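(* Let a wildfire spread in a smooth manifold $M$ under a wind $W$ which is a smooth vector field, the propagation being governed by the Randers metric $F$ with Zermelo data $(h;W)$. Let $A$ be the wavefront at time $0$. Then: (i) If all points of $M$ have the same priority, then for any given time $\tau$ the strategic path until time $\tau$ is the unit speed $F$-geodesic $\gamma_F(t)$ that starts on $A$ and is $F$-orthogonal to $A$, provided that $|\gamma_F(\tau)-\gamma_F(0)|$ (Euclidean norm) is maximal among all such $F$-geodesics. (ii) Given any point $q$ belonging to the wavefront at time $\tau$, the strategic path which reaches $q$ is the unit speed $F$-geodesic $\gamma_F(t)$ that starts on $A$, is $F$-orthogonal to $A$, and satisfies $\gamma_F(\tau)=q$. (iii) Given any area $B\subset M$, the strategic path that meets $B$ for the first time is the unit speed $F$-geodesic $\gamma_F(t)$ which starts on $A$, is $F$-orthogonal to $A$, and satisfies $\gamma_F(\tau)=q$. Here $\tau$ is the time of the wavefront that intersects $B$ for the first time and $q$ is the point of intersection.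
   Context: Zermelo data: for a Riemannian metric $h$ and a vector field $W$ on $M$ with $h(W,W)<1$, the Randers metric with Zermelo data $(h;W)$ is $F(V)=\frac{\sqrt{h(W,V)^2+\lambda h(V,V)}-h(W,V)}{\lambda}$, $\lambda=1-h(W,W)$; equivalently $F$ is positively homogeneous and $F(V)=1$ iff $h(V-W,V-W)=1$. In part (i), $M$ is an open subset of some $\mathbb{R}^n$ so that the Euclidean norm makes sense. Distance: $d(p,q)$ is the infimum of $\int_0^1F(\gamma'(t))dt$ over piecewise smooth curves in $M$ from $p$ to $q$; $d(A,q)=\inf_{p\in A}d(p,q)$ and $\rho(q)=d(A,q)$. An $F$-geodesic is a smooth curve that is locally the shortest-time path between nearby points on it; unit speed means $F(\gamma')=1$. A nonzero $V$ is $F$-orthogonal to $A$ if $g_V(V,U)=0$ for all $U$ tangent to $A$, with $g_V(V,U)=\frac12\frac{\partial^2}{\partial t\partial s}F^2(V+tV+sU)|_{s=t=0}$; a geodesic $\gamma$ starting on $A$ is $F$-orthogonal to $A$ if $\gamma'(0)$ is. Fire model: the fire starts at time $0$ from $A$, a compact smooth submanifold of $M$ (possibly a point). The wavefront at time $\tau$ is $\rho^{-1}(\tau)$. A wave ray from $A$ is a unit-speed shortest-time path from $A$: $\gamma(0)\in A$ and $d(A,\gamma(t))=t$ for the times considered. Strategic paths (there may be more than one): if all points of $M$ have the same priority, a strategic path until time $\tau$ is a wave ray $\gamma$ along which the fire advances most, i.e. whose Euclidean displacement $|\gamma(\tau)-\gamma(0)|$ is maximal among all wave rays joining $A$ to the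 wavefront at time $\tau$. For a given point $q$, it is a wave ray from $A$ that reaches $q$ at the time of the wavefront containing $q$. For a given area $B$, it is a wave ray from $A$ along which the fire meets $B$ (its frontier) for the first time. Standing assumption (the fire is stopped before cut loci or singularities appear): all times lie in $(0,r]$, where $r$ is such that every unit-speed $F$-geodesic leaving $A$ $F$-orthogonally is defined on $[0,r]$ and satisfies $d(A,\gamma(t))=t$ there, and every $q$ with $0<\rho(q)\le r$ is reached by exactly one such geodesic at time $\rho(q)$. *)

theory Defs
  imports "HOL-Analysis.Analysis"
begin

section \<open>Smooth maps between Euclidean spaces\<close>

text \<open>
  Derivatives are taken within \<open>S\<close>, so that the notion makes sense both for open \<open>S\<close> and for
  (relatively open parts of) nondegenerate closed intervals, where it means one-sided derivatives
  at the end points.  It is only used for such \<open>S\<close>, on which derivatives are unique.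
\<close>

primrec Ck_on :: "nat \<Rightarrow> 'a::real_normed_vector set \<Rightarrow> ('a \<Rightarrow> 'b::real_normed_vector) \<Rightarrow> bool" where
  "Ck_on 0 S f \<longleftrightarrow> continuous_on S f"
| "Ck_on (Suc k) S f \<longleftrightarrow>
     f differentiable_on S \<and> (\<forall>v. Ck_on k S (\<lambda>x. frechet_derivative f (at x within S) v))"

definition smooth_on :: "'a::real_normed_vector set \<Rightarrow> ('a \<Rightarrow> 'b::real_normed_vector) \<Rightarrow> bool" where
  "smooth_on S f \<longleftrightarrow> (\<forall>k. Ck_on k S f)"


section \<open>Smooth manifolds\<close>

text \<open>
  A chart is a pair of its domain and a coordinate map; the values of the coordinate map outside
  the domain are irrelevant.
\<close>

type_synonym ('m, 'e) chart = "'m set \<times> ('m \<Rightarrow> 'e)"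

definition is_chart :: "'m topology \<Rightarrow> ('m, 'e::euclidean_space) chart \<Rightarrow> bool" where
  "is_chart X = (\<lambda>(U, \<phi>). openin X U \<and> open (\<phi> ` U) \<and>
     homeomorphic_map (subtopology X U) (top_of_set (\<phi> ` U)) \<phi>)"

definition transition :: "('m, 'e) chart \<Rightarrow> ('m, 'e) chart \<Rightarrow> 'e \<Rightarrow> 'e" where
  "transition c c' = snd c' \<circ> inv_into (fst c) (snd c)"

definition smooth_transition ::
    "('m, 'e::euclidean_space) chart \<Rightarrow> ('m, 'e) chart \<Rightarrow> bool" where
  "smooth_transition c c' \<longleftrightarrow> smooth_on (snd c ` (fst c \<inter> fst c')) (transition c c')"

text \<open>The atlas of a smooth manifold is required to be maximal.\<close>

definition smooth_manifold :: "'m topology \<Rightarrow> ('m, 'e::euclidean_space) chart set \<Rightarrow> bool" where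
  "smooth_manifold X \<A> \<longleftrightarrow>
     Hausdorff_space X \<and> second_countable X \<and>
     (\<forall>c\<in>\<A>. is_chart X c) \<and> (\<Union>c\<in>\<A>. fst c) = topspace X \<and>
     (\<forall>c\<in>\<A>. \<forall>c'\<in>\<A>. smooth_transition c c') \<and>
     (\<forall>c. is_chart X c \<and> (\<forall>c'\<in>\<A>. smooth_transition c c' \<and> smooth_transition c' c) \<longrightarrow> c \<in> \<A>)"

text \<open>
  A tangent vector at \<open>p\<close> is given by its coordinates in all charts around \<open>p\<close>, related by the
  Jacobians of the transition maps (and set to \<open>0\<close> in the other charts).
\<close>

type_synonym ('m, 'e) tvec = "('m, 'e) chart \<Rightarrow> 'e"

definition charts_at :: "('m, 'e) chart set \<Rightarrow> 'm \<Rightarrow> ('m, 'e) chart set" where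
  "charts_at \<A> p = {c \<in> \<A>. p \<in> fst c}"

definition tangent_space ::
    "('m, 'e::euclidean_space) chart set \<Rightarrow> 'm \<Rightarrow> ('m, 'e) tvec set" where
  "tangent_space \<A> p = {v.
     (\<forall>c\<in>charts_at \<A> p. \<forall>c'\<in>charts_at \<A> p.
        v c' = frechet_derivative (transition c c') (at (snd c p)) (v c)) \<and>
     (\<forall>c. c \<notin> charts_at \<A> p \<longrightarrow> v c = 0)}"

definition tv_add :: "('m, 'e::euclidean_space) tvec \<Rightarrow> ('m, 'e) tvec \<Rightarrow> ('m, 'e) tvec" where
  "tv_add u v = (\<lambda>c. u c + v c)"

definition tv_scale :: "real \<Rightarrow> ('m, 'e::euclidean_space) tvec \<Rightarrow> ('m, 'e) tvec" where
  "tv_scale a v = (\<lambda>c. a *\<^sub>R v c)"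

definition tv_zero :: "('m, 'e::euclidean_space) tvec" where
  "tv_zero = (\<lambda>c. 0)"

text \<open>The tangent vector at \<open>p\<close> whose coordinates in the chart \<open>c\<close> are \<open>u\<close>.\<close>

definition tvec_of ::
    "('m, 'e::euclidean_space) chart set \<Rightarrow> ('m, 'e) chart \<Rightarrow> 'm \<Rightarrow> 'e \<Rightarrow> ('m, 'e) tvec" where
  "tvec_of \<A> c p u = (\<lambda>c'. if c' \<in> charts_at \<A> p
     then frechet_derivative (transition c c') (at (snd c p)) u else 0)"

definition smooth_curve ::
    "'m topology \<Rightarrow> ('m, 'e::euclidean_space) chart set \<Rightarrow> real set \<Rightarrow> (real \<Rightarrow> 'm) \<Rightarrow> bool" where
  "smooth_curve X \<A> I \<gamma> \<longleftrightarrow> continuous_map (top_of_set I) X \<gamma> \<and>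
     (\<forall>(U, \<phi>)\<in>\<A>. smooth_on {t\<in>I. \<gamma> t \<in> U} (\<phi> \<circ> \<gamma>))"

definition velocity ::
    "('m, 'e::euclidean_space) chart set \<Rightarrow> real set \<Rightarrow> (real \<Rightarrow> 'm) \<Rightarrow> real \<Rightarrow> ('m, 'e) tvec" where
  "velocity \<A> I \<gamma> t = (\<lambda>c. if c \<in> charts_at \<A> (\<gamma> t)
     then vector_derivative (snd c \<circ> \<gamma>) (at t within I) else 0)"

text \<open>Embedded submanifolds (without boundary), by slice charts.\<close>

definition submanifold :: "('m, 'e::euclidean_space) chart set \<Rightarrow> 'm set \<Rightarrow> bool" where
  "submanifold \<A> A \<longleftrightarrow> (\<exists>k. \<forall>p\<in>A. \<exists>(U, \<phi>)\<in>\<A>. p \<in> U \<and>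
     (\<exists>L. subspace L \<and> dim L = k \<and> \<phi> ` (U \<inter> A) = \<phi> ` U \<inter> L))"

definition sub_tangent_space ::
    "'m topology \<Rightarrow> ('m, 'e::euclidean_space) chart set \<Rightarrow> 'm set \<Rightarrow> 'm \<Rightarrow> ('m, 'e) tvec set" where
  "sub_tangent_space X \<A> A p = {velocity \<A> {-\<epsilon><..<\<epsilon>} \<gamma> 0 | \<epsilon> \<gamma>.
     \<epsilon> > 0 \<and> smooth_curve X \<A> {-\<epsilon><..<\<epsilon>} \<gamma> \<and> \<gamma> ` {-\<epsilon><..<\<epsilon>} \<subseteq> A \<and> \<gamma> 0 = p}"


section \<open>Zermelo data and the Randers metric\<close>

text \<open>Smoothness of tensor fields is smoothness of their components in every chart.\<close>

definition riemannian_metric ::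
    "('m, 'e::euclidean_space) chart set \<Rightarrow> ('m \<Rightarrow> ('m, 'e) tvec \<Rightarrow> ('m, 'e) tvec \<Rightarrow> real) \<Rightarrow> bool" where
  "riemannian_metric \<A> h \<longleftrightarrow>
     (\<forall>p\<in>(\<Union>c\<in>\<A>. fst c).
        (\<forall>u\<in>tangent_space \<A> p. \<forall>v\<in>tangent_space \<A> p. \<forall>w\<in>tangent_space \<A> p. \<forall>a b.
           h p (tv_add (tv_scale a u) (tv_scale b v)) w = a * h p u w + b * h p v w) \<and>
        (\<forall>u\<in>tangent_space \<A> p. \<forall>v\<in>tangent_space \<A> p. h p u v = h p v u) \<and>
        (\<forall>u\<in>tangent_space \<A> p. u \<noteq> tv_zero \<longrightarrow> h p u u > 0)) \<and>
     (\<forall>(U, \<phi>)\<in>\<A>. \<forall>u v. smooth_on (\<phi> ` U)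
        (\<lambda>x. let p = inv_into U \<phi> x in h p (tvec_of \<A> (U, \<phi>) p u) (tvec_of \<A> (U, \<phi>) p v)))"

definition smooth_vector_field ::
    "('m, 'e::euclidean_space) chart set \<Rightarrow> ('m \<Rightarrow> ('m, 'e) tvec) \<Rightarrow> bool" where
  "smooth_vector_field \<A> W \<longleftrightarrow>
     (\<forall>p\<in>(\<Union>c\<in>\<A>. fst c). W p \<in> tangent_space \<A> p) \<and>
     (\<forall>(U, \<phi>)\<in>\<A>. smooth_on (\<phi> ` U) (\<lambda>x. W (inv_into U \<phi> x) (U, \<phi>)))"

definition randers_metric ::
    "('m \<Rightarrow> ('m, 'e) tvec \<Rightarrow> ('m, 'e) tvec \<Rightarrow> real) \<Rightarrow> ('m \<Rightarrow> ('m, 'e) tvec) \<Rightarrow>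
     'm \<Rightarrow> ('m, 'e) tvec \<Rightarrow> real" where
  "randers_metric h W p V = (let l = 1 - h p (W p) (W p) in
     (sqrt ((h p (W p) V)\<^sup>2 + l * h p V V) - h p (W p) V) / l)"

definition fundamental_tensor ::
    "('m \<Rightarrow> ('m, 'e::euclidean_space) tvec \<Rightarrow> real) \<Rightarrow> 'm \<Rightarrow>
     ('m, 'e) tvec \<Rightarrow> ('m, 'e) tvec \<Rightarrow> ('m, 'e) tvec \<Rightarrow> real" where
  "fundamental_tensor F p V Z U = 1 / 2 *
     deriv (\<lambda>t. deriv (\<lambda>s. (F p (tv_add V (tv_add (tv_scale t Z) (tv_scale s U))))\<^sup>2) 0) 0"

definition F_orthogonal ::
    "'m topology \<Rightarrow> ('m, 'e::euclidean_space) chart set \<Rightarrow> ('m \<Rightarrow> ('m, 'e) tvec \<Rightarrow> real) \<Rightarrow>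
     'm set \<Rightarrow> 'm \<Rightarrow> ('m, 'e) tvec \<Rightarrow> bool" where
  "F_orthogonal X \<A> F A p V \<longleftrightarrow> V \<noteq> tv_zero \<and>
     (\<forall>U\<in>sub_tangent_space X \<A> A p. fundamental_tensor F p V V U = 0)"


section \<open>Distance and geodesics\<close>

text \<open>
  \<open>piecewise P a b\<close>: the interval from \<open>a\<close> to \<open>b\<close> has a finite subdivision into closed
  intervals satisfying \<open>P\<close>.
\<close>

definition piecewise :: "(real set \<Rightarrow> bool) \<Rightarrow> real \<Rightarrow> real \<Rightarrow> bool" where
  "piecewise P a b \<longleftrightarrow> (\<exists>(n::nat) s. s 0 = a \<and> s n = b \<and>
     (\<forall>i<n. s i < s (Suc i) \<and> P {s i..s (Suc i)}))"

text \<open>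
  Velocities do not exist at the finitely many corners of a piecewise smooth curve; these do not
  influence the integral.
\<close>

definition travel_time ::
    "('m, 'e::euclidean_space) chart set \<Rightarrow> ('m \<Rightarrow> ('m, 'e) tvec \<Rightarrow> real) \<Rightarrow>
     real \<Rightarrow> real \<Rightarrow> (real \<Rightarrow> 'm) \<Rightarrow> real" where
  "travel_time \<A> F a b \<gamma> = integral {a..b} (\<lambda>t. F (\<gamma> t) (velocity \<A> {a..b} \<gamma> t))"

text \<open>Distances are extended reals, infinite between points that no curve joins.\<close>

definition fdist ::
    "'m topology \<Rightarrow> ('m, 'e::euclidean_space) chart set \<Rightarrow> ('m \<Rightarrow> ('m, 'e) tvec \<Rightarrow> real) \<Rightarrow>
     'm \<Rightarrow> 'm \<Rightarrow> ereal" where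
  "fdist X \<A> F p q =
     (INF \<gamma>\<in>{\<gamma>. piecewise (\<lambda>I. smooth_curve X \<A> I \<gamma>) 0 1 \<and> \<gamma> 0 = p \<and> \<gamma> 1 = q}.
        ereal (travel_time \<A> F 0 1 \<gamma>))"

definition fdist_from ::
    "'m topology \<Rightarrow> ('m, 'e::euclidean_space) chart set \<Rightarrow> ('m \<Rightarrow> ('m, 'e) tvec \<Rightarrow> real) \<Rightarrow>
     'm set \<Rightarrow> 'm \<Rightarrow> ereal" where
  "fdist_from X \<A> F A q = (INF p\<in>A. fdist X \<A> F p q)"

definition unit_speed ::
    "('m, 'e::euclidean_space) chart set \<Rightarrow> ('m \<Rightarrow> ('m, 'e) tvec \<Rightarrow> real) \<Rightarrow>
     real set \<Rightarrow> (real \<Rightarrow> 'm) \<Rightarrow> bool" where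
  "unit_speed \<A> F I \<gamma> \<longleftrightarrow> (\<forall>t\<in>I. F (\<gamma> t) (velocity \<A> I \<gamma> t) = 1)"

definition F_geodesic ::
    "'m topology \<Rightarrow> ('m, 'e::euclidean_space) chart set \<Rightarrow> ('m \<Rightarrow> ('m, 'e) tvec \<Rightarrow> real) \<Rightarrow>
     real \<Rightarrow> real \<Rightarrow> (real \<Rightarrow> 'm) \<Rightarrow> bool" where
  "F_geodesic X \<A> F a b \<gamma> \<longleftrightarrow> smooth_curve X \<A> {a..b} \<gamma> \<and>
     (\<forall>t\<in>{a..b}. \<exists>\<epsilon>>0. \<forall>s\<in>{a..b}. \<forall>u\<in>{a..b}.
        \<bar>s - t\<bar> < \<epsilon> \<and> \<bar>u - t\<bar> < \<epsilon> \<and> s < u \<longrightarrow>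
        fdist X \<A> F (\<gamma> s) (\<gamma> u) = ereal (travel_time \<A> F s u \<gamma>))"

text \<open>Unit speed geodesics on \<open>[0, \<tau>]\<close> that start on \<open>A\<close> and are \<open>F\<close>-orthogonal to \<open>A\<close>.\<close>

definition normal_geodesic ::
    "'m topology \<Rightarrow> ('m, 'e::euclidean_space) chart set \<Rightarrow> ('m \<Rightarrow> ('m, 'e) tvec \<Rightarrow> real) \<Rightarrow>
     'm set \<Rightarrow> real \<Rightarrow> (real \<Rightarrow> 'm) \<Rightarrow> bool" where
  "normal_geodesic X \<A> F A \<tau> \<gamma> \<longleftrightarrow>
     F_geodesic X \<A> F 0 \<tau> \<gamma> \<and> unit_speed \<A> F {0..\<tau>} \<gamma> \<and>
     \<gamma> 0 \<in> A \<and> F_orthogonal X \<A> F A (\<gamma> 0) (velocity \<A> {0..\<tau>} \<gamma> 0)"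


section \<open>Fire spread\<close>

definition wavefront ::
    "'m topology \<Rightarrow> ('m, 'e::euclidean_space) chart set \<Rightarrow> ('m \<Rightarrow> ('m, 'e) tvec \<Rightarrow> real) \<Rightarrow>
     'm set \<Rightarrow> real \<Rightarrow> 'm set" where
  "wavefront X \<A> F A \<tau> = {q \<in> topspace X. fdist_from X \<A> F A q = ereal \<tau>}"

text \<open>
  Wave rays range over the same curves as the distance does, i.e. they may a priori have corners;
  unit speed is required on each smooth piece.
\<close>

definition wave_ray ::
    "'m topology \<Rightarrow> ('m, 'e::euclidean_space) chart set \<Rightarrow> ('m \<Rightarrow> ('m, 'e) tvec \<Rightarrow> real) \<Rightarrow>
     'm set \<Rightarrow> real \<Rightarrow> (real \<Rightarrow> 'm) \<Rightarrow> bool" where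
  "wave_ray X \<A> F A \<tau> \<gamma> \<longleftrightarrow>
     piecewise (\<lambda>I. smooth_curve X \<A> I \<gamma> \<and> unit_speed \<A> F I \<gamma>) 0 \<tau> \<and>
     \<gamma> 0 \<in> A \<and> (\<forall>t\<in>{0..\<tau>}. fdist_from X \<A> F A (\<gamma> t) = ereal t)"

text \<open>
  The manifold is an open subset of a Euclidean space via the global chart \<open>x\<close> (which is the
  identity if it literally is such a subset); the Euclidean norm is taken in that chart.
\<close>

definition strategic_path_until ::
    "'m topology \<Rightarrow> ('m, 'e::euclidean_space) chart set \<Rightarrow> ('m \<Rightarrow> ('m, 'e) tvec \<Rightarrow> real) \<Rightarrow>
     'm set \<Rightarrow> ('m \<Rightarrow> 'e) \<Rightarrow> real \<Rightarrow> (real \<Rightarrow> 'm) \<Rightarrow> bool" where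
  "strategic_path_until X \<A> F A x \<tau> \<gamma> \<longleftrightarrow> wave_ray X \<A> F A \<tau> \<gamma> \<and>
     (\<forall>\<sigma>. wave_ray X \<A> F A \<tau> \<sigma> \<longrightarrow> norm (x (\<sigma> \<tau>) - x (\<sigma> 0)) \<le> norm (x (\<gamma> \<tau>) - x (\<gamma> 0)))"

definition strategic_path_to_point ::
    "'m topology \<Rightarrow> ('m, 'e::euclidean_space) chart set \<Rightarrow> ('m \<Rightarrow> ('m, 'e) tvec \<Rightarrow> real) \<Rightarrow>
     'm set \<Rightarrow> 'm \<Rightarrow> real \<Rightarrow> (real \<Rightarrow> 'm) \<Rightarrow> bool" where
  "strategic_path_to_point X \<A> F A q \<tau> \<gamma> \<longleftrightarrow>
     q \<in> wavefront X \<A> F A \<tau> \<and> wave_ray X \<A> F A \<tau> \<gamma> \<and> \<gamma> \<tau> = q"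

text \<open>
  The first contact of the fire with an area \<open>B\<close> takes place at the frontier of \<open>B\<close>, which need
  not belong to \<open>B\<close> (e.g. if \<open>B\<close> is open).  Hence \<open>B\<close> is met as soon as its closure is.
\<close>

definition first_meeting_time ::
    "'m topology \<Rightarrow> ('m, 'e::euclidean_space) chart set \<Rightarrow> ('m \<Rightarrow> ('m, 'e) tvec \<Rightarrow> real) \<Rightarrow>
     'm set \<Rightarrow> 'm set \<Rightarrow> real \<Rightarrow> bool" where
  "first_meeting_time X \<A> F A B \<tau> \<longleftrightarrow>
     wavefront X \<A> F A \<tau> \<inter> X closure_of B \<noteq> {} \<and>
     (\<forall>s\<in>{0..<\<tau>}. wavefront X \<A> F A s \<inter> X closure_of B = {})"

definition strategic_path_to_area ::
    "'m topology \<Rightarrow> ('m, 'e::euclidean_space) chart set \<Rightarrow> ('m \<Rightarrow> ('m, 'e) tvec \<Rightarrow> real) \<Rightarrow>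
     'm set \<Rightarrow> 'm set \<Rightarrow> real \<Rightarrow> (real \<Rightarrow> 'm) \<Rightarrow> bool" where
  "strategic_path_to_area X \<A> F A B \<tau> \<gamma> \<longleftrightarrow>
     first_meeting_time X \<A> F A B \<tau> \<and> wave_ray X \<A> F A \<tau> \<gamma> \<and> \<gamma> \<tau> \<in> X frontier_of B"

text \<open>
  The standing assumption that the fire is stopped at time \<open>r\<close>, before cut loci appear.  Curves
  are total functions, hence a normal geodesic is defined on \<open>[0, r]\<close> if its values on its
  interval of definition extend to a normal geodesic on \<open>[0, r]\<close>.
\<close>

definition no_cut_loci_until ::
    "'m topology \<Rightarrow> ('m, 'e::euclidean_space) chart set \<Rightarrow> ('m \<Rightarrow> ('m, 'e) tvec \<Rightarrow> real) \<Rightarrow>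
     'm set \<Rightarrow> real \<Rightarrow> bool" where
  "no_cut_loci_until X \<A> F A r \<longleftrightarrow>
     (\<forall>\<epsilon>>0. \<forall>\<gamma>. normal_geodesic X \<A> F A \<epsilon> \<gamma> \<longrightarrow>
        (\<exists>\<sigma>. normal_geodesic X \<A> F A r \<sigma> \<and> (\<forall>t\<in>{0..min \<epsilon> r}. \<sigma> t = \<gamma> t) \<and>
             (\<forall>t\<in>{0..r}. fdist_from X \<A> F A (\<sigma> t) = ereal t))) \<and>
     (\<forall>q\<in>topspace X. \<forall>\<tau>. 0 < \<tau> \<and> \<tau> \<le> r \<and> fdist_from X \<A> F A q = ereal \<tau> \<longrightarrow>
        (\<exists>\<gamma>. normal_geodesic X \<A> F A r \<gamma> \<and> \<gamma> \<tau> = q \<and>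
             (\<forall>\<sigma>. normal_geodesic X \<A> F A r \<sigma> \<and> \<sigma> \<tau> = q \<longrightarrow> (\<forall>t\<in>{0..r}. \<sigma> t = \<gamma> t))))"

end

theory Submission
  imports Defs
begin

text \<open>
  All three parts follow from one equivalence, \<open>wave_ray_iff_normal_geodesic\<close>: up to time \<open>r\<close>, the wave
  rays from \<open>A\<close> are exactly the unit speed geodesics that leave \<open>A\<close> orthogonally.  Existence and uniqueness
  of strategic paths are then existence and uniqueness of the normal geodesic through a point of the
  wavefront, which the absence of cut loci provides.  For an area \<open>B\<close> one also needs that a point of first
  contact lies on the frontier of \<open>B\<close>: a ray that ends in the interior would have met \<open>B\<close> before.

  The absence of cut loci says that normal geodesics are wave rays.  The converse has to deal with rays
  that are only piecewise smooth.  The first smooth piece of a ray minimises between its points and is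
  orthogonal to \<open>A\<close> by a first order variation of its starting point, so it is a normal geodesic and
  extends to a normal geodesic \<open>\<sigma>\<close> on \<open>{0..r}\<close>.  It remains to see that the ray never departs from \<open>\<sigma>\<close>.  Suppose
  that they agree until time \<open>T\<close>.  There is no corner between them at \<open>T\<close>, since a short cut would exist by
  strict convexity of the unit balls of \<open>F\<close> (\<open>no_corner\<close>).  So they have the same velocity at \<open>T\<close>, and what
  is needed is that minimising curves with a common initial part do not branch (\<open>no_branching\<close>).

  This is shown without geodesic equations.  Let \<open>\<eta>\<close> be the difference of the two curves in a chart, which
  is \<open>0\<close> until \<open>T\<close>, and let \<open>lin\<close> be the linear function on \<open>{T-\<delta>..T+\<delta>}\<close> from \<open>0\<close> to \<open>\<eta> (T + \<delta>)\<close>.  Replace the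
  pair of curves \<open>\<sigma>, \<sigma> + \<eta>\<close> by the pair \<open>\<sigma> + (\<eta> - lin) / 2, \<sigma> + (\<eta> + lin) / 2\<close>, which has the same starting point
  and the same end points.  The sum of the displacements being the same for both pairs, first order terms
  cancel in the sum of the travel times, and strict convexity of \<open>F\<close> makes the new pair faster by
  a multiple of \<open>\<integral>|\<eta>'|\<^sup>2 - \<integral>|lin'|\<^sup>2\<close>, up to smaller terms.  As \<open>lin\<close> has twice as much time for its displacement as
  \<open>\<eta>\<close>, this is at least half of \<open>\<integral>|\<eta>'|\<^sup>2\<close>.  But the curves are minimising, whence \<open>\<eta> = 0\<close>.

  For the second order estimate it is convenient that \<open>F\<close> comes from Zermelo data.  A vector \<open>v\<close> has unit
  length iff \<open>P = h(v - W, v - W) - 1\<close> vanishes, and \<open>F - 1 \<le> P / (2 D)\<close> with \<open>D = 1 + h(W, v - W)\<close>, where both sides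
  vanish for unit vectors (\<open>cost_le\<close>, \<open>unit_cost\<close>).  Both \<open>P\<close> and \<open>D\<close> are values of one bilinear form on pairs \<open>(v, f)\<close> of a vector and
  a time, with smooth coefficients, so that only first and second differences of its coefficients enter (\<open>swap_estimate\<close>).
\<close>

section \<open>Calculus of smooth maps\<close>

text \<open>
  The condition under which Frechet derivatives within \<open>S\<close> are unique.  Open sets satisfy it, and so
  do relatively open parts of a nondegenerate interval, which is where pieces of curves live.
\<close>

definition thick :: "'a::euclidean_space set \<Rightarrow> bool" where
  "thick S \<longleftrightarrow> (\<forall>x\<in>S. \<forall>i\<in>Basis. \<forall>e>0. \<exists>d. 0 < \<bar>d\<bar> \<and> \<bar>d\<bar> < e \<and> x + d *\<^sub>R i \<in> S)"

lemma frechet_derivative_within_eq: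
  assumes "(f has_derivative f') (at x within S)" "thick S" "x \<in> S"
  shows "frechet_derivative f (at x within S) = f'"
proof -
  have "(f has_derivative frechet_derivative f (at x within S)) (at x within S)"
    using assms(1) by (meson differentiableI frechet_derivative_works)
  then show ?thesis
    using frechet_derivative_unique_within[OF _ assms(1)] assms(2,3) unfolding thick_def by blast
qed

lemma thick_open:
  assumes "open S"
  shows "thick S"
  unfolding thick_def
proof (intro ballI allI impI)
  fix x i :: 'a and e :: real
  assume "x \<in> S" "i \<in> Basis" "e > 0"
  obtain d where d: "d > 0" "ball x d \<subseteq> S"
    using assms \<open>x \<in> S\<close> open_contains_ball by blast
  have "dist x (x + (min d e / 2) *\<^sub>R i) < d"
    using d \<open>e > 0\<close> \<open>i \<in> Basis\<close> by (simp add: dist_norm)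
  then show "\<exists>d. 0 < \<bar>d\<bar> \<and> \<bar>d\<bar> < e \<and> x + d *\<^sub>R i \<in> S"
    using d \<open>e > 0\<close> by (intro exI[of _ "min d e / 2"]) auto
qed

lemma thick_interval:
  fixes a b :: real
  assumes "a < b" "openin (top_of_set {a..b}) J"
  shows "thick J"
  unfolding thick_def
proof (intro ballI allI impI)
  fix x i e :: real
  assume x: "x \<in> J" and i: "i \<in> Basis" and e: "e > 0"
  obtain T where T: "open T" "J = {a..b} \<inter> T"
    using assms(2) by (auto simp: openin_open)
  obtain d where d: "d > 0" "ball x d \<subseteq> T"
    using T x open_contains_ball by blast
  define m where "m = min (min d e) (b - a) / 2"
  have m: "m > 0" "m < d" "m < e" "2 * m \<le> b - a"
    using d e assms(1) by (auto simp: m_def)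
  have "x + m \<in> J \<or> x - m \<in> J"
  proof (cases "x + m \<le> b")
    case True
    then have "x + m \<in> J"
      using T x d(2) m by (auto simp: subset_eq dist_norm)
    then show ?thesis ..
  next
    case False
    then have "x - m \<in> J"
      using T x d(2) m by (auto simp: subset_eq dist_norm)
    then show ?thesis ..
  qed
  then show "\<exists>d. 0 < \<bar>d\<bar> \<and> \<bar>d\<bar> < e \<and> x + d *\<^sub>R i \<in> J"
    using i m by (auto intro: exI[of _ m] exI[of _ "-m"])
qed

lemma thick_Icc: "a < b \<Longrightarrow> thick {a..b::real}"
  by (rule thick_interval) auto

lemma Ck_on_cong:
  assumes "\<And>x. x \<in> S \<Longrightarrow> f x = g x"
  shows "Ck_on k S f \<longleftrightarrow> Ck_on k S g"
  using assms
proof (induction k arbitrary: f g)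
  case 0
  then show ?case using continuous_on_cong[of S S f g] by auto
next
  case (Suc k)
  have *: "(f has_derivative D) (at x within S) \<longleftrightarrow> (g has_derivative D) (at x within S)"
    if "x \<in> S" for x D
    using has_derivative_transform[OF that, of f g] has_derivative_transform[OF that, of g f]
      Suc.prems by fastforce
  then have "frechet_derivative f (at x within S) = frechet_derivative g (at x within S)"
    if "x \<in> S" for x
    using that unfolding frechet_derivative_def by presburger
  moreover have "f differentiable_on S \<longleftrightarrow> g differentiable_on S"
    using * unfolding differentiable_on_def differentiable_def by blast
  ultimately show ?case
    using Suc.IH[of "\<lambda>x. frechet_derivative f (at x within S) v"
        "\<lambda>x. frechet_derivative g (at x within S) v" for v] by simp
qed

lemma Ck_on_SucI:
  assumes "thick S" "\<And>x. x \<in> S \<Longrightarrow> (f has_derivative f' x) (at x within S)"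
    and "\<And>v. Ck_on k S (\<lambda>x. f' x v)"
  shows "Ck_on (Suc k) S f"
proof -
  have "f differentiable_on S"
    using assms(2) by (meson differentiableI differentiable_on_def)
  moreover have "Ck_on k S (\<lambda>x. frechet_derivative f (at x within S) v)" for v
    using assms(3)[of v] frechet_derivative_within_eq[OF assms(2,1)]
    by (subst Ck_on_cong) auto
  ultimately show ?thesis by simp
qed

lemma Ck_on_SucE:
  assumes "Ck_on (Suc k) S f"
  obtains f' where "\<And>x. x \<in> S \<Longrightarrow> (f has_derivative f' x) (at x within S)"
    and "\<And>v. Ck_on k S (\<lambda>x. f' x v)"
proof
  show "\<And>x. x \<in> S \<Longrightarrow> (f has_derivative frechet_derivative f (at x within S)) (at x within S)"
    using assms by (simp add: differentiable_on_def frechet_derivative_works)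
  show "\<And>v. Ck_on k S (\<lambda>x. frechet_derivative f (at x within S) v)"
    using assms by simp
qed

lemma Ck_on_SucD: "Ck_on (Suc k) S f \<Longrightarrow> Ck_on k S f"
proof (induction k arbitrary: f)
  case 0
  then show ?case by (simp add: differentiable_imp_continuous_on)
next
  case (Suc k)
  from Suc.prems have d: "f differentiable_on S"
    and D: "\<And>v. Ck_on (Suc k) S (\<lambda>x. frechet_derivative f (at x within S) v)"
    by (simp_all only: Ck_on.simps(2)[of "Suc k" S f])
  show ?case
    unfolding Ck_on.simps(2)[of k S f] using d Suc.IH[OF D] by blast
qed

lemma Ck_on_mono: "k \<le> l \<Longrightarrow> Ck_on l S f \<Longrightarrow> Ck_on k S f"
proof (induction rule: inc_induct)
  case (step n)
  then show ?case by (blast intro: Ck_on_SucD)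
qed

lemma Ck_on_continuous: "Ck_on k S f \<Longrightarrow> continuous_on S f"
  using Ck_on_mono[of 0 k S f] by simp

lemma Ck_on_subset:
  assumes "Ck_on k S f" "T \<subseteq> S" "thick T"
  shows "Ck_on k T f"
  using assms(1)
proof (induction k arbitrary: f)
  case 0
  then show ?case using assms(2) by (auto intro: continuous_on_subset)
next
  case (Suc k)
  obtain f' where f': "\<And>x. x \<in> S \<Longrightarrow> (f has_derivative f' x) (at x within S)"
    "\<And>v. Ck_on k S (\<lambda>x. f' x v)"
    using Ck_on_SucE[OF Suc.prems] by blast
  show ?case
    by (rule Ck_on_SucI[OF assms(3), of _ f'])
      (use f' assms(2) Suc.IH in \<open>auto intro: has_derivative_subset\<close>)
qed

lemma Ck_on_const: "thick S \<Longrightarrow> Ck_on k S (\<lambda>x. c)"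
proof (induction k arbitrary: c)
  case (Suc k)
  show ?case
    by (rule Ck_on_SucI[OF Suc.prems, of _ "\<lambda>_ _. 0"]) (use Suc in auto)
qed simp

lemma Ck_on_bounded_linear:
  assumes "bounded_linear f" "thick S"
  shows "Ck_on k S f"
proof (cases k)
  case 0
  then show ?thesis using assms by (simp add: linear_continuous_on)
next
  case (Suc l)
  show ?thesis unfolding Suc
    by (rule Ck_on_SucI[OF assms(2), of _ "\<lambda>_. f"])
      (use assms bounded_linear.has_derivative[OF assms(1) has_derivative_ident] Ck_on_const[OF assms(2)] in auto)
qed

lemma Ck_on_add:
  assumes "thick S" "Ck_on k S f" "Ck_on k S g"
  shows "Ck_on k S (\<lambda>x. f x + g x)"
  using assms(2,3)
proof (induction k arbitrary: f g)
  case 0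
  then show ?case by (auto intro: continuous_intros)
next
  case (Suc k)
  obtain f' where f': "\<And>x. x \<in> S \<Longrightarrow> (f has_derivative f' x) (at x within S)"
    "\<And>v. Ck_on k S (\<lambda>x. f' x v)"
    using Ck_on_SucE[OF Suc.prems(1)] by blast
  obtain g' where g': "\<And>x. x \<in> S \<Longrightarrow> (g has_derivative g' x) (at x within S)"
    "\<And>v. Ck_on k S (\<lambda>x. g' x v)"
    using Ck_on_SucE[OF Suc.prems(2)] by blast
  show ?case
    by (rule Ck_on_SucI[OF assms(1), of _ "\<lambda>x v. f' x v + g' x v"])
      (use f' g' Suc.IH in \<open>auto intro: has_derivative_add\<close>)
qed

lemma Ck_on_sum:
  assumes "thick S" "\<And>i. i \<in> I \<Longrightarrow> Ck_on k S (f i)"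
  shows "Ck_on k S (\<lambda>x. \<Sum>i\<in>I. f i x)"
  using assms(2)
  by (induction I rule: infinite_finite_induct) (auto intro: Ck_on_add[OF assms(1)] Ck_on_const[OF assms(1)])

lemma (in bounded_bilinear) Ck_on:
  assumes "thick S" "Ck_on k S f" "Ck_on k S g"
  shows "Ck_on k S (\<lambda>x. prod (f x) (g x))"
  using assms(2,3)
proof (induction k arbitrary: f g)
  case 0
  then show ?case by (auto intro: continuous_on)
next
  case (Suc k)
  obtain f' where f': "\<And>x. x \<in> S \<Longrightarrow> (f has_derivative f' x) (at x within S)"
    "\<And>v. Ck_on k S (\<lambda>x. f' x v)"
    using Ck_on_SucE[OF Suc.prems(1)] by blast
  obtain g' where g': "\<And>x. x \<in> S \<Longrightarrow> (g has_derivative g' x) (at x within S)"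
    "\<And>v. Ck_on k S (\<lambda>x. g' x v)"
    using Ck_on_SucE[OF Suc.prems(2)] by blast
  show ?case
  proof (rule Ck_on_SucI[OF assms(1), of _ "\<lambda>x v. prod (f x) (g' x v) + prod (f' x v) (g x)"])
    show "\<And>v. Ck_on k S (\<lambda>x. prod (f x) (g' x v) + prod (f' x v) (g x))"
      using f' g' Suc.IH Suc.prems by (intro Ck_on_add[OF assms(1)]) (auto dest: Ck_on_SucD simp del: Ck_on.simps)
  qed (rule FDERIV[OF f'(1) g'(1)])
qed

text \<open>
  By the chain rule, the derivative of the composition in direction \<open>v\<close> is the sum over the basis of
  the coordinates of \<open>Df(x) v\<close> times partial derivatives of \<open>g\<close>, again composed with \<open>f\<close>.  These have
  one degree of smoothness less, so the induction on \<open>k\<close> goes through for all \<open>g\<close> at once.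
\<close>

lemma Ck_on_compose:
  fixes f :: "'a::euclidean_space \<Rightarrow> 'b::euclidean_space" and g :: "'b \<Rightarrow> 'c::real_normed_vector"
  assumes "thick S" "Ck_on k T g" "Ck_on k S f" "f ` S \<subseteq> T"
  shows "Ck_on k S (\<lambda>x. g (f x))"
  using assms(2,3)
proof (induction k arbitrary: g)
  case 0
  then show ?case using assms(4) by (auto intro: continuous_on_compose2)
next
  case (Suc k)
  obtain f' where f': "\<And>x. x \<in> S \<Longrightarrow> (f has_derivative f' x) (at x within S)"
    "\<And>v. Ck_on k S (\<lambda>x. f' x v)"
    using Ck_on_SucE[OF Suc.prems(2)] by blast
  obtain g' where g': "\<And>x. x \<in> T \<Longrightarrow> (g has_derivative g' x) (at x within T)"
    "\<And>v. Ck_on k T (\<lambda>x. g' x v)"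
    using Ck_on_SucE[OF Suc.prems(1)] by blast
  show ?case
  proof (rule Ck_on_SucI[OF assms(1), of _ "\<lambda>x v. \<Sum>i\<in>Basis. (f' x v \<bullet> i) *\<^sub>R g' (f x) i"])
    fix x assume x: "x \<in> S"
    have gd: "(g has_derivative g' (f x)) (at (f x) within f ` S)"
      using g'(1) x assms(4) by (meson has_derivative_subset image_subset_iff)
    have "((\<lambda>x. g (f x)) has_derivative (\<lambda>v. g' (f x) (f' x v))) (at x within S)"
      using has_derivative_in_compose[OF f'(1)[OF x] gd] .
    moreover have "g' (f x) (f' x v) = (\<Sum>i\<in>Basis. (f' x v \<bullet> i) *\<^sub>R g' (f x) i)" for v
    proof -
      interpret bounded_linear "g' (f x)" using gd by (rule has_derivative_bounded_linear)
      have "g' (f x) (f' x v) = g' (f x) (\<Sum>i\<in>Basis. (f' x v \<bullet> i) *\<^sub>R i)"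
        by (simp add: euclidean_representation)
      then show ?thesis by (simp add: sum scaleR)
    qed
    ultimately show "((\<lambda>x. g (f x)) has_derivative
        (\<lambda>v. \<Sum>i\<in>Basis. (f' x v \<bullet> i) *\<^sub>R g' (f x) i)) (at x within S)"
      by simp
  next
    fix v
    have f: "Ck_on k S f" using Suc.prems(2) by (rule Ck_on_SucD)
    show "Ck_on k S (\<lambda>x. \<Sum>i\<in>Basis. (f' x v \<bullet> i) *\<^sub>R g' (f x) i)"
      by (intro Ck_on_sum assms(1) bounded_bilinear.Ck_on[OF bounded_bilinear_scaleR]
          bounded_bilinear.Ck_on[OF bounded_bilinear_inner] f' Ck_on_const Suc.IH g' f)
  qed
qed

lemma smooth_on_compose:
  fixes f :: "'a::euclidean_space \<Rightarrow> 'b::euclidean_space" and g :: "'b \<Rightarrow> 'c::real_normed_vector"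
  assumes "thick S" "smooth_on T g" "smooth_on S f" "f ` S \<subseteq> T"
  shows "smooth_on S (\<lambda>x. g (f x))"
  using assms Ck_on_compose unfolding smooth_on_def by blast

lemma smooth_on_subset: "smooth_on S f \<Longrightarrow> T \<subseteq> S \<Longrightarrow> thick T \<Longrightarrow> smooth_on T f"
  unfolding smooth_on_def using Ck_on_subset by blast

lemma smooth_on_cong: "(\<And>x. x \<in> S \<Longrightarrow> f x = g x) \<Longrightarrow> smooth_on S f \<longleftrightarrow> smooth_on S g"
  unfolding smooth_on_def using Ck_on_cong by metis

lemma smooth_on_const: "thick S \<Longrightarrow> smooth_on S (\<lambda>x. c)"
  by (simp add: smooth_on_def Ck_on_const)

lemma smooth_on_bounded_linear: "bounded_linear f \<Longrightarrow> thick S \<Longrightarrow> smooth_on S f"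
  by (simp add: smooth_on_def Ck_on_bounded_linear)

lemma smooth_on_add:
  "thick S \<Longrightarrow> smooth_on S f \<Longrightarrow> smooth_on S g \<Longrightarrow> smooth_on S (\<lambda>x. f x + g x)"
  by (simp add: smooth_on_def Ck_on_add)

lemma smooth_on_sum:
  "thick S \<Longrightarrow> (\<And>i. i \<in> I \<Longrightarrow> smooth_on S (f i)) \<Longrightarrow> smooth_on S (\<lambda>x. \<Sum>i\<in>I. f i x)"
  by (simp add: smooth_on_def Ck_on_sum)

lemma (in bounded_bilinear) smooth_on:
  "thick S \<Longrightarrow> smooth_on S f \<Longrightarrow> smooth_on S g \<Longrightarrow> smooth_on S (\<lambda>x. prod (f x) (g x))"
  by (simp add: smooth_on_def Ck_on)

lemmas smooth_on_mult = bounded_bilinear.smooth_on[OF bounded_bilinear_mult]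
lemmas smooth_on_scaleR = bounded_bilinear.smooth_on[OF bounded_bilinear_scaleR]
lemmas smooth_on_inner = bounded_bilinear.smooth_on[OF bounded_bilinear_inner]

lemma smooth_on_diff:
  assumes "thick S" "smooth_on S f" "smooth_on S g"
  shows "smooth_on S (\<lambda>x. f x - g x)"
proof -
  have "smooth_on S (\<lambda>x. f x + (-1) *\<^sub>R g x)"
    using assms by (intro smooth_on_add smooth_on_scaleR smooth_on_const)
  then show ?thesis by simp
qed

lemma smooth_on_continuous: "smooth_on S f \<Longrightarrow> continuous_on S f"
  unfolding smooth_on_def using Ck_on_continuous by blast

lemma smooth_on_differentiable: "smooth_on S f \<Longrightarrow> f differentiable_on S"
  unfolding smooth_on_def by (metis Ck_on.simps(2))

lemma smooth_on_vector_derivative: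
  fixes f :: "real \<Rightarrow> 'b::real_normed_vector"
  assumes "smooth_on S f"
  obtains f' where "\<And>t. t \<in> S \<Longrightarrow> (f has_vector_derivative f' t) (at t within S)"
    and "continuous_on S f'"
proof -
  have "Ck_on (Suc 0) S f"
    using assms by (simp only: smooth_on_def)
  then obtain f' where f': "\<And>x. x \<in> S \<Longrightarrow> (f has_derivative f' x) (at x within S)"
    "\<And>v. Ck_on 0 S (\<lambda>x. f' x v)"
    using Ck_on_SucE by blast
  have d: "(f has_vector_derivative f' t 1) (at t within S)" if "t \<in> S" for t
  proof -
    interpret bounded_linear "f' t" using f'(1)[OF that] by (rule has_derivative_bounded_linear)
    have "f' t = (\<lambda>h. h *\<^sub>R f' t 1)" by (metis scaleR mult.right_neutral real_scaleR_def)
    then show ?thesis using f'(1)[OF that] by (simp add: has_vector_derivative_def)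
  qed
  have "continuous_on S (\<lambda>t. f' t 1)" using f'(2)[of 1] by simp
  then show thesis using that[of "\<lambda>t. f' t 1"] d by blast
qed

lemma C1_locally_Lipschitz:
  fixes c :: "'a::euclidean_space \<Rightarrow> real"
  assumes "open S" "x0 \<in> S" "Ck_on (Suc 0) S c"
  obtains K r where "r > 0" "K \<ge> 0" "ball x0 r \<subseteq> S"
    "\<And>x y. x \<in> ball x0 r \<Longrightarrow> y \<in> ball x0 r \<Longrightarrow> \<bar>c x - c y\<bar> \<le> K * norm (x - y)"
proof -
  obtain c' where c': "\<And>x. x \<in> S \<Longrightarrow> (c has_derivative c' x) (at x within S)"
    "\<And>v. Ck_on 0 S (\<lambda>x. c' x v)"
    using Ck_on_SucE[OF assms(3)] by blast
  obtain r where r: "r > 0" "cball x0 r \<subseteq> S"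
    using assms open_contains_cball by blast
  have "compact ((\<lambda>x. \<Sum>i\<in>Basis. \<bar>c' x i\<bar>) ` cball x0 r)"
    using c'(2) r by (intro compact_continuous_image continuous_intros)
      (auto intro: continuous_on_subset)
  then obtain K where K: "\<And>x. x \<in> cball x0 r \<Longrightarrow> \<bar>\<Sum>i\<in>Basis. \<bar>c' x i\<bar>\<bar> \<le> K" "K > 0"
    using compact_imp_bounded[THEN bounded_pos[THEN iffD1]] by fastforce
  have bd: "norm (c x - c y) \<le> K * norm (x - y)" if xy: "x \<in> ball x0 r" "y \<in> ball x0 r" for x y
  proof (rule differentiable_bound[OF convex_ball, where f' = c'])
    fix z assume z: "z \<in> ball x0 r"
    then have zS: "z \<in> S" using r by auto
    show d: "(c has_derivative c' z) (at z within ball x0 r)"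
      using c'(1)[OF zS] r by (meson ball_subset_cball has_derivative_subset order_trans)
    interpret bounded_linear "c' z" using d by (rule has_derivative_bounded_linear)
    show "onorm (c' z) \<le> K"
    proof (rule onorm_le)
      fix a :: 'a
      have "c' z a = (\<Sum>i\<in>Basis. (a \<bullet> i) *\<^sub>R c' z i)"
        using euclidean_representation[of a] by (metis (no_types, lifting) scaleR sum sum.cong)
      then have "norm (c' z a) \<le> (\<Sum>i\<in>Basis. \<bar>a \<bullet> i\<bar> * \<bar>c' z i\<bar>)"
        by (simp add: order.trans[OF sum_abs] abs_mult)
      also have "\<dots> \<le> (\<Sum>i\<in>Basis. norm a * \<bar>c' z i\<bar>)"
        by (intro sum_mono mult_right_mono) (auto simp: Basis_le_norm)
      also have "\<dots> \<le> norm a * K"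
        using K(1)[of z] z unfolding sum_distrib_left[symmetric]
        by (intro mult_left_mono) auto
      finally show "norm (c' z a) \<le> K * norm a" by (simp add: mult.commute)
    qed
  qed (use xy in auto)
  show thesis
    by (rule that[of r K]) (use r K bd in auto)
qed

text \<open>
  The mixed second difference of \<open>c\<close> is, by the mean value theorem in direction \<open>a\<close>, a first difference
  in direction \<open>b\<close> of the derivative \<open>Dc(y) a\<close>, which is locally Lipschitz.  These bounds are
  the form in which the smoothness of the metric enters the comparison of travel times to second order.
\<close>

lemma C2_second_difference:
  fixes c :: "'a::euclidean_space \<Rightarrow> real"
  assumes "open S" "x0 \<in> S" "Ck_on (Suc (Suc 0)) S c"
  obtains K r where "r > 0" "K \<ge> 0"
    "\<And>x a b. norm (x - x0) < r \<Longrightarrow> norm a < r \<Longrightarrow> norm b < r \<Longrightarrow>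
       \<bar>c (x + a) - c x\<bar> \<le> K * norm a \<and>
       \<bar>c (x + a + b) - c (x + a) - c (x + b) + c x\<bar> \<le> K * norm a * norm b"
proof -
  obtain c' where c': "\<And>x. x \<in> S \<Longrightarrow> (c has_derivative c' x) (at x within S)"
    "\<And>v. Ck_on (Suc 0) S (\<lambda>x. c' x v)"
    using Ck_on_SucE[OF assms(3)] by blast
  have "\<exists>K r. r > 0 \<and> K \<ge> 0 \<and> ball x0 r \<subseteq> S \<and>
     (\<forall>x\<in>ball x0 r. \<forall>y\<in>ball x0 r. \<bar>c' x i - c' y i\<bar> \<le> K * norm (x - y))" for i
    using C1_locally_Lipschitz[OF assms(1,2) c'(2)[of i]] by metis
  then obtain K1 r1 where 1: "\<And>i. r1 i > 0" "\<And>i. K1 i \<ge> 0" "\<And>i. ball x0 (r1 i) \<subseteq> S"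
     "\<And>i x y. x\<in>ball x0 (r1 i) \<Longrightarrow> y\<in>ball x0 (r1 i) \<Longrightarrow> \<bar>c' x i - c' y i\<bar> \<le> K1 i * norm (x - y)"
    by metis
  obtain K0 r0 where 0: "r0 > 0" "K0 \<ge> 0" "ball x0 r0 \<subseteq> S"
    "\<And>x y. x \<in> ball x0 r0 \<Longrightarrow> y \<in> ball x0 r0 \<Longrightarrow> \<bar>c x - c y\<bar> \<le> K0 * norm (x - y)"
    using C1_locally_Lipschitz[OF assms(1,2) Ck_on_SucD[OF assms(3)]] by metis
  define r where "r = min r0 (Min (r1 ` Basis)) / 3"
  have r: "r > 0" "3 * r \<le> r0" "\<And>i. i \<in> Basis \<Longrightarrow> 3 * r \<le> r1 i"
    using 0(1) 1(1) by (auto simp: r_def min_le_iff_disj)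
  define K where "K = K0 + (\<Sum>i\<in>Basis. K1 i)"
  have sK: "(\<Sum>i\<in>Basis. K1 i) \<ge> 0" using 1 by (simp add: sum_nonneg)
  show thesis
  proof (rule that[of r K])
    fix x a b :: 'a
    assume n: "norm (x - x0) < r" "norm a < r" "norm b < r"
    have inb: "x + s *\<^sub>R a + t *\<^sub>R b \<in> ball x0 (3 * r)" if "s \<in> {0..1}" "t \<in> {0..1}" for s t
    proof -
      have "norm (x + s *\<^sub>R a + t *\<^sub>R b - x0) \<le> norm (x - x0) + (norm (s *\<^sub>R a) + norm (t *\<^sub>R b))"
        by (metis (no_types, opaque_lifting) add.assoc add_diff_eq diff_add_eq norm_triangle_ineq norm_triangle_mono order_refl)
      also have "\<dots> \<le> norm (x - x0) + (norm a + norm b)"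
        using that by (intro add_mono) (auto intro: mult_left_le_one_le)
      finally show ?thesis using n by (simp add: dist_norm norm_minus_commute)
    qed
    have "\<bar>c (x + a) - c x\<bar> \<le> K0 * norm (x + a - x)"
      using inb[of 1 0] inb[of 0 0] r by (intro 0) auto
    also have "\<dots> \<le> K * norm a" using sK by (simp add: K_def mult_right_mono)
    finally have A: "\<bar>c (x + a) - c x\<bar> \<le> K * norm a" .
    define g where "g s = c (x + s *\<^sub>R a + b) - c (x + s *\<^sub>R a)" for s
    have B3: "ball x0 (3 * r) \<subseteq> S" using 0 r by auto
    have gd: "(g has_derivative (\<lambda>h. c' (x + s *\<^sub>R a + b) (h *\<^sub>R a) - c' (x + s *\<^sub>R a) (h *\<^sub>R a)))
       (at s within {0..1})" if s: "s \<in> {0..1}" for s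
    proof -
      have at: "(c has_derivative c' (x + s *\<^sub>R a + t *\<^sub>R b)) (at (x + s *\<^sub>R a + t *\<^sub>R b))"
        if t: "t \<in> {0..1}" for t
        using c'(1) inb[OF s t] B3 at_within_open[OF _ assms(1)] by (metis subsetD)
      have 1: "((\<lambda>s. x + s *\<^sub>R a + b) has_derivative (\<lambda>h. h *\<^sub>R a)) (at s within {0..1})"
        by (auto intro!: derivative_eq_intros)
      have 0: "((\<lambda>s. x + s *\<^sub>R a) has_derivative (\<lambda>h. h *\<^sub>R a)) (at s within {0..1})"
        by (auto intro!: derivative_eq_intros)
      show ?thesis unfolding g_def
        using has_derivative_compose[OF 1] has_derivative_compose[OF 0] at[of 1] at[of 0]
        by (intro has_derivative_diff) auto
    qed
    have "\<exists>s\<in>{0..1}. g 1 - g 0 = c' (x + s *\<^sub>R a + b) ((1 - 0) *\<^sub>R a) - c' (x + s *\<^sub>R a) ((1 - 0) *\<^sub>R a)"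
      by (rule mvt_very_simple[OF _ gd]) auto
    then obtain s where s: "s \<in> {0..1}" "g 1 - g 0 = c' (x + s *\<^sub>R a + b) a - c' (x + s *\<^sub>R a) a"
      by auto
    define y where "y = x + s *\<^sub>R a"
    have y: "y \<in> ball x0 (3 * r)" "y + b \<in> ball x0 (3 * r)"
      using inb[OF s(1), of 0] inb[OF s(1), of 1] by (auto simp: y_def)
    have lin: "c' z a = (\<Sum>i\<in>Basis. (a \<bullet> i) *\<^sub>R c' z i)" if "z \<in> S" for z
    proof -
      interpret bounded_linear "c' z" using c'(1)[OF that] by (rule has_derivative_bounded_linear)
      show ?thesis
        using euclidean_representation[of a] by (metis (no_types, lifting) scaleR sum sum.cong)
    qed
    have "c (x + a + b) - c (x + a) - c (x + b) + c x = g 1 - g 0"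
      by (simp add: g_def)
    also have "\<dots> = c' (y + b) a - c' y a" using s by (simp add: y_def)
    also have "\<dots> = (\<Sum>i\<in>Basis. (a \<bullet> i) * (c' (y + b) i - c' y i))"
      using y B3 by (subst (1 2) lin) (auto simp: sum_subtractf algebra_simps)
    also have "\<bar>\<dots>\<bar> \<le> (\<Sum>i\<in>Basis. \<bar>a \<bullet> i\<bar> * \<bar>c' (y + b) i - c' y i\<bar>)"
      by (simp add: order.trans[OF sum_abs] abs_mult)
    also have "\<dots> \<le> (\<Sum>i\<in>Basis. norm a * (K1 i * norm b))"
    proof (intro sum_mono mult_mono)
      fix i :: 'a assume i: "i \<in> Basis"
      then have "\<bar>c' (y + b) i - c' y i\<bar> \<le> K1 i * norm (y + b - y)"
        using y r(3)[OF i] by (intro 1) auto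
      then show "\<bar>c' (y + b) i - c' y i\<bar> \<le> K1 i * norm b" by simp
    qed (auto simp: Basis_le_norm)
    also have "\<dots> = (\<Sum>i\<in>Basis. K1 i) * norm a * norm b"
      by (simp add: sum_distrib_left sum_distrib_right mult_ac)
    also have "\<dots> \<le> K * norm a * norm b"
      using 0 by (intro mult_right_mono) (auto simp: K_def)
    finally show "\<bar>c (x + a) - c x\<bar> \<le> K * norm a \<and>
       \<bar>c (x + a + b) - c (x + a) - c (x + b) + c x\<bar> \<le> K * norm a * norm b" using A by simp
  qed (use r 0 sK in \<open>auto simp: K_def\<close>)
qed

section \<open>Exchanging half of a deviation between two curves\<close>

text \<open>
  A family of symmetric bilinear forms whose coefficients are twice continuously differentiable
  near \<open>x0\<close>, expressed by a common bound \<open>C\<close> on values, first and second differences.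
\<close>

locale bilinear_forms =
  fixes Q :: "'e::euclidean_space \<Rightarrow> 'f::euclidean_space \<Rightarrow> 'f \<Rightarrow> real"
    and x0 :: 'e and r0 C :: real
  assumes r0: "r0 > 0" and C1: "C \<ge> 1"
    and bil: "\<And>x. norm (x - x0) < 3 * r0 \<Longrightarrow> bilinear (Q x)"
    and sym: "\<And>x u v. norm (x - x0) < 3 * r0 \<Longrightarrow> Q x u v = Q x v u"
    and bd: "\<And>x u v. norm (x - x0) < 3 * r0 \<Longrightarrow> \<bar>Q x u v\<bar> \<le> C * norm u * norm v"
    and lip: "\<And>x a u v. norm (x - x0) < r0 \<Longrightarrow> norm a < r0 \<Longrightarrow>
       \<bar>Q (x + a) u v - Q x u v\<bar> \<le> C * norm a * norm u * norm v"
    and snd: "\<And>x a b u v. norm (x - x0) < r0 \<Longrightarrow> norm a < r0 \<Longrightarrow> norm b < r0 \<Longrightarrow>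
       \<bar>Q (x + a + b) u v - Q (x + a) u v - Q (x + b) u v + Q x u v\<bar> \<le> C * norm a * norm b * norm u * norm v"
begin

text \<open>
  Let \<open>P(x, z) = Q x z z\<close>, and let \<open>D(x, z) = - Q x z e\<close> be positive at \<open>(x0, z0)\<close>.  Given two zeros
  \<open>(x, z)\<close> and \<open>(x + a + b, z + \<alpha> + \<beta>)\<close> of \<open>P\<close>, the two intermediate points \<open>(x + b, z + \<beta>)\<close> and
  \<open>(x + a, z + \<alpha>)\<close> are obtained by exchanging a part of their difference.  The sum of \<open>P\<close> over the
  intermediate points is minus a mixed second difference, that is \<open>- 2 Q(\<alpha>, \<beta>)\<close> to leading order, and the
  two denominators differ by \<open>- Q(\<alpha> - \<beta>, e)\<close> where the numerator at the first point is approximately \<open>2 Q(z, \<beta>)\<close>.  The last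
  summand collects the errors; it is small compared to \<open>u\<^sup>2\<close> if the radius \<open>\<rho>\<close> of the neighbourhood and the
  ratio \<open>s / u\<close> are small.
  Here \<open>P / (2 D)\<close> will bound the excess of a Randers metric over \<open>1\<close>.
\<close>

lemma swap_estimate:
  assumes D0: "D0 = - Q x0 z0 e" "D0 > 0" and C2: "norm z0 + 3 \<le> C" "norm e \<le> C"
    and \<rho>: "0 < \<rho>" "\<rho> \<le> r0" "\<rho> \<le> 1" "8 * C ^ 3 * \<rho> \<le> D0"
    and x: "norm (x - x0) < \<rho>" "norm a < \<rho>" "norm b < \<rho>"
    and z: "norm (z - z0) < \<rho>" "norm \<alpha> < \<rho>" "norm \<beta> < \<rho>"
    and null: "Q x z z = 0" "Q (x + a + b) (z + \<alpha> + \<beta>) (z + \<alpha> + \<beta>) = 0"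
    and D1: "D1 = - Q (x + b) (z + \<beta>) e" and D2: "D2 = - Q (x + a) (z + \<alpha>) e"
    and u: "u = norm \<alpha> + norm \<beta>" and s: "s = norm a + norm b"
  shows "D1 > 0" "D2 > 0"
    and "Q (x + b) (z + \<beta>) (z + \<beta>) / (2 * D1) + Q (x + a) (z + \<alpha>) (z + \<alpha>) / (2 * D2)
      \<le> - Q x0 \<alpha> \<beta> / D0 - Q x0 z0 \<beta> * Q x0 (\<alpha> - \<beta>) e / D0\<^sup>2
        + (9 * C ^ 3 / D0 + 200 * C ^ 7 / D0\<^sup>2 + 48 * C ^ 7 / D0 ^ 3) * (\<rho> * u\<^sup>2 + s * u + s\<^sup>2)"
proof -
  define G where "G = \<rho> * u\<^sup>2 + s * u + s\<^sup>2"
  have us: "u \<ge> 0" "s \<ge> 0" "norm \<alpha> \<le> u" "norm \<beta> \<le> u" "norm a \<le> s" "norm b \<le> s"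
    by (auto simp: u s)
  have nx: "norm (x + c - x0) \<le> norm (x - x0) + norm c" for c
    by (metis add.commute add_diff_eq norm_triangle_ineq)
  have nz: "norm (z + c) \<le> norm z0 + norm (z - z0) + norm c" for c
  proof -
    have "norm (z0 + (z - z0) + c) \<le> norm z0 + norm (z - z0) + norm c"
      by (meson norm_triangle_ineq norm_triangle_mono order_refl)
    then show ?thesis by simp
  qed
  have near: "norm (x0 - x0) < 3 * r0" "norm (x - x0) < 3 * r0"
    "norm (x + a - x0) < 3 * r0" "norm (x + b - x0) < 3 * r0"
    using nx[of a] nx[of b] x \<rho> r0 by auto
  have near': "norm (x + a + b - x0) < 3 * r0"
  proof -
    have "norm (x + a + b - x0) \<le> norm (x + a - x0) + norm b"
      by (metis add.commute add_diff_eq norm_triangle_ineq)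
    then show ?thesis using nx[of a] x \<rho> r0 by auto
  qed
  have B: "bilinear (Q x0)" "bilinear (Q x)" "bilinear (Q (x + a))" "bilinear (Q (x + b))"
     "bilinear (Q (x + a + b))"
    using bil near near' by blast+
  note lin = B[THEN bilinear_ladd] B[THEN bilinear_radd] B[THEN bilinear_lsub] B[THEN bilinear_rsub]
  have Cp: "C \<ge> 0" "C \<le> C\<^sup>2" "C\<^sup>2 \<le> C ^ 3" "C \<le> C ^ 3" "C^3 \<le> C^4" "C ^ 4 \<le> C ^ 7"
       "C ^ 5 \<le> C ^ 7" "C ^ 6 \<le> C ^ 7" "C\<^sup>2 \<le> C ^ 7" "C ^ 3 \<le> C ^ 7"
    using C1 power_increasing[of 1 2 C] power_increasing[of 1 3 C]
    by (auto intro!: power_increasing)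
  have nzC: "norm z \<le> C" "norm (z + \<alpha>) \<le> C" "norm (z + \<beta>) \<le> C" "norm z0 \<le> C"
     and nzC3: "norm (z + \<alpha> + \<beta>) \<le> C"
  proof -
    show "norm z \<le> C" "norm (z + \<alpha>) \<le> C" "norm (z + \<beta>) \<le> C" "norm z0 \<le> C"
      using nz[of 0] nz[of \<alpha>] nz[of \<beta>] z \<rho> C2 by auto
    have "norm (\<alpha> + \<beta>) \<le> norm \<alpha> + norm \<beta>" by (rule norm_triangle_ineq)
    then show "norm (z + \<alpha> + \<beta>) \<le> C"
      using nz[of "\<alpha> + \<beta>"] z \<rho> C2 by (auto simp: add.assoc)
  qed
  have Glow: "\<rho> * u\<^sup>2 \<le> G" "s * u \<le> G" "s\<^sup>2 \<le> G" "G \<ge> 0" "u * (s + \<rho> * u) \<le> G"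
    "(s + \<rho> * u)\<^sup>2 \<le> 2 * G"
  proof -
    have nn: "\<rho> * u\<^sup>2 \<ge> 0" "s * u \<ge> 0" "s\<^sup>2 \<ge> 0" using us \<rho> by auto
    show "\<rho> * u\<^sup>2 \<le> G" "s * u \<le> G" "s\<^sup>2 \<le> G" "G \<ge> 0" using nn by (auto simp: G_def)
    show "u * (s + \<rho> * u) \<le> G" using nn by (simp add: G_def algebra_simps power2_eq_square)
    have "\<rho> * (s * u) \<le> s * u" "\<rho> * (\<rho> * u\<^sup>2) \<le> \<rho> * u\<^sup>2"
      using nn \<rho> by (auto intro: mult_left_le_one_le)
    moreover have "(s + \<rho> * u)\<^sup>2 = s\<^sup>2 + 2 * (\<rho> * (s * u)) + \<rho> * (\<rho> * u\<^sup>2)"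
      by (simp add: power2_eq_square algebra_simps)
    moreover have "2 * G = 2 * (\<rho> * u\<^sup>2) + 2 * (s * u) + 2 * s\<^sup>2" by (simp add: G_def)
    moreover have "X \<le> g" if "x2 \<le> x1" "x3 \<le> x4" "X = x5 + 2 * x2 + x3"
      "g = 2 * x4 + 2 * x1 + 2 * x5" "x4 \<ge> 0" "x5 \<ge> 0" for X g x1 x2 x3 x4 x5 :: real
      using that by linarith
    ultimately show "(s + \<rho> * u)\<^sup>2 \<le> 2 * G" using nn by blast
  qed
  have m2: "c * p * q \<le> c * P * R" if "0 \<le> p" "p \<le> P" "0 \<le> q" "q \<le> R" "0 \<le> c" for c p q P R :: real
    using that by (simp add: mult.assoc mult_mono mult_left_mono)
  have m3: "c * y * p * q \<le> c * T * P * R"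
    if "0 \<le> y" "y \<le> T" "0 \<le> p" "p \<le> P" "0 \<le> q" "q \<le> R" "0 \<le> c" for c y p q T P R :: real
    using that by (intro mult_mono) auto
  have m4: "c * n * y * p * q \<le> c * N * T * P * R"
    if "0 \<le> n" "n \<le> N" "0 \<le> y" "y \<le> T" "0 \<le> p" "p \<le> P" "0 \<le> q" "q \<le> R" "0 \<le> c"
    for c n y p q N T P R :: real
    using that by (intro mult_mono) auto
  have rx: "norm (x - x0) < r0" "norm a < r0" "norm b < r0" using x \<rho> by auto
  have shift: "\<bar>Q x v w - Q x0 v w\<bar> \<le> C * \<rho> * norm v * norm w" for v w
  proof -
    have "\<bar>Q (x0 + (x - x0)) v w - Q x0 v w\<bar> \<le> C * norm (x - x0) * norm v * norm w"
      using rx r0 by (intro lip) auto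
    also have "\<dots> \<le> C * \<rho> * norm v * norm w" using x Cp by (intro m3) auto
    finally show ?thesis by simp
  qed
  have tri: "\<bar>p\<bar> \<le> P \<Longrightarrow> \<bar>q\<bar> \<le> R \<Longrightarrow> \<bar>p + q\<bar> \<le> P + R"
      "\<bar>p\<bar> \<le> P \<Longrightarrow> \<bar>q\<bar> \<le> R \<Longrightarrow> \<bar>p - q\<bar> \<le> P + R"
      "\<bar>p\<bar> \<le> P \<Longrightarrow> \<bar>- p\<bar> \<le> P" "\<bar>p\<bar> \<le> P \<Longrightarrow> \<bar>2 * p\<bar> \<le> 2 * P" for p q P R :: real
    by auto
  \<comment> \<open>a zero of \<open>P\<close> at \<open>(x, z)\<close> leaves only the linear part of \<open>P\<close> in the displacement \<open>(b, \<beta>)\<close>\<close>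
  define P1 where "P1 = Q (x + b) (z + \<beta>) (z + \<beta>)"
  define P2 where "P2 = Q (x + a) (z + \<alpha>) (z + \<alpha>)"
  have e1: "\<bar>P1 - 2 * Q x0 z0 \<beta>\<bar> \<le> 5 * C ^ 3 * (s + \<rho> * u)"
  proof -
    have eq: "P1 - 2 * Q x0 z0 \<beta> = (Q (x + b) (z + \<beta>) (z + \<beta>) - Q x (z + \<beta>) (z + \<beta>))
       + 2 * Q x (z - z0) \<beta> + 2 * (Q x z0 \<beta> - Q x0 z0 \<beta>) + Q x \<beta> \<beta>"
      using null sym[OF near(2), of \<beta> z] by (simp add: P1_def lin algebra_simps)
    have b1: "\<bar>Q (x + b) (z + \<beta>) (z + \<beta>) - Q x (z + \<beta>) (z + \<beta>)\<bar> \<le> C * s * C * C"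
      using us nzC Cp
      by (intro order.trans[OF lip[OF rx(1,3), of "z + \<beta>" "z + \<beta>"]] m3) (auto)
    have b2: "\<bar>Q x (z - z0) \<beta>\<bar> \<le> C * \<rho> * u"
      using z us Cp by (intro order.trans[OF bd[OF near(2), of "z - z0" \<beta>]] m2) (auto)
    have b3: "\<bar>Q x z0 \<beta> - Q x0 z0 \<beta>\<bar> \<le> C * \<rho> * C * u"
      using nzC us Cp \<rho> by (intro order.trans[OF shift[of z0 \<beta>]] m3) (auto)
    have b4: "\<bar>Q x \<beta> \<beta>\<bar> \<le> C * \<rho> * u"
      using z us Cp by (intro order.trans[OF bd[OF near(2), of \<beta> \<beta>]] m2) (auto)
    have "\<bar>P1 - 2 * Q x0 z0 \<beta>\<bar> \<le> C * s * C * C + 2 * (C * \<rho> * u) + 2 * (C * \<rho> * C * u) + C * \<rho> * u"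
      unfolding eq by (intro tri b1 b2 b3 b4)
    also have "\<dots> = C ^ 3 * s + (3 * C + 2 * C\<^sup>2) * (\<rho> * u)"
      by (simp add: algebra_simps power2_eq_square power3_eq_cube)
    also have "\<dots> \<le> 5 * C ^ 3 * s + 5 * C ^ 3 * (\<rho> * u)"
      using us \<rho> Cp by (intro add_mono mult_right_mono) auto
    finally show ?thesis by (simp add: algebra_simps)
  qed
  \<comment> \<open>with both zeros of \<open>P\<close>, the sum of the numerators is minus the mixed second difference of \<open>P\<close>\<close>
  have e12: "\<bar>P1 + P2 + 2 * Q x0 \<alpha> \<beta>\<bar> \<le> 9 * C ^ 3 * G"
  proof -
    define X where "X = z + \<alpha> + \<beta>"
    have eq: "P1 + P2 + 2 * Q x0 \<alpha> \<beta> = - (2 * (Q x \<alpha> \<beta> - Q x0 \<alpha> \<beta>)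
       + (Q (x + a) \<beta> (z + \<alpha> + X) - Q x \<beta> (z + \<alpha> + X))
       + (Q (x + b) \<alpha> (z + \<beta> + X) - Q x \<alpha> (z + \<beta> + X))
       + (Q (x + a + b) X X - Q (x + a) X X - Q (x + b) X X + Q x X X))"
    proof -
      have sq: "A q (p + (p + q)) = A (p + q) (p + q) - A p p" if "bilinear A" "A p q = A q p"
        for A :: "'f \<Rightarrow> 'f \<Rightarrow> real" and p q
        using that(2) by (simp add: bilinear_ladd[OF that(1)] bilinear_radd[OF that(1)])
      have X: "X = (z + \<alpha>) + \<beta>" "X = (z + \<beta>) + \<alpha>" by (simp_all add: X_def algebra_simps)
      have "Q (x + a) \<beta> (z + \<alpha> + X) = Q (x + a) X X - P2"
        "Q x \<beta> (z + \<alpha> + X) = Q x X X - Q x (z + \<alpha>) (z + \<alpha>)"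
        unfolding X(1) P2_def by (intro sq B sym near)+
      moreover have "Q (x + b) \<alpha> (z + \<beta> + X) = Q (x + b) X X - P1"
        "Q x \<alpha> (z + \<beta> + X) = Q x X X - Q x (z + \<beta>) (z + \<beta>)"
        unfolding X(2) P1_def by (intro sq B sym near)+
      moreover have "Q x X X - Q x (z + \<alpha>) (z + \<alpha>) - Q x (z + \<beta>) (z + \<beta>) = 2 * Q x \<alpha> \<beta>"
        using null(1) sym[OF near(2), of \<beta> \<alpha>] unfolding X_def
        by (simp add: bilinear_ladd[OF B(2)] bilinear_radd[OF B(2)])
      moreover have "Q (x + a + b) X X = 0" using null(2) by (simp add: X_def)
      ultimately show ?thesis by algebra
    qed
    have b1: "\<bar>Q x \<alpha> \<beta> - Q x0 \<alpha> \<beta>\<bar> \<le> C * \<rho> * u * u"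
      using us Cp \<rho> by (intro order.trans[OF shift[of \<alpha> \<beta>]] m3) (auto)
    have nX: "norm (z + \<alpha> + X) \<le> C + C" "norm (z + \<beta> + X) \<le> C + C" "norm X \<le> C"
      using norm_triangle_ineq[of "z + \<alpha>" X] norm_triangle_ineq[of "z + \<beta>" X] nzC nzC3
      by (auto simp: X_def)
    have b2: "\<bar>Q (x + a) \<beta> (z + \<alpha> + X) - Q x \<beta> (z + \<alpha> + X)\<bar> \<le> C * s * u * (C + C)"
      using us nX Cp
      by (intro order.trans[OF lip[OF rx(1,2), of \<beta> "z + \<alpha> + X"]] m3) (auto)
    have b3: "\<bar>Q (x + b) \<alpha> (z + \<beta> + X) - Q x \<alpha> (z + \<beta> + X)\<bar> \<le> C * s * u * (C + C)"
      using us nX Cp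
      by (intro order.trans[OF lip[OF rx(1,3), of \<alpha> "z + \<beta> + X"]] m3) (auto)
    have b4: "\<bar>Q (x + a + b) X X - Q (x + a) X X - Q (x + b) X X + Q x X X\<bar> \<le> C * s * s * C * C"
      using us nX Cp
      by (intro order.trans[OF snd[OF rx, of X X]] m4) (auto)
    have "\<bar>P1 + P2 + 2 * Q x0 \<alpha> \<beta>\<bar>
        \<le> 2 * (C * \<rho> * u * u) + C * s * u * (C + C) + C * s * u * (C + C) + C * s * s * C * C"
      unfolding eq by (intro tri b1 b2 b3 b4)
    also have "\<dots> = 2 * C * (\<rho> * u\<^sup>2) + 4 * C\<^sup>2 * (s * u) + C ^ 3 * s\<^sup>2"
      by (simp add: algebra_simps power2_eq_square power3_eq_cube)
    also have "\<dots> \<le> 9 * C ^ 3 * (\<rho> * u\<^sup>2) + 9 * C ^ 3 * (s * u) + 9 * C ^ 3 * s\<^sup>2"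
      using us \<rho> Cp by (intro add_mono mult_right_mono) auto
    finally show ?thesis by (simp add: G_def algebra_simps)
  qed
  have e2: "\<bar>D2 - D1 + Q x0 (\<alpha> - \<beta>) e\<bar> \<le> 5 * C ^ 3 * (s + \<rho> * u)"
  proof -
    have eq: "D2 - D1 + Q x0 (\<alpha> - \<beta>) e = - (Q (x + a) (z + \<alpha>) e - Q x (z + \<alpha>) e)
       + (Q (x + b) (z + \<beta>) e - Q x (z + \<beta>) e) - (Q x (\<alpha> - \<beta>) e - Q x0 (\<alpha> - \<beta>) e)"
      unfolding D1 D2 by (simp add: lin algebra_simps)
    have b1: "\<bar>Q (x + a) (z + \<alpha>) e - Q x (z + \<alpha>) e\<bar> \<le> C * s * C * C"
      using us nzC Cp C2
      by (intro order.trans[OF lip[OF rx(1,2), of "z + \<alpha>" e]] m3) (auto)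
    have b2: "\<bar>Q (x + b) (z + \<beta>) e - Q x (z + \<beta>) e\<bar> \<le> C * s * C * C"
      using us nzC Cp C2
      by (intro order.trans[OF lip[OF rx(1,3), of "z + \<beta>" e]] m3) (auto)
    have b3: "\<bar>Q x (\<alpha> - \<beta>) e - Q x0 (\<alpha> - \<beta>) e\<bar> \<le> C * \<rho> * u * C"
      using norm_triangle_ineq4[of \<alpha> \<beta>] us Cp C2 \<rho>
      by (intro order.trans[OF shift[of "\<alpha> - \<beta>" e]] m3) (auto simp: u)
    have "\<bar>D2 - D1 + Q x0 (\<alpha> - \<beta>) e\<bar> \<le> C * s * C * C + C * s * C * C + C * \<rho> * u * C"
      unfolding eq by (intro tri b1 b2 b3)
    also have "\<dots> = 2 * C ^ 3 * s + C\<^sup>2 * (\<rho> * u)"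
      by (simp add: algebra_simps power2_eq_square power3_eq_cube)
    also have "\<dots> \<le> 5 * C ^ 3 * s + 5 * C ^ 3 * (\<rho> * u)"
      using us \<rho> Cp by (intro add_mono mult_right_mono) auto
    finally show ?thesis by (simp add: algebra_simps)
  qed
  have den: "\<bar>- Q (x + c) (z + \<gamma>) e - D0\<bar> \<le> 4 * C ^ 3 * \<rho>"
    if c: "norm c < \<rho>" "norm \<gamma> < \<rho>" "norm (z + \<gamma>) \<le> C" for c \<gamma>
  proof -
    have B': "bilinear (Q (x + c))" using nx[of c] c x \<rho> by (intro bil) auto
    have eq: "- Q (x + c) (z + \<gamma>) e - D0 = - (Q (x + c) (z + \<gamma>) e - Q x (z + \<gamma>) e)
       - (Q x (z + \<gamma>) e - Q x0 (z + \<gamma>) e) - Q x0 (z - z0 + \<gamma>) e"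
      unfolding D0 by (simp add: lin B'[THEN bilinear_ladd] algebra_simps)
    have b1: "\<bar>Q (x + c) (z + \<gamma>) e - Q x (z + \<gamma>) e\<bar> \<le> C * \<rho> * C * C"
      using c \<rho> Cp C2
      by (intro order.trans[OF lip[OF rx(1), of c "z + \<gamma>" e]] m3) (auto)
    have b2: "\<bar>Q x (z + \<gamma>) e - Q x0 (z + \<gamma>) e\<bar> \<le> C * \<rho> * C * C"
      using c Cp C2 \<rho>
      by (intro order.trans[OF shift[of "z + \<gamma>" e]] m3) (auto)
    have b3: "\<bar>Q x0 (z - z0 + \<gamma>) e\<bar> \<le> C * (2 * \<rho>) * C"
      using norm_triangle_ineq[of "z - z0" \<gamma>] c z Cp C2
      by (intro order.trans[OF bd[OF near(1), of "z - z0 + \<gamma>" e]] m2) (auto)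
    have "\<bar>- Q (x + c) (z + \<gamma>) e - D0\<bar> \<le> C * \<rho> * C * C + C * \<rho> * C * C + C * (2 * \<rho>) * C"
      unfolding eq by (intro tri b1 b2 b3)
    also have "\<dots> = 2 * C ^ 3 * \<rho> + 2 * C\<^sup>2 * \<rho>"
      by (simp add: algebra_simps power2_eq_square power3_eq_cube)
    also have "\<dots> \<le> 2 * C ^ 3 * \<rho> + 2 * C ^ 3 * \<rho>"
      using \<rho> Cp by (intro add_mono mult_right_mono) auto
    finally show ?thesis by (simp add: mult_ac)
  qed
  have d1: "\<bar>D1 - D0\<bar> \<le> 4 * C ^ 3 * \<rho>" and d2: "\<bar>D2 - D0\<bar> \<le> 4 * C ^ 3 * \<rho>"
    using den x z nzC D1 D2 by auto
  have h: "D0 / 2 \<le> D1" "D0 / 2 \<le> D2" "D1 \<le> 2 * D0" "D2 \<le> 2 * D0"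
    using d1 d2 \<rho>(4) D0(2) by (auto simp: abs_le_iff)
  show pos: "D1 > 0" "D2 > 0" using h D0(2) by auto
  \<comment> \<open>the quotients are split so that each error meets a factor that is already small\<close>
  define A where "A = Q x0 \<alpha> \<beta>"
  define b' where "b' = Q x0 z0 \<beta>"
  define L where "L = Q x0 (\<alpha> - \<beta>) e"
  have bA: "\<bar>A\<bar> \<le> C * u * u" unfolding A_def
    using us Cp by (intro order.trans[OF bd[OF near(1), of \<alpha> \<beta>]] m2) (auto)
  have bb: "\<bar>b'\<bar> \<le> C * C * u" unfolding b'_def
    using us Cp nzC by (intro order.trans[OF bd[OF near(1), of z0 \<beta>]] m2) (auto)
  have bL: "\<bar>L\<bar> \<le> C * u * C" unfolding L_def
    using norm_triangle_ineq4[of \<alpha> \<beta>] us Cp C2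
    by (intro order.trans[OF bd[OF near(1), of "\<alpha> - \<beta>" e]] m2) (auto simp: u)
  define \<epsilon>1 where "\<epsilon>1 = P1 - 2 * b'"
  define \<epsilon>2 where "\<epsilon>2 = D2 - D1 + L"
  define \<epsilon>3 where "\<epsilon>3 = P1 + P2 + 2 * A"
  have "P1 / (2 * D1) + P2 / (2 * D2) - (- A / D0 - b' * L / D0\<^sup>2)
    = \<epsilon>3 / (2 * D2) + A * (D2 - D0) / (D0 * D2) + (2 * b' * \<epsilon>2 - L * \<epsilon>1 + \<epsilon>1 * \<epsilon>2) / (2 * D1 * D2)
      + b' * L * (D1 * D2 - D0\<^sup>2) / (D0\<^sup>2 * (D1 * D2))"
    using pos D0(2) unfolding \<epsilon>1_def \<epsilon>2_def \<epsilon>3_def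
    by (simp add: divide_simps) (simp add: algebra_simps power2_eq_square)
  moreover have "\<epsilon>3 / (2 * D2) \<le> 9 * C ^ 3 / D0 * G"
  proof -
    have "\<epsilon>3 / (2 * D2) \<le> (9 * C ^ 3 * G) / (2 * D2)"
      using e12 pos by (intro divide_right_mono) (auto simp: \<epsilon>3_def A_def)
    also have "\<dots> \<le> (9 * C ^ 3 * G) / D0"
      using h D0(2) Cp Glow by (intro divide_left_mono) auto
    finally show ?thesis by simp
  qed
  moreover have "A * (D2 - D0) / (D0 * D2) \<le> 8 * C ^ 7 / D0\<^sup>2 * G"
  proof -
    have "A * (D2 - D0) \<le> \<bar>A\<bar> * \<bar>D2 - D0\<bar>" by (metis abs_ge_self abs_mult)
    also have "\<dots> \<le> (C * u * u) * (4 * C ^ 3 * \<rho>)" by (intro mult_mono bA d2) (use us Cp in auto)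
    also have "\<dots> = 4 * C ^ 4 * (\<rho> * u\<^sup>2)" by (simp add: power2_eq_square numeral_eq_Suc)
    also have "\<dots> \<le> 4 * C ^ 7 * G" using Glow Cp us \<rho> by (intro mult_mono) auto
    finally have "A * (D2 - D0) / (D0 * D2) \<le> 4 * C ^ 7 * G / (D0 * D2)"
      using pos D0(2) by (intro divide_right_mono) auto
    also have "\<dots> \<le> 4 * C ^ 7 * G / (D0 * (D0 / 2))"
      using h D0(2) Cp Glow by (intro divide_left_mono mult_left_mono) auto
    finally show ?thesis by (simp add: power2_eq_square)
  qed
  moreover have "(2 * b' * \<epsilon>2 - L * \<epsilon>1 + \<epsilon>1 * \<epsilon>2) / (2 * D1 * D2) \<le> 130 * C ^ 7 / D0\<^sup>2 * G"
  proof -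
    have a1: "\<bar>\<epsilon>1\<bar> \<le> 5 * C ^ 3 * (s + \<rho> * u)" and a2: "\<bar>\<epsilon>2\<bar> \<le> 5 * C ^ 3 * (s + \<rho> * u)"
      using e1 e2 by (auto simp: \<epsilon>1_def \<epsilon>2_def b'_def L_def)
    have "2 * b' * \<epsilon>2 - L * \<epsilon>1 + \<epsilon>1 * \<epsilon>2 \<le> 2 * (\<bar>b'\<bar> * \<bar>\<epsilon>2\<bar>) + \<bar>L\<bar> * \<bar>\<epsilon>1\<bar> + \<bar>\<epsilon>1\<bar> * \<bar>\<epsilon>2\<bar>"
      unfolding abs_mult[symmetric] by linarith
    also have "\<dots> \<le> 2 * ((C * C * u) * (5 * C ^ 3 * (s + \<rho> * u))) + (C * u * C) * (5 * C ^ 3 * (s + \<rho> * u))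
       + (5 * C ^ 3 * (s + \<rho> * u)) * (5 * C ^ 3 * (s + \<rho> * u))"
      by (intro add_mono mult_left_mono mult_mono a1 a2 bb bL) (use us Cp \<rho> in auto)
    also have "\<dots> = 15 * C ^ 5 * (u * (s + \<rho> * u)) + 25 * C ^ 6 * (s + \<rho> * u)\<^sup>2"
      by (simp add: power2_eq_square numeral_eq_Suc algebra_simps)
    also have "\<dots> \<le> 15 * C ^ 7 * G + 25 * C ^ 7 * (2 * G)"
      using Glow Cp us \<rho> by (intro add_mono mult_mono) auto
    finally have "2 * b' * \<epsilon>2 - L * \<epsilon>1 + \<epsilon>1 * \<epsilon>2 \<le> 65 * C ^ 7 * G" by (simp add: mult_ac)
    then have "(2 * b' * \<epsilon>2 - L * \<epsilon>1 + \<epsilon>1 * \<epsilon>2) / (2 * D1 * D2) \<le> 65 * C ^ 7 * G / (2 * D1 * D2)"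
      using pos by (intro divide_right_mono) auto
    also have "\<dots> \<le> 65 * C ^ 7 * G / (2 * (D0 / 2) * (D0 / 2))"
      using h D0(2) Cp Glow pos by (intro divide_left_mono mult_mono) auto
    finally show ?thesis by (simp add: power2_eq_square)
  qed
  moreover have "b' * L * (D1 * D2 - D0\<^sup>2) / (D0\<^sup>2 * (D1 * D2)) \<le> 48 * C ^ 7 / D0 ^ 3 * G"
  proof -
    have "\<bar>D1 * D2 - D0\<^sup>2\<bar> = \<bar>(D1 - D0) * D2 + D0 * (D2 - D0)\<bar>"
      by (simp add: power2_eq_square algebra_simps)
    also have "\<dots> \<le> \<bar>D1 - D0\<bar> * \<bar>D2\<bar> + \<bar>D0\<bar> * \<bar>D2 - D0\<bar>"
      unfolding abs_mult[symmetric] by (rule abs_triangle_ineq)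
    also have "\<dots> \<le> (4 * C ^ 3 * \<rho>) * (2 * D0) + D0 * (4 * C ^ 3 * \<rho>)"
      using h D0(2) pos d1 d2 Cp(1) \<rho>(1) by (intro add_mono mult_mono) auto
    finally have d: "\<bar>D1 * D2 - D0\<^sup>2\<bar> \<le> 12 * C ^ 3 * \<rho> * D0" by (simp add: algebra_simps)
    have "b' * L * (D1 * D2 - D0\<^sup>2) \<le> \<bar>b'\<bar> * \<bar>L\<bar> * \<bar>D1 * D2 - D0\<^sup>2\<bar>" by (metis abs_ge_self abs_mult)
    also have "\<dots> \<le> (C * C * u) * (C * u * C) * (12 * C ^ 3 * \<rho> * D0)"
      by (intro mult_mono bb bL d) (use us Cp in auto)
    also have "\<dots> = 12 * C ^ 7 * D0 * (\<rho> * u\<^sup>2)" by (simp add: power2_eq_square numeral_eq_Suc)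
    also have "\<dots> \<le> 12 * C ^ 7 * D0 * G" using Glow Cp us \<rho> D0(2) by (intro mult_left_mono) auto
    finally have "b' * L * (D1 * D2 - D0\<^sup>2) / (D0\<^sup>2 * (D1 * D2)) \<le> 12 * C ^ 7 * D0 * G / (D0\<^sup>2 * (D1 * D2))"
      using pos D0(2) by (intro divide_right_mono) auto
    also have "\<dots> \<le> 12 * C ^ 7 * D0 * G / (D0\<^sup>2 * ((D0 / 2) * (D0 / 2)))"
      using h D0(2) Cp Glow pos by (intro divide_left_mono mult_mono mult_left_mono) auto
    also have "\<dots> = 48 * C ^ 7 / D0 ^ 3 * G" using D0(2) by (simp add: power2_eq_square power3_eq_cube)
    finally show ?thesis .
  qed
  ultimately have "P1 / (2 * D1) + P2 / (2 * D2) - (- A / D0 - b' * L / D0\<^sup>2)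
     \<le> 9 * C ^ 3 / D0 * G + 8 * C ^ 7 / D0\<^sup>2 * G + 130 * C ^ 7 / D0\<^sup>2 * G + 48 * C ^ 7 / D0 ^ 3 * G"
    by linarith
  also have "\<dots> \<le> (9 * C ^ 3 / D0 + 200 * C ^ 7 / D0\<^sup>2 + 48 * C ^ 7 / D0 ^ 3) * G"
    using Glow Cp by (simp add: algebra_simps divide_right_mono mult_left_mono)
  finally show "Q (x + b) (z + \<beta>) (z + \<beta>) / (2 * D1) + Q (x + a) (z + \<alpha>) (z + \<alpha>) / (2 * D2)
      \<le> - Q x0 \<alpha> \<beta> / D0 - Q x0 z0 \<beta> * Q x0 (\<alpha> - \<beta>) e / D0\<^sup>2
        + (9 * C ^ 3 / D0 + 200 * C ^ 7 / D0\<^sup>2 + 48 * C ^ 7 / D0 ^ 3) * (\<rho> * u\<^sup>2 + s * u + s\<^sup>2)"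
    unfolding P1_def P2_def A_def b'_def L_def G_def by linarith
qed

end

section \<open>Bilinear forms and energies\<close>

lemma bilinear_coordinates_left:
  fixes f :: "'a::euclidean_space \<Rightarrow> 'b::euclidean_space \<Rightarrow> real"
  assumes "bilinear f"
  shows "f u v = (\<Sum>i\<in>Basis. (u \<bullet> i) * f i v)"
proof -
  have l: "linear (\<lambda>u. f u v)"
    using assms by (simp add: bilinear_def)
  show ?thesis
    using linear_sum[OF l, of "\<lambda>i. (u \<bullet> i) *\<^sub>R i" Basis]
    by (simp add: euclidean_representation linear_cmul[OF l])
qed

lemma bilinear_coordinates_right:
  fixes f :: "'a::euclidean_space \<Rightarrow> 'b::euclidean_space \<Rightarrow> real"
  assumes "bilinear f"
  shows "f u v = (\<Sum>i\<in>Basis. (v \<bullet> i) * f u i)"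
  using bilinear_coordinates_left[of "\<lambda>v u. f u v" v u] assms by (simp add: bilinear_def)

lemma bilinear_coordinates:
  fixes f :: "'a::euclidean_space \<Rightarrow> 'b::euclidean_space \<Rightarrow> real"
  assumes "bilinear f"
  shows "f u v = (\<Sum>i\<in>Basis. \<Sum>j\<in>Basis. (u \<bullet> i) * (v \<bullet> j) * f i j)"
  unfolding bilinear_coordinates_left[OF assms, of u v]
  by (subst bilinear_coordinates_right[OF assms, of _ v]) (simp add: sum_distrib_left mult.assoc)

lemma coordinate_form_bound:
  fixes u :: "'a::euclidean_space" and v :: "'b::euclidean_space"
  assumes "\<And>i j. i \<in> Basis \<Longrightarrow> j \<in> Basis \<Longrightarrow> \<bar>c i j\<bar> \<le> k i j"
  shows "\<bar>\<Sum>i\<in>Basis. \<Sum>j\<in>Basis. (u \<bullet> i) * (v \<bullet> j) * c i j\<bar>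
     \<le> (\<Sum>i\<in>(Basis :: 'a set). \<Sum>j\<in>(Basis :: 'b set). k i j) * norm u * norm v"
proof -
  have "\<bar>\<Sum>i\<in>Basis. \<Sum>j\<in>Basis. (u \<bullet> i) * (v \<bullet> j) * c i j\<bar>
      \<le> (\<Sum>i\<in>Basis. \<Sum>j\<in>Basis. norm u * norm v * k i j)"
  proof (intro order.trans[OF sum_abs] sum_mono)
    fix i :: 'a and j :: 'b assume ij: "i \<in> Basis" "j \<in> Basis"
    show "\<bar>(u \<bullet> i) * (v \<bullet> j) * c i j\<bar> \<le> norm u * norm v * k i j"
      unfolding abs_mult using ij assms[OF ij] by (intro mult_mono) (auto simp: Basis_le_norm)
  qed
  then show ?thesis by (simp add: sum_distrib_left sum_distrib_right mult_ac)
qed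

lemma positive_form_coercive:
  fixes h :: "'a::euclidean_space \<Rightarrow> 'a \<Rightarrow> real"
  assumes "bilinear h" "\<And>u. u \<noteq> 0 \<Longrightarrow> h u u > 0"
  obtains m where "m > 0" "\<And>u. m * (norm u)\<^sup>2 \<le> h u u"
proof -
  have bb: "bounded_bilinear h" using assms(1) by (simp add: bilinear_conv_bounded_bilinear)
  have c: "continuous_on (sphere 0 1) (\<lambda>u. h u u)"
    by (rule bounded_bilinear.continuous_on[OF bb continuous_on_id continuous_on_id])
  have ne: "sphere (0::'a) 1 \<noteq> {}" by simp
  obtain u0 :: 'a where u0: "u0 \<in> sphere 0 1" "\<And>u. u \<in> sphere 0 1 \<Longrightarrow> h u0 u0 \<le> h u u"
    using continuous_attains_inf[OF compact_sphere ne c] by blast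
  show thesis
  proof (rule that)
    show "h u0 u0 > 0" using u0(1) assms(2)[of u0] by (metis norm_zero mem_sphere_0 zero_neq_one)
    fix u
    show "h u0 u0 * (norm u)\<^sup>2 \<le> h u u"
    proof (cases "u = 0")
      case True
      then show ?thesis using bilinear_lzero[OF assms(1)] by simp
    next
      case False
      then have "h u0 u0 \<le> h (u /\<^sub>R norm u) (u /\<^sub>R norm u)" by (intro u0) auto
      also have "\<dots> = h u u / (norm u)\<^sup>2"
        by (simp add: bilinear_lmul[OF assms(1)] bilinear_rmul[OF assms(1)] power2_eq_square field_simps)
      finally show ?thesis using False by (simp add: field_simps)
    qed
  qed
qed

text \<open>
  The Cauchy-Schwarz inequality: among the paths from \<open>0\<close> to \<open>y b\<close>, the uniform one has the least energy.
\<close>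

lemma energy_bounds_displacement:
  fixes h :: "'a::euclidean_space \<Rightarrow> 'a \<Rightarrow> real" and y :: "real \<Rightarrow> 'a"
  assumes h: "bilinear h" "\<And>u v. h u v = h v u" "\<And>u. h u u \<ge> 0" and T: "T < b"
    and y: "\<And>t. t \<in> {T..b} \<Longrightarrow> (y has_vector_derivative y' t) (at t within {T..b})"
    and c: "continuous_on {T..b} y'" and y0: "y T = 0"
  shows "h (y b) (y b) \<le> (b - T) * integral {T..b} (\<lambda>s. h (y' s) (y' s))"
proof -
  define w where "w = y b"
  define E where "E = integral {T..b} (\<lambda>s. h (y' s) (y' s))"
  have bb: "bounded_bilinear h" using h(1) by (simp add: bilinear_conv_bounded_bilinear)
  have iE: "((\<lambda>s. h (y' s) (y' s)) has_integral E) {T..b}" unfolding E_def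
    using bounded_bilinear.continuous_on[OF bb c c] integrable_continuous_interval by blast
  have "(y' has_integral w) {T..b}"
    using fundamental_theorem_of_calculus[of T b y y'] y T y0 by (simp add: w_def)
  then have iw: "((\<lambda>s. h w (y' s)) has_integral h w w) {T..b}"
    using has_integral_linear[OF _ bounded_bilinear.bounded_linear_right[OF bb]] by (auto simp: o_def)
  define L where "L = b - T"
  have L: "L > 0" using T by (simp add: L_def)
  have int: "((\<lambda>s. h (y' s) (y' s) - 2 / L * h w (y' s) + h w w / L\<^sup>2) has_integral
     (E - 2 / L * h w w + L * (h w w / L\<^sup>2))) {T..b}"
    using has_integral_const_real[of "h w w / L\<^sup>2" T b] T
    by (intro has_integral_add has_integral_diff iE has_integral_mult_right iw) (simp add: L_def)
  have sq: "h (a - c *\<^sub>R v) (a - c *\<^sub>R v) = h a a - 2 * c * h v a + c\<^sup>2 * h v v" for a v c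
    using h(2)[of a v]
    by (simp add: bilinear_lsub[OF h(1)] bilinear_rsub[OF h(1)] bilinear_lmul[OF h(1)]
        bilinear_rmul[OF h(1)] power2_eq_square algebra_simps)
  have e: "h (y' s) (y' s) - 2 / L * h w (y' s) + h w w / L\<^sup>2
      = h (y' s - w /\<^sub>R L) (y' s - w /\<^sub>R L)" for s
    unfolding sq by (simp only: divide_inverse power_inverse mult_ac)
  have "0 \<le> E - 2 / L * h w w + L * (h w w / L\<^sup>2)"
    by (rule has_integral_nonneg[OF int]) (simp only: e h(3))
  also have "\<dots> = E - h w w / L" using L by (simp add: field_simps power2_eq_square)
  finally show ?thesis using L by (simp add: w_def E_def L_def field_simps)
qed

section \<open>Randers metrics in a chart\<close>

text \<open>
  Zermelo data in coordinates, on the open set \<open>S\<close> of coordinate vectors of a chart.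
\<close>

locale randers_chart =
  fixes S :: "'e::euclidean_space set" and H :: "'e \<Rightarrow> 'e \<Rightarrow> 'e \<Rightarrow> real" and w :: "'e \<Rightarrow> 'e"
  assumes S: "open S"
    and H_bil: "\<And>x. x \<in> S \<Longrightarrow> bilinear (H x)"
    and H_sym: "\<And>x u v. x \<in> S \<Longrightarrow> H x u v = H x v u"
    and H_pos: "\<And>x u. x \<in> S \<Longrightarrow> u \<noteq> 0 \<Longrightarrow> H x u u > 0"
    and H_smooth: "\<And>u v. smooth_on S (\<lambda>x. H x u v)"
    and w_smooth: "smooth_on S w"
    and w_small: "\<And>x. x \<in> S \<Longrightarrow> H x (w x) (w x) < 1"
begin

definition cost :: "'e \<Rightarrow> 'e \<Rightarrow> real" where
  "cost x v = (sqrt ((H x (w x) v)\<^sup>2 + (1 - H x (w x) (w x)) * H x v v) - H x (w x) v)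
     / (1 - H x (w x) (w x))"

text \<open>
  A pair \<open>(v, f)\<close> with \<open>f > 0\<close> satisfies \<open>cone_form x (v, f) (v, f) \<le> 0\<close> iff \<open>v / f - w x\<close> lies in the unit
  ball of \<open>H x\<close>, i.e. iff the displacement \<open>v\<close> is possible within time \<open>f\<close>.  Thus this is the
  Lorentzian form on space-time whose future light cone is the graph of the Randers metric.  In
  contrast to the metric it is quadratic in \<open>v\<close>, with coefficients that are smooth in \<open>x\<close>.
\<close>

definition cone_form :: "'e \<Rightarrow> 'e \<times> real \<Rightarrow> 'e \<times> real \<Rightarrow> real" where
  "cone_form x p q = H x (fst p - snd p *\<^sub>R w x) (fst q - snd q *\<^sub>R w x) - snd p * snd q"

text \<open>
  These are \<open>h(v - W, v - W) - 1\<close>, which vanishes on the unit vectors of the Randers metric, and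
  \<open>1 + h(W, v - W)\<close>.
\<close>

abbreviation "gap x v \<equiv> cone_form x (v, 1) (v, 1)"
abbreviation "slope x v \<equiv> - cone_form x (v, 1) (0, 1)"

lemma H_nonneg: "x \<in> S \<Longrightarrow> H x u u \<ge> 0"
  using H_pos[of x u] bilinear_lzero[OF H_bil, of x] by (cases "u = 0") auto

lemma bilinear_cone_form:
  assumes "x \<in> S"
  shows "bilinear (cone_form x)"
proof -
  note l = bilinear_ladd[OF H_bil[OF assms]] bilinear_radd[OF H_bil[OF assms]]
    bilinear_lsub[OF H_bil[OF assms]] bilinear_rsub[OF H_bil[OF assms]]
    bilinear_lmul[OF H_bil[OF assms]] bilinear_rmul[OF H_bil[OF assms]]
  show ?thesis unfolding bilinear_def
    by (auto intro!: linearI simp: cone_form_def l algebra_simps)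
qed

lemma cone_form_sym: "x \<in> S \<Longrightarrow> cone_form x p q = cone_form x q p"
  unfolding cone_form_def using H_sym by auto

lemma cone_form_horizontal: "cone_form x (u, 0) (v, 0) = H x u v"
  by (simp add: cone_form_def)

text \<open>
  The defining formula solves the quadratic equation \<open>\<lambda> F\<^sup>2 + 2 h(W, v) F = h(v, v)\<close>, where
  \<open>\<lambda> = 1 - h(W, W)\<close>.  Here it is written in powers of \<open>F - 1\<close>.
\<close>

lemma cost_quadratic:
  assumes "x \<in> S"
  shows "2 * slope x v * (cost x v - 1) + (1 - H x (w x) (w x)) * (cost x v - 1)\<^sup>2 = gap x v"
proof -
  define l where "l = 1 - H x (w x) (w x)"
  define b where "b = H x (w x) v"
  have l: "l > 0" using w_small[OF assms] by (simp add: l_def)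
  have "(l * cost x v + b)\<^sup>2 = b\<^sup>2 + l * H x v v"
    using l H_nonneg[OF assms, of v] by (simp add: cost_def l_def[symmetric] b_def[symmetric])
  then have "l * (l * (cost x v)\<^sup>2 + 2 * b * cost x v - H x v v) = 0"
    by (simp add: power2_eq_square algebra_simps)
  then have e: "l * (cost x v)\<^sup>2 + 2 * b * cost x v = H x v v"
    using l by simp
  note lin = bilinear_lsub[OF H_bil[OF assms]] bilinear_rsub[OF H_bil[OF assms]]
     bilinear_lneg[OF H_bil[OF assms]] bilinear_rneg[OF H_bil[OF assms]]
  have "slope x v = b + l" "gap x v = H x v v - 2 * b - l"
    using H_sym[OF assms, of v "w x"] by (simp_all add: cone_form_def lin b_def l_def)
  then show ?thesis
    using e unfolding l_def[symmetric] by (simp add: power2_eq_square algebra_simps)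
qed

text \<open>
  The metric lies below its linearisation in the gap, with equality for unit vectors: the square in
  \<open>cost_quadratic\<close> has a positive coefficient.
\<close>

lemma cost_le:
  assumes "x \<in> S" "slope x v > 0"
  shows "cost x v \<le> 1 + gap x v / (2 * slope x v)"
proof -
  have "(1 - H x (w x) (w x)) * (cost x v - 1)\<^sup>2 \<ge> 0" using w_small[OF assms(1)] by simp
  then have "(cost x v - 1) * (2 * slope x v) \<le> gap x v"
    using cost_quadratic[OF assms(1), of v] by (simp only: mult.commute)
  moreover have "c \<le> 1 + g / (2 * s)" if "(c - 1) * (2 * s) \<le> g" "s > 0" for c g s :: real
    using that by (simp add: field_simps)
  ultimately show ?thesis using assms(2) by blast
qed

text \<open>
  For a unit vector \<open>v\<close>, the vector \<open>n = v - w x\<close> has length \<open>1\<close>, and the slope is \<open>1 + h(n, W)\<close>.  It is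
  positive since \<open>h(n + W, n + W) \<ge> 0\<close> and \<open>h(W, W) < 1\<close>.
\<close>

lemma unit_cost:
  assumes "x \<in> S" "cost x v = 1"
  shows "gap x v = 0" "slope x v > 0"
proof -
  show g: "gap x v = 0" using cost_quadratic[OF assms(1), of v] assms(2) by simp
  note lin = bilinear_ladd[OF H_bil[OF assms(1)]] bilinear_radd[OF H_bil[OF assms(1)]]
     bilinear_rneg[OF H_bil[OF assms(1)]]
  have "0 \<le> H x (v - w x + w x) (v - w x + w x)" by (rule H_nonneg[OF assms(1)])
  also have "\<dots> = H x (v - w x) (v - w x) + 2 * H x (v - w x) (w x) + H x (w x) (w x)"
    unfolding lin using H_sym[OF assms(1), of "v - w x" "w x"] by simp
  also have "H x (v - w x) (v - w x) = 1" using g by (simp add: cone_form_def)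
  finally have "H x (v - w x) (w x) > -1" using w_small[OF assms(1)] by simp
  then show "slope x v > 0" by (simp add: cone_form_def lin)
qed

text \<open>Strict convexity of the indicatrix, an ellipsoid centred at the wind.\<close>

lemma cost_midpoint_less:
  assumes "x \<in> S" "cost x u = 1" "cost x v = 1" "u \<noteq> v"
  shows "cost x ((1/2) *\<^sub>R (u + v)) < 1"
proof -
  note lin = bilinear_ladd[OF bilinear_cone_form[OF assms(1)]] bilinear_radd[OF bilinear_cone_form[OF assms(1)]]
     bilinear_lmul[OF bilinear_cone_form[OF assms(1)]] bilinear_rmul[OF bilinear_cone_form[OF assms(1)]]
     bilinear_lsub[OF bilinear_cone_form[OF assms(1)]] bilinear_rsub[OF bilinear_cone_form[OF assms(1)]]
  note g = unit_cost[OF assms(1,2)] unit_cost[OF assms(1,3)]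
  have m: "((1/2) *\<^sub>R (u + v), 1::real) = (1/2) *\<^sub>R ((u, 1) + (v, 1))"
    by (simp add: scaleR_prod_def)
  have "0 < cone_form x (u - v, 0) (u - v, 0)"
    unfolding cone_form_horizontal using assms(4) by (intro H_pos assms(1)) auto
  also have "(u - v, 0::real) = (u, 1) - (v, 1)" by simp
  finally have "0 < - 2 * cone_form x (u, 1) (v, 1)"
    unfolding lin using g cone_form_sym[OF assms(1), of "(v, 1)" "(u, 1)"] by simp
  then have "gap x ((1/2) *\<^sub>R (u + v)) < 0"
    unfolding m lin using g cone_form_sym[OF assms(1), of "(v, 1)" "(u, 1)"] by simp
  moreover have s: "slope x ((1/2) *\<^sub>R (u + v)) > 0"
    unfolding m lin using g by simp
  ultimately have "gap x ((1/2) *\<^sub>R (u + v)) / (2 * slope x ((1/2) *\<^sub>R (u + v))) < 0"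
    by (intro divide_neg_pos) auto
  then show ?thesis using cost_le[OF assms(1) s] by linarith
qed

lemma smooth_H_wind:
  "smooth_on S (\<lambda>x. H x (w x) v)" "smooth_on S (\<lambda>x. H x (w x) (w x))"
proof -
  have t: "thick S" by (rule thick_open[OF S])
  have wi: "smooth_on S (\<lambda>x. w x \<bullet> i)" for i
    by (intro smooth_on_inner t w_smooth smooth_on_const)
  have 1: "smooth_on S (\<lambda>x. \<Sum>i\<in>Basis. (w x \<bullet> i) * H x i v)" for v
    by (intro smooth_on_sum smooth_on_mult t wi H_smooth)
  note e = bilinear_coordinates_left[OF H_bil]
  show 2: "smooth_on S (\<lambda>x. H x (w x) v)" for v
    using 1[of v] smooth_on_cong[OF e, of S "\<lambda>x. x" w "\<lambda>_. v"] by simp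
  have "smooth_on S (\<lambda>x. \<Sum>i\<in>Basis. (w x \<bullet> i) * H x i (w x))"
  proof (intro smooth_on_sum smooth_on_mult t wi)
    fix i
    show "smooth_on S (\<lambda>x. H x i (w x))"
      using 2[of i] smooth_on_cong[OF H_sym, of S "\<lambda>x. x" "\<lambda>_. i" w] by simp
  qed
  then show "smooth_on S (\<lambda>x. H x (w x) (w x))"
    using smooth_on_cong[OF e, of S "\<lambda>x. x" w w] by simp
qed

lemma smooth_cone_form: "smooth_on S (\<lambda>x. cone_form x p q)"
proof -
  have t: "thick S" by (rule thick_open[OF S])
  have "smooth_on S (\<lambda>x. H x (fst p) (fst q) - snd p * H x (w x) (fst q)
      - snd q * H x (w x) (fst p) + snd p * snd q * H x (w x) (w x) - snd p * snd q)"
    by (intro smooth_on_diff smooth_on_add smooth_on_mult smooth_on_const smooth_H_wind H_smooth t)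
  moreover have "cone_form x p q = H x (fst p) (fst q) - snd p * H x (w x) (fst q)
      - snd q * H x (w x) (fst p) + snd p * snd q * H x (w x) (w x) - snd p * snd q" if "x \<in> S" for x
    using H_sym[OF that, of "fst p" "w x"]
    by (simp add: cone_form_def bilinear_lsub[OF H_bil[OF that]] bilinear_rsub[OF H_bil[OF that]]
     bilinear_lmul[OF H_bil[OF that]] bilinear_rmul[OF H_bil[OF that]] algebra_simps)
  ultimately show ?thesis by (subst smooth_on_cong) auto
qed

lemma continuous_cost: "continuous_on (S \<times> UNIV) (\<lambda>(x, v). cost x v)"
proof -
  have f: "continuous_on (S \<times> UNIV) (\<lambda>p. f (fst p))" if "continuous_on S f" for f :: "'e \<Rightarrow> real"
    using that by (intro continuous_on_compose2[of S f _ fst]) (auto intro: continuous_intros)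
  have 1: "continuous_on (S \<times> UNIV) (\<lambda>p. \<Sum>i\<in>Basis. (snd p \<bullet> i) * H (fst p) (w (fst p)) i)"
    by (intro continuous_intros f smooth_on_continuous smooth_H_wind)
  have 2: "continuous_on (S \<times> UNIV) (\<lambda>p. \<Sum>i\<in>Basis. \<Sum>j\<in>Basis. (snd p \<bullet> i) * (snd p \<bullet> j) * H (fst p) i j)"
    by (intro continuous_intros f smooth_on_continuous H_smooth)
  have 3: "continuous_on (S \<times> UNIV) (\<lambda>p. H (fst p) (w (fst p)) (w (fst p)))"
    by (intro f smooth_on_continuous smooth_H_wind)
  from 1 have 1: "continuous_on (S \<times> UNIV) (\<lambda>p. H (fst p) (w (fst p)) (snd p))"
    by (rule continuous_on_eq) (auto simp: bilinear_coordinates_right[OF H_bil, symmetric])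
  from 2 have 2: "continuous_on (S \<times> UNIV) (\<lambda>p. H (fst p) (snd p) (snd p))"
    by (rule continuous_on_eq) (auto simp: bilinear_coordinates[OF H_bil, symmetric])
  have "continuous_on (S \<times> UNIV) (\<lambda>p. cost (fst p) (snd p))"
    unfolding cost_def by (intro continuous_intros 1 2 3) (use w_small in force)
  then show ?thesis by (simp add: case_prod_unfold)
qed

text \<open>
  The coefficients of the cone form are smooth; summing their local bounds over the finitely many
  pairs of basis vectors gives the bounds on the form.
\<close>

lemma cone_form_locally_C2:
  assumes "x0 \<in> S"
  obtains r0 C where "bilinear_forms cone_form x0 r0 C" "C \<ge> C0" "ball x0 (3 * r0) \<subseteq> S"
proof -
  define B where "B = (Basis :: ('e \<times> real) set)"
  have "\<exists>K r. r > 0 \<and> K \<ge> 0 \<and> (\<forall>x a b. norm (x - x0) < r \<longrightarrow> norm a < r \<longrightarrow> norm b < r \<longrightarrow>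
       \<bar>cone_form (x + a) i j - cone_form x i j\<bar> \<le> K * norm a \<and>
       \<bar>cone_form (x + a + b) i j - cone_form (x + a) i j - cone_form (x + b) i j + cone_form x i j\<bar>
         \<le> K * norm a * norm b)" for i j
  proof -
    have "Ck_on (Suc (Suc 0)) S (\<lambda>x. cone_form x i j)"
      using smooth_cone_form by (simp only: smooth_on_def)
    from C2_second_difference[OF S assms this] show ?thesis by metis
  qed
  then obtain K r where K: "\<And>i j. r i j > 0" "\<And>i j. K i j \<ge> 0"
     "\<And>i j x a b. norm (x - x0) < r i j \<Longrightarrow> norm a < r i j \<Longrightarrow> norm b < r i j \<Longrightarrow>
       \<bar>cone_form (x + a) i j - cone_form x i j\<bar> \<le> K i j * norm a \<and>
       \<bar>cone_form (x + a + b) i j - cone_form (x + a) i j - cone_form (x + b) i j + cone_form x i j\<bar>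
         \<le> K i j * norm a * norm b"
    by metis
  obtain d where d: "d > 0" "ball x0 d \<subseteq> S" using S assms open_contains_ball by blast
  define r0 where "r0 = min d (Min ((\<lambda>(i, j). r i j) ` (B \<times> B))) / 3"
  have fB: "finite B" "B \<noteq> {}" by (auto simp: B_def)
  have r0: "r0 > 0" "3 * r0 \<le> d" "\<And>i j. i \<in> B \<Longrightarrow> j \<in> B \<Longrightarrow> 3 * r0 \<le> r i j"
    using fB K(1) d(1) by (auto simp: r0_def min_le_iff_disj intro!: disjI2 Min_le)
  define k where "k i j = \<bar>cone_form x0 i j\<bar> + K i j * (3 * r0) + K i j" for i j
  define C where "C = (\<Sum>i\<in>B. \<Sum>j\<in>B. k i j) + \<bar>C0\<bar> + 1"
  have sub: "x \<in> S" if "norm (x - x0) < 3 * r0" for x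
    using that d r0(2) by (auto simp: dist_norm norm_minus_commute)
  have coord: "cone_form x u v = (\<Sum>i\<in>B. \<Sum>j\<in>B. (u \<bullet> i) * (v \<bullet> j) * cone_form x i j)"
    if "norm (x - x0) < 3 * r0" for x u v
    unfolding B_def by (rule bilinear_coordinates[OF bilinear_cone_form[OF sub[OF that]]])
  have kK: "K i j \<le> k i j" for i j using K(2)[of i j] r0 by (simp add: k_def)
  have "k i j \<ge> 0" for i j using K(2)[of i j] r0 by (simp add: k_def)
  then have ksum: "(\<Sum>i\<in>B. \<Sum>j\<in>B. k i j) \<ge> 0" by (intro sum_nonneg)
  have Cs: "(\<Sum>i\<in>B. \<Sum>j\<in>B. k i j) \<le> C" by (simp add: C_def)
  have sumB: "(\<Sum>i\<in>B. \<Sum>j\<in>B. k i j * c) * n * m \<le> C * c * n * m"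
    if "c \<ge> 0" "n \<ge> 0" "m \<ge> 0" for c n m :: real
    unfolding sum_distrib_right[symmetric] using that Cs by (intro mult_right_mono) auto
  show thesis
  proof
    show "C \<ge> C0" using ksum by (simp add: C_def)
    show "ball x0 (3 * r0) \<subseteq> S" using r0(2) d(2) by auto
    show "bilinear_forms cone_form x0 r0 C"
    proof
      show "1 \<le> C"
        using ksum by (simp add: C_def)
      fix x :: 'e and u v :: "'e \<times> real" assume x: "norm (x - x0) < 3 * r0"
      show "bilinear (cone_form x)" "cone_form x u v = cone_form x v u"
        using sub[OF x] bilinear_cone_form cone_form_sym by blast+
      have "\<bar>cone_form x i j\<bar> \<le> k i j * 1" if "i \<in> Basis" "j \<in> Basis" for i j
      proof -
        have "\<bar>cone_form (x0 + (x - x0)) i j - cone_form x0 i j\<bar> \<le> K i j * norm (x - x0)"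
          using x r0(3)[unfolded B_def, OF that] K(1)[of i j] K(3)[of x0 i j "x - x0" 0] by simp
        also have "\<dots> \<le> K i j * (3 * r0)" using x K(2) by (intro mult_left_mono) auto
        finally show ?thesis using K(2)[of i j] by (simp add: k_def)
      qed
      from coordinate_form_bound[of "cone_form x" "\<lambda>i j. k i j * 1" u v, OF this] sumB[of 1 "norm u" "norm v"]
      show "\<bar>cone_form x u v\<bar> \<le> C * norm u * norm v"
        unfolding coord[OF x, of u v] B_def by simp
    next
      fix x a :: 'e and u v :: "'e \<times> real" assume x: "norm (x - x0) < r0" and a: "norm a < r0"
      have xa: "norm (x + a - x0) < 3 * r0"
        using norm_triangle_ineq[of "x - x0" a] x a r0 by (simp add: algebra_simps)
      have "\<bar>cone_form (x + a) i j - cone_form x i j\<bar> \<le> k i j * norm a"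
        if "i \<in> Basis" "j \<in> Basis" for i j
      proof -
        have "\<bar>cone_form (x + a) i j - cone_form x i j\<bar> \<le> K i j * norm a"
          using x a r0(1) r0(3)[unfolded B_def, OF that] K(3)[of x i j a 0] by simp
        also have "\<dots> \<le> k i j * norm a" using kK by (intro mult_right_mono) auto
        finally show ?thesis .
      qed
      from coordinate_form_bound[of "\<lambda>i j. cone_form (x + a) i j - cone_form x i j" "\<lambda>i j. k i j * norm a" u v, OF this]
        sumB[of "norm a" "norm u" "norm v"]
      show "\<bar>cone_form (x + a) u v - cone_form x u v\<bar> \<le> C * norm a * norm u * norm v"
        using x r0 coord[OF xa, of u v] coord[of x u v] unfolding B_def
        by (simp add: right_diff_distrib sum_subtractf)
    next
      fix x a b :: 'e and u v :: "'e \<times> real" assume x: "norm (x - x0) < r0" and a: "norm a < r0" and b: "norm b < r0"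
      have xa: "norm (x + a - x0) < 3 * r0" "norm (x + b - x0) < 3 * r0" "norm (x + a + b - x0) < 3 * r0"
        using norm_triangle_ineq[of "x - x0" a] norm_triangle_ineq[of "x - x0" b]
          norm_triangle_ineq[of "x - x0 + a" b] x a b r0 by (simp_all add: algebra_simps)
      have "\<bar>cone_form (x + a + b) i j - cone_form (x + a) i j - cone_form (x + b) i j + cone_form x i j\<bar>
           \<le> k i j * (norm a * norm b)"
        if "i \<in> Basis" "j \<in> Basis" for i j
      proof -
        have "\<bar>cone_form (x + a + b) i j - cone_form (x + a) i j - cone_form (x + b) i j + cone_form x i j\<bar>
            \<le> K i j * norm a * norm b"
          using x a b r0(1) r0(3)[unfolded B_def, OF that] K(3)[of x i j a b] by simp
        also have "\<dots> \<le> k i j * (norm a * norm b)"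
          unfolding mult.assoc using kK by (intro mult_right_mono) auto
        finally show ?thesis .
      qed
      from coordinate_form_bound[of "\<lambda>i j. cone_form (x + a + b) i j - cone_form (x + a) i j - cone_form (x + b) i j + cone_form x i j"
          "\<lambda>i j. k i j * (norm a * norm b)" u v, OF this]
        sumB[of "norm a * norm b" "norm u" "norm v"]
      show "\<bar>cone_form (x + a + b) u v - cone_form (x + a) u v - cone_form (x + b) u v + cone_form x u v\<bar>
          \<le> C * norm a * norm b * norm u * norm v"
        using x r0 coord[OF xa(1), of u v] coord[OF xa(2), of u v] coord[OF xa(3), of u v] coord[of x u v]
        unfolding B_def
        by (simp add: right_diff_distrib distrib_left sum_subtractf sum.distrib mult.assoc)
    qed (use r0 in auto)
  qed
qed

end

section \<open>Minimising curves do not branch\<close>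

context randers_chart
begin

lemma continuous_on_cost:
  fixes y y' :: "real \<Rightarrow> 'e"
  assumes "continuous_on I y" "continuous_on I y'" "\<And>t. t \<in> I \<Longrightarrow> y t \<in> S"
  shows "continuous_on I (\<lambda>t. cost (y t) (y' t))"
proof -
  have "continuous_on I (\<lambda>t. (\<lambda>(x, v). cost x v) (y t, y' t))"
    by (rule continuous_on_compose2[OF continuous_cost]) (use assms in \<open>auto intro: continuous_intros\<close>)
  then show ?thesis by simp
qed

text \<open>
  At time \<open>T\<close>, the curve \<open>x2\<close> departs from \<open>x1\<close> with the same velocity.  Let \<open>\<eta>\<close> be the difference
  \<open>x2 - x1\<close>, extended by \<open>0\<close> before \<open>T\<close>, and \<open>lin\<close> the linear function on \<open>{T-\<delta>..T+\<delta>}\<close> from \<open>0\<close> to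
  \<open>\<eta> (T + \<delta>)\<close>.  The competitors \<open>x1 + (\<eta> - lin) / 2\<close> and \<open>x1 + (\<eta> + lin) / 2\<close> have the same start and, as a
  pair, the same end points as the two curves.  If neither of them is faster, then \<open>\<eta>\<close> vanishes for
  small \<open>\<delta>\<close>.  Indeed, by the swap estimate their total travel time differs from \<open>4 \<delta>\<close> by minus a
  positive multiple of \<open>\<integral>|\<eta>'|\<^sup>2 - \<integral>|lin'|\<^sup>2\<close> up to small errors, and \<open>lin\<close>, having twice the time for the
  same displacement, has at most half of the energy of \<open>\<eta>\<close>.  Therefore the energy \<open>E\<close> of \<open>\<eta>\<close> is zero.

  The hypothesis on the competitors is stated with the constant \<open>k = (+/-) \<eta> (T + \<delta>) / (4 \<delta>)\<close>, half of the
  derivative of \<open>lin\<close> up to sign, which covers both of them.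
\<close>

lemma no_branching:
  fixes x1 x2 x1' x2' :: "real \<Rightarrow> 'e"
  assumes d: "d > 0"
    and x1: "\<And>t. t \<in> {T-d..T+d} \<Longrightarrow> (x1 has_vector_derivative x1' t) (at t within {T-d..T+d})"
      "continuous_on {T-d..T+d} x1'"
      "\<And>t. t \<in> {T-d..T+d} \<Longrightarrow> x1 t \<in> S"
      "\<And>t. t \<in> {T-d..T+d} \<Longrightarrow> cost (x1 t) (x1' t) = 1"
    and x2: "\<And>t. t \<in> {T..T+d} \<Longrightarrow> (x2 has_vector_derivative x2' t) (at t within {T..T+d})"
      "continuous_on {T..T+d} x2'"
      "\<And>t. t \<in> {T..T+d} \<Longrightarrow> x2 t \<in> S"
      "\<And>t. t \<in> {T..T+d} \<Longrightarrow> cost (x2 t) (x2' t) = 1"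
    and join: "x2 T = x1 T" "x2' T = x1' T"
    and min: "\<And>\<delta> c k. 0 < \<delta> \<Longrightarrow> \<delta> < d \<Longrightarrow> \<bar>c\<bar> = 1 / (4 * \<delta>) \<Longrightarrow> k = c *\<^sub>R (x2 (T + \<delta>) - x1 (T + \<delta>)) \<Longrightarrow>
       (\<And>t. t \<in> {T-\<delta>..T} \<Longrightarrow> x1 t + (t - (T - \<delta>)) *\<^sub>R k \<in> S) \<Longrightarrow>
       (\<And>t. t \<in> {T..T+\<delta>} \<Longrightarrow> (1/2) *\<^sub>R (x1 t + x2 t) + (t - (T - \<delta>)) *\<^sub>R k \<in> S) \<Longrightarrow>
       2 * \<delta> \<le> integral {T-\<delta>..T} (\<lambda>t. cost (x1 t + (t - (T - \<delta>)) *\<^sub>R k) (x1' t + k))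
         + integral {T..T+\<delta>} (\<lambda>t. cost ((1/2) *\<^sub>R (x1 t + x2 t) + (t - (T - \<delta>)) *\<^sub>R k)
             ((1/2) *\<^sub>R (x1' t + x2' t) + k))"
  shows "\<exists>\<delta>>0. \<delta> \<le> d \<and> (\<forall>t\<in>{T..T+\<delta>}. x2 t = x1 t)"
proof -
  define x0 v0 where "x0 = x1 T" and "v0 = x1' T"
  define z0 e where "z0 = (v0, 1::real)" and "e = (0::'e, 1::real)"
  define D0 where "D0 = - cone_form x0 z0 e"
  have x0S: "x0 \<in> S" and u0: "cost x0 v0 = 1" using x1(3,4)[of T] d by (auto simp: x0_def v0_def)
  have D0: "D0 > 0" using unit_cost(2)[OF x0S u0] by (simp add: D0_def z0_def e_def)
  obtain r0 C where bf: "bilinear_forms cone_form x0 r0 C" and C: "C \<ge> norm z0 + 3 + norm e"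
    and ball: "ball x0 (3 * r0) \<subseteq> S"
    using cone_form_locally_C2[OF x0S, of "norm z0 + 3 + norm e"] by blast
  have C': "norm z0 + 3 \<le> C" "norm e \<le> C" "C > 0" using C norm_ge_zero[of z0] norm_ge_zero[of e] by linarith+
  have r0: "r0 > 0" using bilinear_forms.r0[OF bf] .
  note hb = H_bil[OF x0S]
  obtain m where m: "m > 0" "\<And>u. m * (norm u)\<^sup>2 \<le> H x0 u u"
    using positive_form_coercive[OF hb H_pos[OF x0S]] by blast
  define M where "M = 9 * C ^ 3 / D0 + 200 * C ^ 7 / D0\<^sup>2 + 48 * C ^ 7 / D0 ^ 3"
  have M: "M > 0" using C'(3) D0 unfolding M_def by (intro add_pos_pos divide_pos_pos) auto
  define \<rho> where "\<rho> = min (min 1 r0) (min (D0 / (8 * C ^ 3)) (m / (192 * M * D0)))"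
  have \<rho>: "\<rho> > 0" "\<rho> \<le> 1" "\<rho> \<le> r0" "\<rho> \<le> D0 / (8 * C ^ 3)" "\<rho> \<le> m / (192 * M * D0)"
    using r0 D0 C'(3) m M by (auto simp: \<rho>_def)
  have \<rho>C: "8 * C ^ 3 * \<rho> \<le> D0" using \<rho>(4) C'(3) by (simp add: field_simps)
  define lam mu where "lam b = cone_form x0 z0 (b, 0)" and "mu b = cone_form x0 (b, 0) e" for b
  \<comment> \<open>the error \<open>s u\<close> of the swap estimate is absorbed by \<open>\<rho> u\<^sup>2 + s\<^sup>2 / \<rho>\<close>: after integration, \<open>\<rho>\<close> makes the
    velocity term small, and a choice of \<open>\<delta>\<close> depending on \<open>\<rho>\<close> the displacement term\<close>
  have pw: "cost (x + b) (v + \<beta>) + cost (x + a) (v + \<alpha>)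
      \<le> 2 - H x0 \<alpha> \<beta> / D0 - lam \<beta> * mu (\<alpha> - \<beta>) / D0\<^sup>2
        + M * (2 * \<rho> * (norm \<alpha> + norm \<beta>)\<^sup>2 + 2 / \<rho> * (norm a + norm b)\<^sup>2)"
    if n: "norm (x - x0) < \<rho>" "norm a < \<rho>" "norm b < \<rho>" "norm (v - v0) < \<rho>" "norm \<alpha> < \<rho>" "norm \<beta> < \<rho>"
      and g: "gap x v = 0" "gap (x + a + b) (v + \<alpha> + \<beta>) = 0" for x v a b \<alpha> \<beta>
  proof -
    define u s where "u = norm \<alpha> + norm \<beta>" and "s = norm a + norm b"
    have n': "norm ((v, 1::real) - z0) < \<rho>" "norm (\<alpha>, 0::real) < \<rho>" "norm (\<beta>, 0::real) < \<rho>"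
      using n by (simp_all add: z0_def norm_Pair)
    have g': "cone_form (x + a + b) ((v, 1) + (\<alpha>, 0) + (\<beta>, 0)) ((v, 1) + (\<alpha>, 0) + (\<beta>, 0)) = 0"
      using g by simp
    have us: "u = norm (\<alpha>, 0::real) + norm (\<beta>, 0::real)" by (simp add: u_def norm_Pair)
    note est = bilinear_forms.swap_estimate[OF bf D0_def D0 C'(1,2) \<rho>(1,3,2) \<rho>C n(1-3) n' g(1) g' refl refl us s_def]
    have sl: "slope (x + b) (v + \<beta>) > 0" "slope (x + a) (v + \<alpha>) > 0"
      using est(1,2) by (simp_all add: e_def)
    have xS: "x + b \<in> S" "x + a \<in> S"
    proof -
      have "norm (x + b - x0) < 3 * r0" "norm (x + a - x0) < 3 * r0"
        using norm_triangle_ineq[of "x - x0" b] norm_triangle_ineq[of "x - x0" a] n \<rho>(1,3)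
        by (simp_all add: algebra_simps)
      then show "x + b \<in> S" "x + a \<in> S" using ball by (auto simp: dist_norm norm_minus_commute)
    qed
    have su: "s * u \<le> \<rho> * u\<^sup>2 + s\<^sup>2 / \<rho>"
    proof -
      have "0 \<le> (\<rho> * u - s)\<^sup>2 + \<rho> * (s * u)" using \<rho> by (simp add: s_def u_def)
      then have "\<rho> * (s * u) \<le> \<rho> * (\<rho> * u\<^sup>2) + s\<^sup>2" by (simp add: power2_eq_square algebra_simps)
      then show ?thesis using \<rho>(1) by (simp add: field_simps)
    qed
    have "s\<^sup>2 * \<rho> \<le> s\<^sup>2" using \<rho>(1,2) by (intro mult_right_le_one_le) auto
    then have s2: "s\<^sup>2 \<le> s\<^sup>2 / \<rho>" using \<rho>(1) by (simp add: field_simps)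
    have "\<rho> * u\<^sup>2 + s * u + s\<^sup>2 \<le> 2 * \<rho> * u\<^sup>2 + 2 / \<rho> * s\<^sup>2" using su s2 by simp
    then have "M * (\<rho> * u\<^sup>2 + s * u + s\<^sup>2) \<le> M * (2 * \<rho> * u\<^sup>2 + 2 / \<rho> * s\<^sup>2)"
      using M by (intro mult_left_mono) auto
    moreover have "cost (x + b) (v + \<beta>) + cost (x + a) (v + \<alpha>)
        \<le> 2 + (gap (x + b) (v + \<beta>) / (2 * slope (x + b) (v + \<beta>)) + gap (x + a) (v + \<alpha>) / (2 * slope (x + a) (v + \<alpha>)))"
      using cost_le[OF xS(1) sl(1)] cost_le[OF xS(2) sl(2)] by linarith
    moreover have "gap (x + b) (v + \<beta>) / (2 * slope (x + b) (v + \<beta>)) + gap (x + a) (v + \<alpha>) / (2 * slope (x + a) (v + \<alpha>))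
       \<le> - H x0 \<alpha> \<beta> / D0 - lam \<beta> * mu (\<alpha> - \<beta>) / D0\<^sup>2 + M * (\<rho> * u\<^sup>2 + s * u + s\<^sup>2)"
      using est(3) unfolding M_def[symmetric] lam_def mu_def by (simp add: e_def cone_form_horizontal)
    ultimately show ?thesis unfolding u_def s_def by linarith
  qed
  have near: "\<exists>\<delta>>0. \<forall>t\<in>I. \<bar>t - T\<bar> < \<delta> \<longrightarrow> norm (f t - f T) < \<rho> / 2"
    if "continuous_on I f" "T \<in> I" for I and f :: "real \<Rightarrow> 'e"
    using that \<rho>(1) unfolding continuous_on_iff dist_norm real_norm_def by (metis half_gt_zero)
  have c1: "continuous_on {T-d..T+d} x1" and c2: "continuous_on {T..T+d} x2"
    using continuous_on_vector_derivative x1(1) x2(1) by blast+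
  obtain d1 where d1: "d1 > 0" "\<And>t. t \<in> {T-d..T+d} \<Longrightarrow> \<bar>t - T\<bar> < d1 \<Longrightarrow> norm (x1 t - x0) < \<rho> / 2"
    using near[OF c1] d by (auto simp: x0_def)
  obtain d2 where d2: "d2 > 0" "\<And>t. t \<in> {T-d..T+d} \<Longrightarrow> \<bar>t - T\<bar> < d2 \<Longrightarrow> norm (x1' t - v0) < \<rho> / 2"
    using near[OF x1(2)] d by (auto simp: v0_def)
  obtain d3 where d3: "d3 > 0" "\<And>t. t \<in> {T..T+d} \<Longrightarrow> \<bar>t - T\<bar> < d3 \<Longrightarrow> norm (x2 t - x0) < \<rho> / 2"
    using near[OF c2] d join by (auto simp: x0_def)
  obtain d4 where d4: "d4 > 0" "\<And>t. t \<in> {T..T+d} \<Longrightarrow> \<bar>t - T\<bar> < d4 \<Longrightarrow> norm (x2' t - v0) < \<rho> / 2"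
    using near[OF x2(2)] d join by (auto simp: v0_def)
  \<comment> \<open>\<open>\<delta> \<le> q\<close> and the last bound on \<open>\<rho>\<close> keep the sum of the errors below the main term \<open>E / (8 D0)\<close>\<close>
  define q where "q = \<rho> * m / (384 * M * D0)"
  have q: "q > 0" using \<rho> m M D0 by (simp add: q_def)
  define \<delta> where "\<delta> = min (min (min d1 d2) (min d3 d4)) (min (min 1 d) q) / 2"
  have \<delta>: "\<delta> > 0" "\<delta> < d" "\<delta> < d1" "\<delta> < d2" "\<delta> < d3" "\<delta> < d4" "\<delta> \<le> 1" "\<delta> \<le> q"
    using d d1(1) d2(1) d3(1) d4(1) q by (auto simp: \<delta>_def)
  define \<eta> \<eta>' where "\<eta> t = x2 t - x1 t" and "\<eta>' t = x2' t - x1' t" for t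
  have sub: "{T..T+\<delta>} \<subseteq> {T..T+d}" "{T..T+\<delta>} \<subseteq> {T-d..T+d}" "{T-\<delta>..T} \<subseteq> {T-d..T+d}"
    using \<delta> d by auto
  have dx1: "(x1 has_vector_derivative x1' t) (at t within {T..T+\<delta>})" if "t \<in> {T..T+\<delta>}" for t
    using x1(1)[of t] that sub by (auto intro: has_vector_derivative_within_subset)
  have dx2: "(x2 has_vector_derivative x2' t) (at t within {T..T+\<delta>})" if "t \<in> {T..T+\<delta>}" for t
    using x2(1)[of t] that sub by (auto intro: has_vector_derivative_within_subset)
  have d\<eta>: "(\<eta> has_vector_derivative \<eta>' t) (at t within {T..T+\<delta>})" if "t \<in> {T..T+\<delta>}" for t
    unfolding \<eta>_def \<eta>'_def by (intro has_vector_derivative_diff dx1 dx2 that)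
  have c\<eta>': "continuous_on {T..T+\<delta>} \<eta>'"
    unfolding \<eta>'_def using x1(2) x2(2) sub by (intro continuous_intros) (auto intro: continuous_on_subset)
  have n\<eta>: "norm (\<eta> t) < \<rho>" "norm (\<eta>' t) < \<rho>" if "t \<in> {T..T+\<delta>}" for t
  proof -
    have "norm (x1 t - x0) < \<rho> / 2" "norm (x2 t - x0) < \<rho> / 2"
      "norm (x1' t - v0) < \<rho> / 2" "norm (x2' t - v0) < \<rho> / 2"
      using d1(2)[of t] d2(2)[of t] d3(2)[of t] d4(2)[of t] that \<delta> by auto
    then show "norm (\<eta> t) < \<rho>" "norm (\<eta>' t) < \<rho>"
      using norm_triangle_ineq4[of "x2 t - x0" "x1 t - x0"] norm_triangle_ineq4[of "x2' t - v0" "x1' t - v0"]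
      by (auto simp: \<eta>_def \<eta>'_def)
  qed
  define g where "g t = H x0 (\<eta>' t) (\<eta>' t)" for t
  define E where "E = integral {T..T+\<delta>} g"
  have bb: "bounded_bilinear (H x0)" using hb by (simp add: bilinear_conv_bounded_bilinear)
  have cg: "continuous_on {T..T+\<delta>} g"
    unfolding g_def by (rule bounded_bilinear.continuous_on[OF bb c\<eta>' c\<eta>'])
  have ig: "(g has_integral E) {T..T+\<delta>}"
    unfolding E_def using cg integrable_continuous_interval by blast
  have g0: "g t \<ge> 0" for t unfolding g_def by (rule H_nonneg[OF x0S])
  have E0: "E \<ge> 0" using has_integral_nonneg[OF ig] g0 by blast
  have energy: "H x0 (\<eta> t) (\<eta> t) \<le> \<delta> * E" if t: "t \<in> {T..T+\<delta>}" for t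
  proof (cases "t = T")
    case True
    then show ?thesis using join E0 \<delta> bilinear_lzero[OF hb] by (simp add: \<eta>_def)
  next
    case False
    have s: "{T..t} \<subseteq> {T..T+\<delta>}" using t by auto
    have "H x0 (\<eta> t) (\<eta> t) \<le> (t - T) * integral {T..t} (\<lambda>s. H x0 (\<eta>' s) (\<eta>' s))"
    proof (rule energy_bounds_displacement[OF hb])
      show "T < t" using t False by auto
      show "(\<eta> has_vector_derivative \<eta>' s) (at s within {T..t})" if "s \<in> {T..t}" for s
        using d\<eta>[of s] that s by (auto intro: has_vector_derivative_within_subset)
      show "continuous_on {T..t} \<eta>'" using c\<eta>' s by (rule continuous_on_subset)
    qed (use H_sym[OF x0S] H_nonneg[OF x0S] join in \<open>auto simp: \<eta>_def\<close>)
    also have "integral {T..t} (\<lambda>s. H x0 (\<eta>' s) (\<eta>' s)) \<le> E"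
      unfolding E_def g_def[symmetric]
      using s cg g0 by (intro integral_subset_le integrable_continuous_interval) (auto intro: continuous_on_subset)
    then have "(t - T) * integral {T..t} (\<lambda>s. H x0 (\<eta>' s) (\<eta>' s)) \<le> \<delta> * E"
      using t E0 by (intro mult_mono integral_nonneg integrable_continuous_interval
        continuous_on_subset[OF cg[unfolded g_def] s]) (auto intro: H_nonneg[OF x0S])
    finally show ?thesis .
  qed
  define w1 where "w1 = \<eta> (T + \<delta>)"
  define l where "l = (1 / (2 * \<delta>)) *\<^sub>R w1"
  define W2 where "W2 = \<delta> * E / m"
  have n2: "(norm (\<eta> t))\<^sup>2 \<le> W2" if "t \<in> {T..T+\<delta>}" for t
    using order.trans[OF m(2) energy[OF that]] m(1) by (simp add: W2_def field_simps)
  have w2: "(norm w1)\<^sup>2 \<le> W2" unfolding w1_def using \<delta> by (intro n2) auto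
  have iw: "(\<eta>' has_integral w1) {T..T+\<delta>}"
    using fundamental_theorem_of_calculus[of T "T + \<delta>" \<eta> \<eta>'] d\<eta> \<delta> join by (simp add: w1_def \<eta>_def)
  have "norm w1 \<le> \<rho> * measure lborel {T..T+\<delta>}"
    by (rule has_integral_bound_real[OF _ finite.emptyI iw])
      (use n\<eta>(2) \<rho>(1) in \<open>auto intro: less_imp_le\<close>)
  then have nw: "norm w1 \<le> \<rho> * \<delta>" using \<delta>(1) by simp
  have nl: "norm l < \<rho>" "norm l = norm w1 / (2 * \<delta>)"
  proof -
    show e: "norm l = norm w1 / (2 * \<delta>)" using \<delta>(1) by (simp add: l_def)
    have "\<rho> * \<delta> < \<rho> * (2 * \<delta>)" using \<rho>(1) \<delta>(1) by (intro mult_strict_left_mono) auto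
    then have "norm w1 < \<rho> * (2 * \<delta>)" using nw by linarith
    then show "norm l < \<rho>" unfolding e using \<delta>(1) by (simp add: pos_divide_less_eq)
  qed
  have l2: "\<delta> * (norm l)\<^sup>2 \<le> E / (4 * m)"
    using w2 \<delta>(1) m(1) unfolding nl(2) W2_def by (simp add: power_divide power2_eq_square field_simps)
  have Hl: "\<delta> * H x0 l l \<le> E / 4"
  proof -
    have "H x0 l l = H x0 w1 w1 / (4 * \<delta>\<^sup>2)"
      by (simp add: l_def bilinear_lmul[OF hb] bilinear_rmul[OF hb] power2_eq_square)
    moreover have "H x0 w1 w1 \<le> \<delta> * E" unfolding w1_def using \<delta> by (intro energy) auto
    then have "H x0 w1 w1 / (4 * \<delta>) \<le> (\<delta> * E) / (4 * \<delta>)" using \<delta>(1) by (intro divide_right_mono) auto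
    ultimately show ?thesis using \<delta>(1) by (simp add: power2_eq_square)
  qed
  define lin where "lin t = (t - (T - \<delta>)) *\<^sub>R l" for t
  have nlin: "norm (lin t) \<le> norm w1" if "t \<in> {T-\<delta>..T+\<delta>}" for t
  proof -
    have "norm (lin t) = (t - (T - \<delta>)) / (2 * \<delta>) * norm w1" using that nl(2) by (simp add: lin_def)
    also have "\<dots> \<le> 1 * norm w1" using that \<delta>(1) by (intro mult_right_mono) auto
    finally show ?thesis by simp
  qed
  have nw\<rho>: "norm w1 < \<rho>" using n\<eta>(1)[of "T + \<delta>"] \<delta> by (simp add: w1_def)
  have nlin\<rho>: "norm (lin t) < \<rho>" if "t \<in> {T-\<delta>..T+\<delta>}" for t using nlin[OF that] nw\<rho> by linarith
  have nlin2: "(norm (lin t))\<^sup>2 \<le> W2" if "t \<in> {T-\<delta>..T+\<delta>}" for t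
    by (rule order.trans[OF power_mono[OF nlin[OF that] norm_ge_zero] w2])
  have pairs: "(norm (p + q) + norm (p - q))\<^sup>2 \<le> 8 * (norm p)\<^sup>2 + 8 * (norm q)\<^sup>2" for p q :: 'e
  proof -
    have "norm (p + q) + norm (p - q) \<le> 2 * (norm p + norm q)"
      using norm_triangle_ineq[of p q] norm_triangle_ineq4[of p q] by simp
    then have "(norm (p + q) + norm (p - q))\<^sup>2 \<le> (2 * (norm p + norm q))\<^sup>2" by (intro power_mono) auto
    also have "\<dots> \<le> 8 * (norm p)\<^sup>2 + 8 * (norm q)\<^sup>2"
      using zero_le_power2[of "norm p - norm q"] by (simp add: power2_eq_square algebra_simps)
    finally show ?thesis .
  qed
  have lmul: "lam (c *\<^sub>R b) = c * lam b" "mu (c *\<^sub>R b) = c * mu b" for c b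
    using bilinear_rmul[OF bilinear_cone_form[OF x0S], of z0 c "(b, 0)"]
      bilinear_lmul[OF bilinear_cone_form[OF x0S], of c "(b, 0)" e]
    by (simp_all add: lam_def mu_def)
  have ldiff: "lam (b - c) = lam b - lam c" for b c
    using bilinear_rsub[OF bilinear_cone_form[OF x0S], of z0 "(b, 0)" "(c, 0)"] by (simp add: lam_def)
  define \<kappa> where "\<kappa> = (1/2) *\<^sub>R l"
  define yL where "yL k t = x1 t + (t - (T - \<delta>)) *\<^sub>R k" for k t
  define yR where "yR k t = (1/2) *\<^sub>R (x1 t + x2 t) + (t - (T - \<delta>)) *\<^sub>R k" for k t
  define cL where "cL = 2 + H x0 l l / (4 * D0) + lam l * mu l / (2 * D0\<^sup>2)
     + M * (2 * \<rho> * (norm l)\<^sup>2 + 2 / \<rho> * W2)"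
  have kk: "(t - (T - \<delta>)) *\<^sub>R \<kappa> = (1/2) *\<^sub>R lin t" for t by (simp add: \<kappa>_def lin_def)
  have L: "cost (yL (- \<kappa>) t) (x1' t - \<kappa>) + cost (yL \<kappa> t) (x1' t + \<kappa>) \<le> cL"
    and LS: "yL (- \<kappa>) t \<in> S" "yL \<kappa> t \<in> S" if t: "t \<in> {T-\<delta>..T}" for t
  proof -
    have tt: "t \<in> {T-\<delta>..T+\<delta>}" "t \<in> {T-d..T+d}" "\<bar>t - T\<bar> \<le> \<delta>" using t \<delta> by auto
    have nx: "norm (x1 t - x0) < \<rho> / 2" "norm (x1' t - v0) < \<rho> / 2" using d1(2)[of t] d2(2)[of t] tt \<delta> by auto
    have e: "yL (- \<kappa>) t = x1 t + - ((1/2) *\<^sub>R lin t)" "yL \<kappa> t = x1 t + (1/2) *\<^sub>R lin t"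
      by (simp_all add: yL_def kk)
    have "norm (- ((1/2) *\<^sub>R lin t)) < \<rho>" "norm ((1/2) *\<^sub>R lin t) < \<rho>" "norm \<kappa> < \<rho>" "norm (- \<kappa>) < \<rho>"
      using nlin\<rho>[OF tt(1)] nl(1) \<rho>(1) by (auto simp: \<kappa>_def)
    note pwt = pw[of "x1 t" "(1/2) *\<^sub>R lin t" "- ((1/2) *\<^sub>R lin t)" "x1' t" \<kappa> "- \<kappa>", OF _ this(2,1) _ this(3,4)]
    have gp: "gap (x1 t) (x1' t) = 0" using unit_cost(1) x1(3,4) tt by blast
    have "cost (yL (- \<kappa>) t) (x1' t - \<kappa>) + cost (yL \<kappa> t) (x1' t + \<kappa>)
      \<le> 2 - H x0 \<kappa> (- \<kappa>) / D0 - lam (- \<kappa>) * mu (\<kappa> - - \<kappa>) / D0\<^sup>2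
        + M * (2 * \<rho> * (norm \<kappa> + norm (- \<kappa>))\<^sup>2 + 2 / \<rho> * (norm ((1/2) *\<^sub>R lin t) + norm (- ((1/2) *\<^sub>R lin t)))\<^sup>2)"
      using pwt gp nx \<rho>(1) unfolding e by simp
    also have "\<dots> = 2 + H x0 l l / (4 * D0) + lam l * mu l / (2 * D0\<^sup>2)
        + M * (2 * \<rho> * (norm l)\<^sup>2 + 2 / \<rho> * (norm (lin t))\<^sup>2)"
    proof -
      have k2: "\<kappa> - - \<kappa> = l" "- \<kappa> = (- 1/2) *\<^sub>R l" by (simp_all add: \<kappa>_def scaleR_left_distrib[symmetric])
      have "H x0 \<kappa> (- \<kappa>) = - (H x0 l l / 4)"
        unfolding k2 unfolding \<kappa>_def by (simp add: bilinear_lmul[OF hb] bilinear_rmul[OF hb] bilinear_rneg[OF hb])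
      moreover have "lam (- \<kappa>) = - (lam l / 2)" unfolding k2 lmul by simp
      moreover have "norm \<kappa> + norm (- \<kappa>) = norm l" by (simp add: \<kappa>_def)
      moreover have "norm ((1/2) *\<^sub>R lin t) + norm (- ((1/2) *\<^sub>R lin t)) = norm (lin t)" by simp
      ultimately show ?thesis unfolding k2(1) by simp
    qed
    also have "\<dots> \<le> cL"
      unfolding cL_def using M \<rho>(1) nlin2[OF tt(1)] by (intro add_left_mono mult_left_mono) auto
    finally show "cost (yL (- \<kappa>) t) (x1' t - \<kappa>) + cost (yL \<kappa> t) (x1' t + \<kappa>) \<le> cL" .
    have "norm (yL (- \<kappa>) t - x0) < 3 * r0" "norm (yL \<kappa> t - x0) < 3 * r0"
      using norm_triangle_ineq[of "x1 t - x0" "- ((1/2) *\<^sub>R lin t)"] norm_triangle_ineq[of "x1 t - x0" "(1/2) *\<^sub>R lin t"]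
        nx nlin\<rho>[OF tt(1)] \<rho>(1,3) r0 unfolding e by (auto simp: algebra_simps)
    then show "yL (- \<kappa>) t \<in> S" "yL \<kappa> t \<in> S" using ball by (auto simp: dist_norm norm_minus_commute)
  qed
  define cR where "cR = 2 + H x0 l l / (4 * D0) + lam l * mu l / (2 * D0\<^sup>2)
     + M * (2 * \<rho> * (2 * (norm l)\<^sup>2) + 2 / \<rho> * (4 * W2))"
  define aR where "aR = - 1 / (4 * D0) + 4 * M * \<rho> / m"
  have R: "cost (yR (- \<kappa>) t) ((1/2) *\<^sub>R (x1' t + x2' t) - \<kappa>) + cost (yR \<kappa> t) ((1/2) *\<^sub>R (x1' t + x2' t) + \<kappa>)
      \<le> aR * g t - mu l / (2 * D0\<^sup>2) * lam (\<eta>' t) + cR"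
    and RS: "yR (- \<kappa>) t \<in> S" "yR \<kappa> t \<in> S" if t: "t \<in> {T..T+\<delta>}" for t
  proof -
    have tt: "t \<in> {T-\<delta>..T+\<delta>}" "t \<in> {T-d..T+d}" "\<bar>t - T\<bar> \<le> \<delta>" "t \<in> {T..T+d}" using t \<delta> by auto
    have nx: "norm (x1 t - x0) < \<rho> / 2" "norm (x1' t - v0) < \<rho> / 2" using d1(2)[of t] d2(2)[of t] tt \<delta> by auto
    define a b where "a = (1/2) *\<^sub>R (\<eta> t + lin t)" and "b = (1/2) *\<^sub>R (\<eta> t - lin t)"
    define \<alpha> \<beta> where "\<alpha> = (1/2) *\<^sub>R (\<eta>' t + l)" and "\<beta> = (1/2) *\<^sub>R (\<eta>' t - l)"
    have half: "x + (1/2) *\<^sub>R (y - x + z) = (1/2) *\<^sub>R (x + y) + (1/2) *\<^sub>R z"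
      "x + (1/2) *\<^sub>R (y - x - z) = (1/2) *\<^sub>R (x + y) - (1/2) *\<^sub>R z"  for x y z :: 'e
    proof -
      have "x + (1/2) *\<^sub>R p = (1/2) *\<^sub>R (x + x + p)" for p
        unfolding scaleR_right_distrib[of "1/2" "x + x" p] scaleR_half_double ..
      moreover have "x + x + (y - x + z) = (x + y) + z" "x + x + (y - x - z) = (x + y) - z" by simp_all
      ultimately
      show "x + (1/2) *\<^sub>R (y - x + z) = (1/2) *\<^sub>R (x + y) + (1/2) *\<^sub>R z"
       "x + (1/2) *\<^sub>R (y - x - z) = (1/2) *\<^sub>R (x + y) - (1/2) *\<^sub>R z"
        by (metis scaleR_right_distrib, metis scaleR_right_diff_distrib)
    qed
    have e: "yR (- \<kappa>) t = x1 t + b" "yR \<kappa> t = x1 t + a"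
      "(1/2) *\<^sub>R (x1' t + x2' t) - \<kappa> = x1' t + \<beta>" "(1/2) *\<^sub>R (x1' t + x2' t) + \<kappa> = x1' t + \<alpha>"
      by (simp_all add: yR_def lin_def \<kappa>_def a_def b_def \<alpha>_def \<beta>_def \<eta>_def \<eta>'_def half)
    have dbl: "(1/2) *\<^sub>R (p + q) + (1/2) *\<^sub>R (p - q) = p" "(1/2) *\<^sub>R (p + q) - (1/2) *\<^sub>R (p - q) = q" for p q :: 'e
      by (simp_all add: scaleR_right_distrib scaleR_right_diff_distrib scaleR_left_distrib[symmetric])
    have s: "x1 t + a + b = x2 t" "x1' t + \<alpha> + \<beta> = x2' t" "\<alpha> - \<beta> = l"
      using dbl by (simp_all add: a_def b_def \<alpha>_def \<beta>_def add.assoc \<eta>_def \<eta>'_def)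
    have hn: "norm ((1/2) *\<^sub>R (p + q)) < \<rho>" "norm ((1/2) *\<^sub>R (p - q)) < \<rho>"
      if "norm p < \<rho>" "norm q < \<rho>" for p q :: 'e
      using norm_triangle_ineq[of p q] norm_triangle_ineq4[of p q] that by simp_all
    have n: "norm a < \<rho>" "norm b < \<rho>" "norm \<alpha> < \<rho>" "norm \<beta> < \<rho>"
      unfolding a_def b_def \<alpha>_def \<beta>_def using n\<eta>[OF t] nlin\<rho>[OF tt(1)] nl(1) by (auto intro!: hn simp del: norm_scaleR)
    have gp: "gap (x1 t) (x1' t) = 0" "gap (x2 t) (x2' t) = 0"
      using unit_cost(1) x1(3,4)[of t] x2(3,4)[of t] tt by blast+
    have "cost (x1 t + b) (x1' t + \<beta>) + cost (x1 t + a) (x1' t + \<alpha>)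
      \<le> 2 - H x0 \<alpha> \<beta> / D0 - lam \<beta> * mu (\<alpha> - \<beta>) / D0\<^sup>2
        + M * (2 * \<rho> * (norm \<alpha> + norm \<beta>)\<^sup>2 + 2 / \<rho> * (norm a + norm b)\<^sup>2)"
      using nx \<rho>(1) gp by (intro pw n) (auto simp: s)
    also have "\<dots> \<le> 2 - H x0 \<alpha> \<beta> / D0 - lam \<beta> * mu (\<alpha> - \<beta>) / D0\<^sup>2
        + M * (2 * \<rho> * (2 * (g t / m) + 2 * (norm l)\<^sup>2) + 2 / \<rho> * (4 * W2))"
    proof -
      have hp: "(norm ((1/2) *\<^sub>R (p + q)) + norm ((1/2) *\<^sub>R (p - q)))\<^sup>2 \<le> 2 * (norm p)\<^sup>2 + 2 * (norm q)\<^sup>2" for p q :: 'e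
        using pairs[of "(1/2) *\<^sub>R p" "(1/2) *\<^sub>R q"]
        by (simp add: scaleR_right_distrib scaleR_right_diff_distrib power_mult_distrib power_divide)
      have "(norm a + norm b)\<^sup>2 \<le> 4 * W2"
        unfolding a_def b_def using order.trans[OF hp, of "\<eta> t" "lin t" "4 * W2"] n2[OF t] nlin2[OF tt(1)] by linarith
      moreover have "(norm \<alpha> + norm \<beta>)\<^sup>2 \<le> 2 * (g t / m) + 2 * (norm l)\<^sup>2"
      proof -
        have "(norm (\<eta>' t))\<^sup>2 \<le> g t / m" using m(2)[of "\<eta>' t"] m(1) by (simp add: g_def field_simps)
        then show ?thesis unfolding \<alpha>_def \<beta>_def using hp[of "\<eta>' t" l] by linarith
      qed
      ultimately show ?thesis
        using M \<rho>(1) by (intro add_left_mono mult_left_mono add_mono) auto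
    qed
    also have "\<dots> = aR * g t - mu l / (2 * D0\<^sup>2) * lam (\<eta>' t) + cR"
    proof -
      have eqH: "H x0 \<alpha> \<beta> = g t / 4 - H x0 l l / 4"
        using H_sym[OF x0S, of l "\<eta>' t"] unfolding \<alpha>_def \<beta>_def g_def
        by (simp add: bilinear_ladd[OF hb] bilinear_rsub[OF hb] bilinear_lmul[OF hb] bilinear_rmul[OF hb] algebra_simps)
      have eqL: "lam \<beta> = lam (\<eta>' t) / 2 - lam l / 2"
        unfolding \<beta>_def lmul ldiff by simp
      show ?thesis
        unfolding s(3) eqH eqL aR_def cR_def by (simp add: algebra_simps diff_divide_distrib add_divide_distrib)
    qed
    finally show "cost (yR (- \<kappa>) t) ((1/2) *\<^sub>R (x1' t + x2' t) - \<kappa>) + cost (yR \<kappa> t) ((1/2) *\<^sub>R (x1' t + x2' t) + \<kappa>)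
      \<le> aR * g t - mu l / (2 * D0\<^sup>2) * lam (\<eta>' t) + cR"
      unfolding e .
    have "norm (x1 t + b - x0) < 3 * r0" "norm (x1 t + a - x0) < 3 * r0"
      using norm_triangle_ineq[of "x1 t - x0" b] norm_triangle_ineq[of "x1 t - x0" a]
        nx n \<rho>(1,3) by (auto simp: algebra_simps)
    then show "yR (- \<kappa>) t \<in> S" "yR \<kappa> t \<in> S" unfolding e using ball by (auto simp: dist_norm norm_minus_commute)
  qed
  define fL where "fL k t = cost (yL k t) (x1' t + k)" for k t
  define fR where "fR k t = cost (yR k t) ((1/2) *\<^sub>R (x1' t + x2' t) + k)" for k t
  have iL: "(fL k has_integral integral {T-\<delta>..T} (fL k)) {T-\<delta>..T}" if "k = \<kappa> \<or> k = - \<kappa>" for k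
  proof -
    have "continuous_on {T-\<delta>..T} (fL k)" unfolding fL_def
    proof (intro continuous_on_cost)
      show "continuous_on {T-\<delta>..T} (yL k)" unfolding yL_def
        by (intro continuous_intros continuous_on_subset[OF c1 sub(3)])
      show "continuous_on {T-\<delta>..T} (\<lambda>t. x1' t + k)"
        by (intro continuous_intros continuous_on_subset[OF x1(2) sub(3)])
    qed (use LS that in auto)
    then show ?thesis by (metis integrable_continuous_interval integrable_integral)
  qed
  have iR: "(fR k has_integral integral {T..T+\<delta>} (fR k)) {T..T+\<delta>}" if "k = \<kappa> \<or> k = - \<kappa>" for k
  proof -
    have "continuous_on {T..T+\<delta>} (fR k)" unfolding fR_def
    proof (intro continuous_on_cost)
      show "continuous_on {T..T+\<delta>} (yR k)" unfolding yR_def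
        by (intro continuous_intros continuous_on_subset[OF c1 sub(2)] continuous_on_subset[OF c2 sub(1)])
      show "continuous_on {T..T+\<delta>} (\<lambda>t. (1/2) *\<^sub>R (x1' t + x2' t) + k)"
        by (intro continuous_intros continuous_on_subset[OF x1(2) sub(2)] continuous_on_subset[OF x2(2) sub(1)])
    qed (use RS that in auto)
    then show ?thesis by (metis integrable_continuous_interval integrable_integral)
  qed
  have mn: "2 * \<delta> \<le> integral {T-\<delta>..T} (fL k) + integral {T..T+\<delta>} (fR k)" if k: "k = \<kappa> \<or> k = - \<kappa>" for k
  proof -
    obtain c where c: "\<bar>c\<bar> = 1 / (4 * \<delta>)" "k = c *\<^sub>R (x2 (T + \<delta>) - x1 (T + \<delta>))"
    proof -
      from k have "k = (1 / (4 * \<delta>)) *\<^sub>R (x2 (T + \<delta>) - x1 (T + \<delta>)) \<or> k = (- 1 / (4 * \<delta>)) *\<^sub>R (x2 (T + \<delta>) - x1 (T + \<delta>))"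
        by (auto simp: \<kappa>_def l_def w1_def \<eta>_def)
      then show thesis using that \<delta>(1) by (metis abs_divide abs_minus_cancel abs_mult abs_numeral abs_of_pos abs_one)
    qed
    show ?thesis
      unfolding fL_def fR_def yL_def yR_def
      using LS RS k by (intro min[OF \<delta>(1,2) c]) (auto simp: yL_def yR_def)
  qed
  have "integral {T-\<delta>..T} (fL (- \<kappa>)) + integral {T-\<delta>..T} (fL \<kappa>) \<le> \<delta> * cL"
  proof (rule has_integral_le)
    show "((\<lambda>t. fL (- \<kappa>) t + fL \<kappa> t) has_integral (integral {T-\<delta>..T} (fL (- \<kappa>)) + integral {T-\<delta>..T} (fL \<kappa>))) {T-\<delta>..T}"
      by (intro has_integral_add iL) auto
    show "((\<lambda>t. cL) has_integral \<delta> * cL) {T-\<delta>..T}"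
      using has_integral_const_real[of cL "T - \<delta>" T] \<delta>(1) by simp
    show "fL (- \<kappa>) t + fL \<kappa> t \<le> cL" if "t \<in> {T-\<delta>..T}" for t
      using L[OF that] by (simp add: fL_def)
  qed
  moreover have "integral {T..T+\<delta>} (fR (- \<kappa>)) + integral {T..T+\<delta>} (fR \<kappa>)
     \<le> aR * E - mu l / (2 * D0\<^sup>2) * lam w1 + \<delta> * cR"
  proof (rule has_integral_le)
    show "((\<lambda>t. fR (- \<kappa>) t + fR \<kappa> t) has_integral (integral {T..T+\<delta>} (fR (- \<kappa>)) + integral {T..T+\<delta>} (fR \<kappa>))) {T..T+\<delta>}"
      by (intro has_integral_add iR) auto
    have "bounded_linear lam"
    proof -
      have "linear lam"
        by (rule linearI) (use lmul ldiff[of _ "- _"] in \<open>auto simp: lam_def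
          bilinear_radd[OF bilinear_cone_form[OF x0S], symmetric]\<close>)
      then show ?thesis by (simp add: linear_conv_bounded_linear)
    qed
    then have "((\<lambda>t. lam (\<eta>' t)) has_integral lam w1) {T..T+\<delta>}"
      using has_integral_linear[OF iw] by (simp add: o_def)
    then show "((\<lambda>t. aR * g t - mu l / (2 * D0\<^sup>2) * lam (\<eta>' t) + cR) has_integral
        (aR * E - mu l / (2 * D0\<^sup>2) * lam w1 + \<delta> * cR)) {T..T+\<delta>}"
      using has_integral_const_real[of cR "T" "T+\<delta>"] \<delta>(1)
      by (intro has_integral_add has_integral_diff has_integral_mult_right ig) simp_all
    show "fR (- \<kappa>) t + fR \<kappa> t \<le> aR * g t - mu l / (2 * D0\<^sup>2) * lam (\<eta>' t) + cR" if "t \<in> {T..T+\<delta>}" for t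
      using R[OF that] by (simp add: fR_def)
  qed
  ultimately have "4 * \<delta> \<le> \<delta> * cL + (aR * E - mu l / (2 * D0\<^sup>2) * lam w1 + \<delta> * cR)"
    using mn[of \<kappa>, OF disjI1[OF refl]] mn[of "- \<kappa>", OF disjI2[OF refl]] by linarith
  \<comment> \<open>the terms linear in \<open>\<eta>\<close> and \<open>lin\<close> cancel, both functions having the same total displacement\<close>
  also have "mu l / (2 * D0\<^sup>2) * lam w1 = \<delta> * (lam l * mu l / D0\<^sup>2)"
  proof -
    have "w1 = (2 * \<delta>) *\<^sub>R l" using \<delta>(1) by (simp add: l_def)
    then have "lam w1 = 2 * \<delta> * lam l" using lmul(1)[of "2 * \<delta>" l] by simp
    then show ?thesis by simp
  qed
  also have "\<delta> * cL + (aR * E - \<delta> * (lam l * mu l / D0\<^sup>2) + \<delta> * cR)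
     = 4 * \<delta> + (\<delta> * H x0 l l) / (2 * D0) + aR * E + 6 * M * \<rho> * (\<delta> * (norm l)\<^sup>2) + 10 * M / \<rho> * (\<delta> * W2)"
    unfolding cL_def cR_def by (simp add: algebra_simps)
  finally have "0 \<le> (\<delta> * H x0 l l) / (2 * D0) + aR * E + 6 * M * \<rho> * (\<delta> * (norm l)\<^sup>2) + 10 * M / \<rho> * (\<delta> * W2)"
    by simp
  moreover have "(\<delta> * H x0 l l) / (2 * D0) \<le> (E / 4) / (2 * D0)"
    using Hl D0 by (intro divide_right_mono) auto
  moreover have "6 * M * \<rho> * (\<delta> * (norm l)\<^sup>2) \<le> 6 * M * \<rho> * (E / (4 * m))"
    using l2 M \<rho>(1) by (intro mult_left_mono) auto
  moreover have "10 * M / \<rho> * (\<delta> * W2) \<le> E / (32 * D0)"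
  proof -
    have "\<delta> * \<delta> \<le> 1 * q" using \<delta> q by (intro mult_mono) auto
    then have "10 * M / \<rho> * (\<delta> * \<delta> * (E / m)) \<le> 10 * M / \<rho> * (q * (E / m))"
      using M \<rho>(1) E0 m(1) by (intro mult_left_mono mult_right_mono) auto
    also have "\<dots> = 10 / 384 * (E / D0)"
      unfolding q_def using M \<rho>(1) m(1) D0 by (simp add: field_simps)
    also have "\<dots> \<le> 1 / 32 * (E / D0)" using E0 D0 by (intro mult_right_mono) auto
    finally show ?thesis by (simp add: W2_def mult.assoc)
  qed
  moreover have "M * \<rho> * E / m \<le> E / (192 * D0)"
  proof -
    have "M / m * E * \<rho> \<le> M / m * E * (m / (192 * M * D0))"
      using \<rho>(5) M m(1) E0 by (intro mult_left_mono) auto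
    also have "\<dots> = E / (192 * D0)" using M m(1) by simp
    finally show ?thesis by (simp add: mult_ac)
  qed
  moreover have "aR * E = - E / (4 * D0) + 4 * (M * \<rho> * E / m)" "6 * M * \<rho> * (E / (4 * m)) = 3 / 2 * (M * \<rho> * E / m)"
    using m(1) by (simp_all add: aR_def algebra_simps)
  ultimately have "0 \<le> (E / D0) * (1/8 - 1/4 + 11/2 * (1/192) + 1/32)"
    by (simp add: algebra_simps)
  then have "E / D0 \<le> 0" by (simp add: zero_le_mult_iff)
  then have "E = 0" using E0 D0 by (simp add: divide_le_0_iff)
  then have "\<eta> t = 0" if "t \<in> {T..T+\<delta>}" for t
    using n2[OF that] by (simp add: W2_def)
  then show ?thesis using \<delta>(1,2) by (intro exI[of _ \<delta>]) (auto simp: \<eta>_def)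
qed

end

section \<open>Coordinates on the manifold\<close>

lemma (in randers_chart) cost_homogeneous:
  assumes "x \<in> S" "a > 0"
  shows "cost x (a *\<^sub>R v) = a * cost x v"
proof -
  note l = bilinear_lmul[OF H_bil[OF assms(1)]] bilinear_rmul[OF H_bil[OF assms(1)]]
  have "(H x (w x) (a *\<^sub>R v))\<^sup>2 + (1 - H x (w x) (w x)) * H x (a *\<^sub>R v) (a *\<^sub>R v)
      = a\<^sup>2 * ((H x (w x) v)\<^sup>2 + (1 - H x (w x) (w x)) * H x v v)"
    by (simp add: l power2_eq_square algebra_simps)
  then show ?thesis
    using assms(2) by (simp add: cost_def l real_sqrt_mult right_diff_distrib)
qed

locale zermelo_manifold =
  fixes X :: "'m topology"
    and \<A> :: "('m, 'e::euclidean_space) chart set"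
    and h :: "'m \<Rightarrow> ('m, 'e) tvec \<Rightarrow> ('m, 'e) tvec \<Rightarrow> real"
    and W :: "'m \<Rightarrow> ('m, 'e) tvec"
    and F :: "'m \<Rightarrow> ('m, 'e) tvec \<Rightarrow> real"
  assumes manifold: "smooth_manifold X \<A>"
    and metric: "riemannian_metric \<A> h"
    and wind: "smooth_vector_field \<A> W"
    and mild: "\<And>p. p \<in> topspace X \<Longrightarrow> h p (W p) (W p) < 1"
    and F_eq: "F = randers_metric h W"
begin

lemma manifoldD:
  "Hausdorff_space X" "\<And>c. c \<in> \<A> \<Longrightarrow> is_chart X c" "(\<Union>c\<in>\<A>. fst c) = topspace X"
  "\<And>c c'. c \<in> \<A> \<Longrightarrow> c' \<in> \<A> \<Longrightarrow> smooth_transition c c'"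
  using manifold unfolding smooth_manifold_def by blast+

lemma chartD:
  assumes "(U, \<phi>) \<in> \<A>"
  shows "openin X U" "open (\<phi> ` U)" "homeomorphic_map (subtopology X U) (top_of_set (\<phi> ` U)) \<phi>"
    "U \<subseteq> topspace X" "inj_on \<phi> U"
proof -
  have "is_chart X (U, \<phi>)" using manifoldD(2) assms by blast
  then show 1: "openin X U" "open (\<phi> ` U)" "homeomorphic_map (subtopology X U) (top_of_set (\<phi> ` U)) \<phi>"
    by (auto simp: is_chart_def)
  show 2: "U \<subseteq> topspace X" using 1(1) by (rule openin_subset)
  show "inj_on \<phi> U"
    using homeomorphic_imp_injective_map[OF 1(3)] 2 by (simp add: inf_absorb2)
qed

lemma chart_cover: "p \<in> topspace X \<Longrightarrow> \<exists>U \<phi>. (U, \<phi>) \<in> \<A> \<and> p \<in> U"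
  using manifoldD(3) by fastforce

lemma chart_inv [simp]:
  assumes "(U, \<phi>) \<in> \<A>"
  shows "p \<in> U \<Longrightarrow> inv_into U \<phi> (\<phi> p) = p" "x \<in> \<phi> ` U \<Longrightarrow> \<phi> (inv_into U \<phi> x) = x"
    "x \<in> \<phi> ` U \<Longrightarrow> inv_into U \<phi> x \<in> U"
  using chartD(5)[OF assms] by (auto intro: inv_into_into f_inv_into_f)

lemma chart_inv_continuous:
  assumes c: "(U, \<phi>) \<in> \<A>"
  shows "continuous_map (top_of_set (\<phi> ` U)) X (inv_into U \<phi>)"
proof -
  obtain g where g: "homeomorphic_maps (subtopology X U) (top_of_set (\<phi> ` U)) \<phi> g"
    using chartD(3)[OF c] homeomorphic_map_maps by blast
  then have "continuous_map (top_of_set (\<phi> ` U)) (subtopology X U) g"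
    by (simp add: homeomorphic_maps_def)
  then have "continuous_map (top_of_set (\<phi> ` U)) X g"
    by (simp add: continuous_map_in_subtopology)
  moreover have "g x = inv_into U \<phi> x" if x: "x \<in> \<phi> ` U" for x
  proof -
    obtain p where p: "p \<in> U" "x = \<phi> p" using x by blast
    then have "g x = p" using g chartD(4)[OF c] by (auto simp: homeomorphic_maps_def)
    then show ?thesis using p chart_inv(1)[OF c] by simp
  qed
  ultimately show ?thesis by (rule continuous_map_eq) auto
qed

lemma chart_open_image:
  assumes c: "(U, \<phi>) \<in> \<A>" and V: "openin X V" "V \<subseteq> U"
  shows "open (\<phi> ` V)"
proof -
  have "openin (subtopology X U) V" using V by (auto simp: openin_subtopology)
  then have "openin (top_of_set (\<phi> ` U)) (\<phi> ` V)"
    using homeomorphic_imp_open_map[OF chartD(3)[OF c]] by (simp add: open_map_def)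
  then show ?thesis using chartD(2)[OF c] openin_open_trans by blast
qed

lemma open_chart_overlap:
  assumes "(U, \<phi>) \<in> \<A>" "(V, \<psi>) \<in> \<A>"
  shows "open (\<phi> ` (U \<inter> V))"
  using assms chartD(1) by (intro chart_open_image) auto

lemma transition_apply:
  assumes "(U, \<phi>) \<in> \<A>" "p \<in> U"
  shows "transition (U, \<phi>) (V, \<psi>) (\<phi> p) = \<psi> p"
  using assms by (simp add: transition_def)

lemma transition_smooth:
  assumes "(U, \<phi>) \<in> \<A>" "(V, \<psi>) \<in> \<A>"
  shows "smooth_on (\<phi> ` (U \<inter> V)) (transition (U, \<phi>) (V, \<psi>))"
  using manifoldD(4)[OF assms] by (simp add: smooth_transition_def)

abbreviation jacobian :: "('m, 'e) chart \<Rightarrow> ('m, 'e) chart \<Rightarrow> 'm \<Rightarrow> 'e \<Rightarrow> 'e" where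
  "jacobian c c' p \<equiv> frechet_derivative (transition c c') (at (snd c p))"

lemma transition_derivative:
  assumes "(U, \<phi>) \<in> \<A>" "(V, \<psi>) \<in> \<A>" "p \<in> U" "p \<in> V"
  shows "(transition (U, \<phi>) (V, \<psi>) has_derivative jacobian (U, \<phi>) (V, \<psi>) p) (at (\<phi> p))"
proof -
  have "transition (U, \<phi>) (V, \<psi>) differentiable (at (\<phi> p) within \<phi> ` (U \<inter> V))"
    using smooth_on_differentiable[OF transition_smooth[OF assms(1,2)]] assms(3,4)
    by (auto simp: differentiable_on_def)
  then have "transition (U, \<phi>) (V, \<psi>) differentiable (at (\<phi> p))"
    using at_within_open[OF _ open_chart_overlap[OF assms(1,2)], of "\<phi> p"] assms(3,4) by auto
  then show ?thesis by (simp add: frechet_derivative_works)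
qed

text \<open>
  The cocycle rule for transition maps, which makes the coordinates given by \<open>tvec_of\<close> consistent.
\<close>

lemma jacobian_compose:
  assumes "(U, \<phi>) \<in> \<A>" "(V, \<psi>) \<in> \<A>" "(V', \<theta>) \<in> \<A>" "p \<in> U" "p \<in> V" "p \<in> V'"
  shows "jacobian (V, \<psi>) (V', \<theta>) p (jacobian (U, \<phi>) (V, \<psi>) p u) = jacobian (U, \<phi>) (V', \<theta>) p u"
proof -
  have "openin X (U \<inter> V \<inter> V')" using chartD(1) assms by blast
  then have o: "open (\<phi> ` (U \<inter> V \<inter> V'))" by (rule chart_open_image[OF assms(1)]) auto
  have "(transition (V, \<psi>) (V', \<theta>) has_derivative jacobian (V, \<psi>) (V', \<theta>) p) (at (transition (U, \<phi>) (V, \<psi>) (\<phi> p)))"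
    using transition_derivative[OF assms(2,3,5,6)] transition_apply[OF assms(1,4)] by simp
  from has_derivative_compose[OF transition_derivative[OF assms(1,2,4,5)] this]
  have "((\<lambda>x. transition (V, \<psi>) (V', \<theta>) (transition (U, \<phi>) (V, \<psi>) x)) has_derivative
      (\<lambda>u. jacobian (V, \<psi>) (V', \<theta>) p (jacobian (U, \<phi>) (V, \<psi>) p u))) (at (\<phi> p))" .
  then have "(transition (U, \<phi>) (V', \<theta>) has_derivative
      (\<lambda>u. jacobian (V, \<psi>) (V', \<theta>) p (jacobian (U, \<phi>) (V, \<psi>) p u))) (at (\<phi> p))"
    by (rule has_derivative_transform_within_open[OF _ o])
      (use assms transition_apply in auto)
  then have "(\<lambda>u. jacobian (V, \<psi>) (V', \<theta>) p (jacobian (U, \<phi>) (V, \<psi>) p u)) = jacobian (U, \<phi>) (V', \<theta>) p"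
    using frechet_derivative_at[of "transition (U, \<phi>) (V', \<theta>)"] by simp
  then show ?thesis by metis
qed

lemma jacobian_self:
  assumes "(U, \<phi>) \<in> \<A>" "p \<in> U"
  shows "jacobian (U, \<phi>) (U, \<phi>) p u = u"
proof -
  have "((\<lambda>x. x) has_derivative (\<lambda>x. x)) (at (\<phi> p))" by simp
  then have "(transition (U, \<phi>) (U, \<phi>) has_derivative (\<lambda>x. x)) (at (\<phi> p))"
    by (rule has_derivative_transform_within_open[OF _ chartD(2)[OF assms(1)]])
      (use assms transition_apply in auto)
  from frechet_derivative_at[OF this, symmetric] show ?thesis by simp
qed

lemma charts_atI: "(U, \<phi>) \<in> \<A> \<Longrightarrow> p \<in> U \<Longrightarrow> (U, \<phi>) \<in> charts_at \<A> p"
  by (simp add: charts_at_def)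

lemma tvec_of_tangent:
  assumes "(U, \<phi>) \<in> \<A>" "p \<in> U"
  shows "tvec_of \<A> (U, \<phi>) p u \<in> tangent_space \<A> p"
proof -
  have *: "jacobian (U, \<phi>) c'' p u = jacobian c' c'' p (jacobian (U, \<phi>) c' p u)"
    if "c' \<in> charts_at \<A> p" "c'' \<in> charts_at \<A> p" for c' c''
    using jacobian_compose[OF assms(1), of "fst c'" "snd c'" "fst c''" "snd c''" p u] that assms
    by (auto simp: charts_at_def)
  show ?thesis unfolding tangent_space_def mem_Collect_eq
  proof (intro conjI ballI allI impI)
    fix c' c'' assume "c' \<in> charts_at \<A> p" "c'' \<in> charts_at \<A> p"
    with *[OF this] show "tvec_of \<A> (U, \<phi>) p u c'' = jacobian c' c'' p (tvec_of \<A> (U, \<phi>) p u c')"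
      unfolding tvec_of_def by presburger
  qed (simp add: tvec_of_def)
qed

lemma tangent_eq_tvec_of:
  assumes "(U, \<phi>) \<in> \<A>" "p \<in> U" "V \<in> tangent_space \<A> p"
  shows "V = tvec_of \<A> (U, \<phi>) p (V (U, \<phi>))"
proof
  fix c
  have "\<And>c'. c' \<in> charts_at \<A> p \<Longrightarrow> V c' = jacobian (U, \<phi>) c' p (V (U, \<phi>))"
    "\<And>c'. c' \<notin> charts_at \<A> p \<Longrightarrow> V c' = 0"
    using assms(3) charts_atI[OF assms(1,2)] unfolding tangent_space_def by blast+
  then show "V c = tvec_of \<A> (U, \<phi>) p (V (U, \<phi>)) c"
    unfolding tvec_of_def by presburger
qed

lemma tvec_of_self: "(U, \<phi>) \<in> \<A> \<Longrightarrow> p \<in> U \<Longrightarrow> tvec_of \<A> (U, \<phi>) p u (U, \<phi>) = u"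
  using jacobian_self charts_atI by (auto simp: tvec_of_def)

lemma tvec_of_linear:
  assumes "(U, \<phi>) \<in> \<A>" "p \<in> U"
  shows "tvec_of \<A> (U, \<phi>) p (u + v) = tv_add (tvec_of \<A> (U, \<phi>) p u) (tvec_of \<A> (U, \<phi>) p v)"
    "tvec_of \<A> (U, \<phi>) p (a *\<^sub>R u) = tv_scale a (tvec_of \<A> (U, \<phi>) p u)"
proof -
  have l: "bounded_linear (jacobian (U, \<phi>) c p)" if "c \<in> charts_at \<A> p" for c
    using transition_derivative[OF assms(1), of "fst c" "snd c" p] that assms has_derivative_bounded_linear
    by (auto simp: charts_at_def)
  show "tvec_of \<A> (U, \<phi>) p (u + v) = tv_add (tvec_of \<A> (U, \<phi>) p u) (tvec_of \<A> (U, \<phi>) p v)"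
    using bounded_linear.linear[OF l, THEN linear_add] by (auto simp: tvec_of_def tv_add_def fun_eq_iff)
  show "tvec_of \<A> (U, \<phi>) p (a *\<^sub>R u) = tv_scale a (tvec_of \<A> (U, \<phi>) p u)"
    using bounded_linear.linear[OF l, THEN linear_cmul] by (auto simp: tvec_of_def tv_scale_def fun_eq_iff)
qed

definition metric_coord :: "('m, 'e) chart \<Rightarrow> 'e \<Rightarrow> 'e \<Rightarrow> 'e \<Rightarrow> real" where
  "metric_coord c x u v = (let p = inv_into (fst c) (snd c) x in h p (tvec_of \<A> c p u) (tvec_of \<A> c p v))"

definition wind_coord :: "('m, 'e) chart \<Rightarrow> 'e \<Rightarrow> 'e" where
  "wind_coord c x = W (inv_into (fst c) (snd c) x) c"

abbreviation cost_coord :: "('m, 'e) chart \<Rightarrow> 'e \<Rightarrow> 'e \<Rightarrow> real" where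
  "cost_coord c \<equiv> randers_chart.cost (metric_coord c) (wind_coord c)"

lemma wind_tangent: "p \<in> topspace X \<Longrightarrow> W p \<in> tangent_space \<A> p"
  using wind manifoldD(3) by (auto simp: smooth_vector_field_def)

lemma metric_bilinear:
  assumes "p \<in> topspace X" "u \<in> tangent_space \<A> p" "v \<in> tangent_space \<A> p" "w \<in> tangent_space \<A> p"
  shows "h p (tv_add (tv_scale a u) (tv_scale b v)) w = a * h p u w + b * h p v w"
    and "h p u v = h p v u" and "u \<noteq> tv_zero \<Longrightarrow> h p u u > 0"
  using metric assms unfolding riemannian_metric_def manifoldD(3) by blast+

lemma randers_chart:
  assumes c: "(U, \<phi>) \<in> \<A>"
  shows "randers_chart (\<phi> ` U) (metric_coord (U, \<phi>)) (wind_coord (U, \<phi>))"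
proof
  show "open (\<phi> ` U)" by (rule chartD(2)[OF c])
  have "\<forall>(U, \<phi>)\<in>\<A>. \<forall>u v. smooth_on (\<phi> ` U)
      (\<lambda>x. let p = inv_into U \<phi> x in h p (tvec_of \<A> (U, \<phi>) p u) (tvec_of \<A> (U, \<phi>) p v))"
    using metric unfolding riemannian_metric_def by blast
  from bspec[OF this c] show "smooth_on (\<phi> ` U) (\<lambda>x. metric_coord (U, \<phi>) x u v)" for u v
    by (simp add: metric_coord_def)
  show "smooth_on (\<phi> ` U) (wind_coord (U, \<phi>))"
    using wind c unfolding smooth_vector_field_def wind_coord_def[abs_def] by auto
  fix x u v assume x: "x \<in> \<phi> ` U"
  define p where "p = inv_into U \<phi> x"
  have p: "p \<in> U" "p \<in> topspace X" using x chartD(4)[OF c] chart_inv(3)[OF c x] by (auto simp: p_def)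
  note tan = tvec_of_tangent[OF c p(1)]
  note lin = tvec_of_linear[OF c p(1)]
  note m = metric_bilinear[OF p(2)]
  have M: "metric_coord (U, \<phi>) x u v = h p (tvec_of \<A> (U, \<phi>) p u) (tvec_of \<A> (U, \<phi>) p v)" for u v
    unfolding metric_coord_def Let_def p_def by simp
  show sym: "metric_coord (U, \<phi>) x u v = metric_coord (U, \<phi>) x v u" for u v
    unfolding M by (rule m(2)[OF tan tan tan])
  have comb: "metric_coord (U, \<phi>) x (a *\<^sub>R u + b *\<^sub>R u') v = a * metric_coord (U, \<phi>) x u v + b * metric_coord (U, \<phi>) x u' v"
    for a b u u' v unfolding M lin by (rule m(1)[OF tan tan tan])
  have lin1: "linear (\<lambda>u. metric_coord (U, \<phi>) x u v)" for v
    using comb[of 1 _ 1 _ v] comb[of _ _ 0 0 v] by (intro linearI) auto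
  moreover have "metric_coord (U, \<phi>) x u = (\<lambda>v. metric_coord (U, \<phi>) x v u)" for u using sym by auto
  ultimately show "bilinear (metric_coord (U, \<phi>) x)" unfolding bilinear_def by metis
  show "0 < metric_coord (U, \<phi>) x u u" if "u \<noteq> 0"
  proof -
    have "tvec_of \<A> (U, \<phi>) p u \<noteq> tv_zero"
      using tvec_of_self[OF c p(1), of u] that by (auto simp: tv_zero_def)
    then show ?thesis unfolding M by (rule m(3)[OF tan tan tan])
  qed
  show "metric_coord (U, \<phi>) x (wind_coord (U, \<phi>) x) (wind_coord (U, \<phi>) x) < 1"
    unfolding M using mild[OF p(2)] tangent_eq_tvec_of[OF c p(1) wind_tangent[OF p(2)]]
    by (simp add: wind_coord_def p_def)
qed

lemma F_coord:
  assumes c: "(U, \<phi>) \<in> \<A>" and p: "p \<in> U"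
  shows "F p (tvec_of \<A> (U, \<phi>) p u) = cost_coord (U, \<phi>) (\<phi> p) u"
proof -
  have t: "p \<in> topspace X" using p chartD(4)[OF c] by auto
  have M: "metric_coord (U, \<phi>) (\<phi> p) u v = h p (tvec_of \<A> (U, \<phi>) p u) (tvec_of \<A> (U, \<phi>) p v)" for u v
    using chart_inv(1)[OF c p] by (simp add: metric_coord_def)
  have w: "tvec_of \<A> (U, \<phi>) p (wind_coord (U, \<phi>) (\<phi> p)) = W p"
    using tangent_eq_tvec_of[OF c p wind_tangent[OF t]] chart_inv(1)[OF c p] by (simp add: wind_coord_def)
  show ?thesis
    unfolding F_eq randers_metric_def randers_chart.cost_def[OF randers_chart[OF c]] M w Let_def ..
qed

lemma F_tv_scale:
  assumes "p \<in> topspace X" "V \<in> tangent_space \<A> p" "a > 0"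
  shows "F p (tv_scale a V) = a * F p V"
proof -
  obtain U \<phi> where c: "(U, \<phi>) \<in> \<A>" and p: "p \<in> U" using chart_cover[OF assms(1)] by blast
  interpret randers_chart "\<phi> ` U" "metric_coord (U, \<phi>)" "wind_coord (U, \<phi>)" by (rule randers_chart[OF c])
  show ?thesis
    using tangent_eq_tvec_of[OF c p assms(2)] F_coord[OF c p] tvec_of_linear(2)[OF c p]
      cost_homogeneous[of "\<phi> p" a] assms(3) p by (metis image_eqI)
qed

section \<open>Velocities of smooth curves\<close>

lemma at_within_relopen:
  fixes t :: real
  assumes "openin (top_of_set I) J" "t \<in> J"
  shows "at t within J = at t within I"
proof -
  obtain T where "open T" "J = I \<inter> T" using assms(1) by (auto simp: openin_open)
  then show ?thesis using assms(2) by (intro at_within_nhd[of t T]) auto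
qed

lemma thick_at_nontrivial:
  assumes "thick I" "t \<in> I"
  shows "at (t::real) within I \<noteq> bot"
proof -
  have "t islimpt I" unfolding islimpt_approachable
  proof (intro allI impI)
    fix e :: real assume "e > 0"
    then obtain d where "0 < \<bar>d\<bar>" "\<bar>d\<bar> < e" "t + d *\<^sub>R 1 \<in> I"
      using assms unfolding thick_def by force
    then show "\<exists>x'\<in>I. x' \<noteq> t \<and> dist x' t < e"
      by (intro bexI[of _ "t + d"]) (auto simp: dist_norm)
  qed
  then show ?thesis by (simp add: trivial_limit_within)
qed

lemma smooth_curve_chart_domain:
  assumes "smooth_curve X \<A> I \<gamma>" "(U, \<phi>) \<in> \<A>"
  shows "openin (top_of_set I) {t\<in>I. \<gamma> t \<in> U}" "smooth_on {t\<in>I. \<gamma> t \<in> U} (\<phi> \<circ> \<gamma>)"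
proof -
  have "continuous_map (top_of_set I) X \<gamma>" using assms(1) by (simp add: smooth_curve_def)
  from openin_continuous_map_preimage[OF this chartD(1)[OF assms(2)]]
  show "openin (top_of_set I) {t\<in>I. \<gamma> t \<in> U}" by simp
  show "smooth_on {t\<in>I. \<gamma> t \<in> U} (\<phi> \<circ> \<gamma>)" using assms by (auto simp: smooth_curve_def)
qed

lemma smooth_curve_in_topspace: "smooth_curve X \<A> I \<gamma> \<Longrightarrow> t \<in> I \<Longrightarrow> \<gamma> t \<in> topspace X"
  unfolding smooth_curve_def using continuous_map_image_subset_topspace by fastforce

lemma smooth_curve_derivative:
  assumes "smooth_curve X \<A> I \<gamma>" "(U, \<phi>) \<in> \<A>" "t \<in> I" "\<gamma> t \<in> U"
  shows "((\<phi> \<circ> \<gamma>) has_vector_derivative vector_derivative (\<phi> \<circ> \<gamma>) (at t within I)) (at t within I)"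
proof -
  define J where "J = {t\<in>I. \<gamma> t \<in> U}"
  have "(\<phi> \<circ> \<gamma>) differentiable (at t within J)"
    using smooth_on_differentiable[OF smooth_curve_chart_domain(2)[OF assms(1,2)]] assms(3,4)
    by (auto simp: differentiable_on_def J_def)
  then have "(\<phi> \<circ> \<gamma>) differentiable (at t within I)"
    using at_within_relopen[OF smooth_curve_chart_domain(1)[OF assms(1,2)]] assms(3,4) by (auto simp: J_def)
  then show ?thesis by (simp add: vector_derivative_works)
qed

text \<open>
  The coordinates of the velocity in two charts are related by the Jacobian of the transition map,
  so they are determined by those in a single chart.  Hence the travel time of a curve inside a chart
  is an integral in Euclidean space.
\<close>

lemma velocity_coord:
  assumes g: "smooth_curve X \<A> I \<gamma>" and I: "thick I" and c: "(U, \<phi>) \<in> \<A>" and t: "t \<in> I" "\<gamma> t \<in> U"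
  shows "velocity \<A> I \<gamma> t = tvec_of \<A> (U, \<phi>) (\<gamma> t) (vector_derivative (\<phi> \<circ> \<gamma>) (at t within I))"
proof
  fix c' :: "('m, 'e) chart"
  obtain V \<psi> where c': "c' = (V, \<psi>)" by (cases c')
  show "velocity \<A> I \<gamma> t c' = tvec_of \<A> (U, \<phi>) (\<gamma> t) (vector_derivative (\<phi> \<circ> \<gamma>) (at t within I)) c'"
  proof (cases "(V, \<psi>) \<in> charts_at \<A> (\<gamma> t)")
    case True
    then have V: "(V, \<psi>) \<in> \<A>" "\<gamma> t \<in> V" by (auto simp: charts_at_def)
    define J where "J = {s\<in>I. \<gamma> s \<in> U}"
    have J: "at t within J = at t within I" "t \<in> J"
      using at_within_relopen[OF smooth_curve_chart_domain(1)[OF g c]] t by (auto simp: J_def)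
    define v where "v = vector_derivative (\<phi> \<circ> \<gamma>) (at t within I)"
    have "((\<phi> \<circ> \<gamma>) has_vector_derivative v) (at t within J)"
      unfolding J v_def by (rule smooth_curve_derivative[OF g c t])
    then have d: "((\<phi> \<circ> \<gamma>) has_derivative (\<lambda>x. x *\<^sub>R v)) (at t within J)"
      by (simp add: has_vector_derivative_def)
    have "(transition (U, \<phi>) (V, \<psi>) has_derivative jacobian (U, \<phi>) (V, \<psi>) (\<gamma> t)) (at ((\<phi> \<circ> \<gamma>) t))"
      using transition_derivative[OF c V(1) t(2) V(2)] by simp
    from has_derivative_compose[OF d this]
    have "((\<lambda>s. transition (U, \<phi>) (V, \<psi>) ((\<phi> \<circ> \<gamma>) s)) has_derivative
        (\<lambda>x. jacobian (U, \<phi>) (V, \<psi>) (\<gamma> t) (x *\<^sub>R v))) (at t within J)" .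
    then have "((\<psi> \<circ> \<gamma>) has_derivative (\<lambda>x. jacobian (U, \<phi>) (V, \<psi>) (\<gamma> t) (x *\<^sub>R v))) (at t within J)"
      by (rule has_derivative_transform[OF J(2), rotated]) (use transition_apply[OF c] in \<open>auto simp: J_def\<close>)
    moreover have "linear (jacobian (U, \<phi>) (V, \<psi>) (\<gamma> t))"
      using transition_derivative[OF c V(1) t(2) V(2)] has_derivative_linear by blast
    ultimately have "((\<psi> \<circ> \<gamma>) has_vector_derivative jacobian (U, \<phi>) (V, \<psi>) (\<gamma> t) v) (at t within I)"
      by (simp add: has_vector_derivative_def linear_cmul J(1))
    then have "vector_derivative (\<psi> \<circ> \<gamma>) (at t within I) = jacobian (U, \<phi>) (V, \<psi>) (\<gamma> t) v"
      by (rule vector_derivative_within[OF thick_at_nontrivial[OF I t(1)]])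
    then show ?thesis using True by (simp add: velocity_def tvec_of_def c' v_def)
  next
    case False
    then show ?thesis by (simp add: velocity_def tvec_of_def c')
  qed
qed

lemma velocity_tangent:
  assumes "smooth_curve X \<A> I \<gamma>" "thick I" "t \<in> I"
  shows "velocity \<A> I \<gamma> t \<in> tangent_space \<A> (\<gamma> t)"
  using chart_cover[OF smooth_curve_in_topspace[OF assms(1,3)]] velocity_coord[OF assms(1,2) _ assms(3)] tvec_of_tangent
  by metis

lemma velocity_subset:
  assumes "smooth_curve X \<A> I \<gamma>" "thick J" "J \<subseteq> I" "t \<in> J"
  shows "velocity \<A> J \<gamma> t = velocity \<A> I \<gamma> t"
proof
  fix c' :: "('m, 'e) chart"
  obtain V \<psi> where c': "c' = (V, \<psi>)" by (cases c')
  show "velocity \<A> J \<gamma> t c' = velocity \<A> I \<gamma> t c'"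
  proof (cases "(V, \<psi>) \<in> charts_at \<A> (\<gamma> t)")
    case True
    then have "((\<psi> \<circ> \<gamma>) has_vector_derivative vector_derivative (\<psi> \<circ> \<gamma>) (at t within I)) (at t within J)"
      using smooth_curve_derivative[OF assms(1), of V \<psi> t] assms(3,4)
      by (auto simp: charts_at_def intro: has_vector_derivative_within_subset)
    then have "vector_derivative (\<psi> \<circ> \<gamma>) (at t within J) = vector_derivative (\<psi> \<circ> \<gamma>) (at t within I)"
      by (rule vector_derivative_within[OF thick_at_nontrivial[OF assms(2,4)]])
    then show ?thesis by (simp add: velocity_def c')
  qed (simp add: velocity_def c')
qed

lemma velocity_cong:
  assumes "\<And>s. s \<in> I \<Longrightarrow> \<gamma> s = \<gamma>' s" "t \<in> I"
  shows "velocity \<A> I \<gamma> t = velocity \<A> I \<gamma>' t"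
proof -
  have "((f \<circ> \<gamma>) has_vector_derivative v) (at t within I) \<longleftrightarrow> ((f \<circ> \<gamma>') has_vector_derivative v) (at t within I)"
    for f :: "'m \<Rightarrow> 'e" and v
    using has_vector_derivative_transform[OF assms(2), of "f \<circ> \<gamma>" "f \<circ> \<gamma>'"]
      has_vector_derivative_transform[OF assms(2), of "f \<circ> \<gamma>'" "f \<circ> \<gamma>"] assms(1) by fastforce
  then have "vector_derivative (snd c \<circ> \<gamma>) (at t within I) = vector_derivative (snd c \<circ> \<gamma>') (at t within I)"
    for c :: "('m, 'e) chart" unfolding vector_derivative_def by presburger
  then show ?thesis
    using assms unfolding velocity_def by presburger
qed

lemma velocity_interior: "t \<in> {a<..<b} \<Longrightarrow> velocity \<A> {a..b} \<gamma> t = velocity \<A> UNIV \<gamma> t"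
  using at_within_Icc_at[of a t b] unfolding velocity_def by simp metis

lemma smooth_curve_subset:
  assumes "smooth_curve X \<A> I \<gamma>" "J \<subseteq> I" "a < b" "J = {a..b}"
  shows "smooth_curve X \<A> J \<gamma>"
  unfolding smooth_curve_def
proof (intro conjI ballI)
  show c: "continuous_map (top_of_set J) X \<gamma>"
    using assms(1,2) continuous_map_from_subtopology_mono[of euclidean I X \<gamma> J] by (simp add: smooth_curve_def)
  fix c assume "c \<in> \<A>"
  then obtain U \<phi> where U: "c = (U, \<phi>)" "(U, \<phi>) \<in> \<A>" by (cases c) auto
  have "openin (top_of_set J) {t\<in>J. \<gamma> t \<in> U}"
    using openin_continuous_map_preimage[OF c chartD(1)[OF U(2)]] by simp
  then have t: "thick {t\<in>J. \<gamma> t \<in> U}" using assms(3,4) thick_interval by blast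
  show "case c of (U, \<phi>) \<Rightarrow> smooth_on {t \<in> J. \<gamma> t \<in> U} (\<phi> \<circ> \<gamma>)"
    unfolding U(1) prod.case
    by (rule smooth_on_subset[OF smooth_curve_chart_domain(2)[OF assms(1) U(2)] _ t]) (use assms(2) in auto)
qed

lemma smooth_curve_cong:
  assumes "smooth_curve X \<A> I \<gamma>" "\<And>s. s \<in> I \<Longrightarrow> \<gamma> s = \<gamma>' s"
  shows "smooth_curve X \<A> I \<gamma>'"
  unfolding smooth_curve_def
proof (intro conjI ballI)
  show "continuous_map (top_of_set I) X \<gamma>'"
    using assms continuous_map_eq[of "top_of_set I" X \<gamma> \<gamma>'] by (auto simp: smooth_curve_def)
  fix c assume "c \<in> \<A>"
  then obtain U \<phi> where U: "c = (U, \<phi>)" "(U, \<phi>) \<in> \<A>" by (cases c) auto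
  have "{t\<in>I. \<gamma> t \<in> U} = {t\<in>I. \<gamma>' t \<in> U}" using assms(2) by auto
  then show "case c of (U, \<phi>) \<Rightarrow> smooth_on {t \<in> I. \<gamma>' t \<in> U} (\<phi> \<circ> \<gamma>')"
    unfolding U(1) prod.case
    using smooth_curve_chart_domain(2)[OF assms(1) U(2)] assms(2)
    by (subst smooth_on_cong[of _ _ "\<phi> \<circ> \<gamma>"]) auto
qed

lemma chart_piece:
  assumes g: "smooth_curve X \<A> {a..b} \<gamma>" and ab: "a < b" and c: "(U, \<phi>) \<in> \<A>"
    and sub: "\<And>t. t \<in> {a..b} \<Longrightarrow> \<gamma> t \<in> U"
  obtains y' where "smooth_on {a..b} (\<phi> \<circ> \<gamma>)"
    "\<And>t. t \<in> {a..b} \<Longrightarrow> ((\<phi> \<circ> \<gamma>) has_vector_derivative y' t) (at t within {a..b})"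
    "continuous_on {a..b} y'"
    "\<And>t. t \<in> {a..b} \<Longrightarrow> velocity \<A> {a..b} \<gamma> t = tvec_of \<A> (U, \<phi>) (\<gamma> t) (y' t)"
    "\<And>t. t \<in> {a..b} \<Longrightarrow> F (\<gamma> t) (velocity \<A> {a..b} \<gamma> t) = cost_coord (U, \<phi>) (\<phi> (\<gamma> t)) (y' t)"
proof -
  have "{t\<in>{a..b}. \<gamma> t \<in> U} = {a..b}" using sub by auto
  then have s: "smooth_on {a..b} (\<phi> \<circ> \<gamma>)" using smooth_curve_chart_domain(2)[OF g c] by simp
  obtain y' where y': "\<And>t. t \<in> {a..b} \<Longrightarrow> ((\<phi> \<circ> \<gamma>) has_vector_derivative y' t) (at t within {a..b})"
    "continuous_on {a..b} y'"
    using smooth_on_vector_derivative[OF s] by blast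
  have "vector_derivative (\<phi> \<circ> \<gamma>) (at t within {a..b}) = y' t" if "t \<in> {a..b}" for t
    using y'(1)[OF that] vector_derivative_within[OF thick_at_nontrivial[OF thick_Icc[OF ab] that]] by blast
  then have v: "velocity \<A> {a..b} \<gamma> t = tvec_of \<A> (U, \<phi>) (\<gamma> t) (y' t)" if "t \<in> {a..b}" for t
    using velocity_coord[OF g thick_Icc[OF ab] c that sub[OF that]] that by simp
  show thesis
    by (rule that[OF s y' v]) (use v F_coord[OF c sub] in auto)
qed

text \<open>
  This is the source of competitors: a smooth curve of coordinate vectors is smooth in all the other
  charts, too, being composed with transition maps there.
\<close>

lemma chart_curve:
  assumes c: "(U, \<phi>) \<in> \<A>" and y: "smooth_on {a..b} y" "\<And>t. t \<in> {a..b} \<Longrightarrow> y t \<in> \<phi> ` U" and ab: "a < b"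
  shows "smooth_curve X \<A> {a..b} (\<lambda>t. inv_into U \<phi> (y t))"
  unfolding smooth_curve_def
proof (intro conjI ballI)
  have "continuous_map (top_of_set {a..b}) (top_of_set (\<phi> ` U)) y"
    using smooth_on_continuous[OF y(1)] y(2) by (auto simp: continuous_map_in_subtopology)
  from continuous_map_compose[OF this chart_inv_continuous[OF c]]
  show cont: "continuous_map (top_of_set {a..b}) X (\<lambda>t. inv_into U \<phi> (y t))" by (simp add: o_def)
  fix c' assume "c' \<in> \<A>"
  then obtain V \<psi> where V: "c' = (V, \<psi>)" "(V, \<psi>) \<in> \<A>" by (cases c') auto
  define J where "J = {t\<in>{a..b}. inv_into U \<phi> (y t) \<in> V}"
  have "openin (top_of_set {a..b}) J"
    using openin_continuous_map_preimage[OF cont chartD(1)[OF V(2)]] by (simp add: J_def)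
  then have J: "thick J" by (rule thick_interval[OF ab])
  have "smooth_on J (\<lambda>t. transition (U, \<phi>) (V, \<psi>) (y t))"
  proof (rule smooth_on_compose[OF J transition_smooth[OF c V(2)]])
    show "smooth_on J y" by (rule smooth_on_subset[OF y(1) _ J]) (auto simp: J_def)
    show "y ` J \<subseteq> \<phi> ` (U \<inter> V)"
    proof
      fix x assume "x \<in> y ` J"
      then obtain t where t: "t \<in> {a..b}" "inv_into U \<phi> (y t) \<in> V" "x = y t" by (auto simp: J_def)
      then show "x \<in> \<phi> ` (U \<inter> V)"
        using chart_inv(2,3)[OF c y(2)[OF t(1)]] by (intro image_eqI[of _ _ "inv_into U \<phi> (y t)"]) auto
    qed
  qed
  moreover have "(\<lambda>t. transition (U, \<phi>) (V, \<psi>) (y t)) = \<psi> \<circ> (\<lambda>t. inv_into U \<phi> (y t))"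
    by (auto simp: transition_def)
  ultimately show "case c' of (U', \<psi>) \<Rightarrow> smooth_on {t \<in> {a..b}. inv_into U \<phi> (y t) \<in> U'} (\<psi> \<circ> (\<lambda>t. inv_into U \<phi> (y t)))"
    unfolding V(1) prod.case J_def by simp
qed

end

section \<open>Piecewise smooth curves and their travel times\<close>

lemma piecewise_single: "a < b \<Longrightarrow> P {a..b} \<Longrightarrow> piecewise P a b"
  unfolding piecewise_def
  by (intro exI[of _ "1::nat"] exI[of _ "\<lambda>i::nat. if i = 0 then a else b"]) auto

lemma piecewise_append:
  assumes "piecewise P a b" "piecewise P b c"
  shows "piecewise P a c"
proof -
  obtain n s where s: "s 0 = a" "s n = b" "\<And>i. i < n \<Longrightarrow> s i < s (Suc i) \<and> P {s i..s (Suc i)}"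
    using assms(1) unfolding piecewise_def by blast
  obtain m u where u: "u 0 = b" "u m = c" "\<And>i. i < m \<Longrightarrow> u i < u (Suc i) \<and> P {u i..u (Suc i)}"
    using assms(2) unfolding piecewise_def by blast
  define v where "v i = (if i \<le> n then s i else u (i - n))" for i
  have "v i < v (Suc i) \<and> P {v i..v (Suc i)}" if i: "i < n + m" for i
  proof (cases "i < n")
    case True
    then show ?thesis using s(3)[of i] by (simp add: v_def)
  next
    case False
    then have "v i = u (i - n)" "v (Suc i) = u (Suc (i - n))"
      using s(2) u(1) by (auto simp: v_def Suc_diff_le)
    then show ?thesis using u(3)[of "i - n"] False i by simp
  qed
  moreover have "v 0 = a" "v (n + m) = c" using s u by (auto simp: v_def)
  ultimately show ?thesis unfolding piecewise_def by blast
qed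

lemma piecewise_induct [consumes 1, case_names refl step]:
  assumes "piecewise P a b" "R a"
    and "\<And>u v. R u \<Longrightarrow> a \<le> u \<Longrightarrow> u < v \<Longrightarrow> v \<le> b \<Longrightarrow> P {u..v} \<Longrightarrow> R v"
  shows "R b \<and> a \<le> b"
proof -
  obtain n s where s: "s 0 = a" "s n = b" "\<And>i. i < n \<Longrightarrow> s i < s (Suc i) \<and> P {s i..s (Suc i)}"
    using assms(1) unfolding piecewise_def by blast
  have le_b: "s i \<le> b" if "i \<le> n" for i
    using that by (induction rule: inc_induct) (use s in \<open>auto intro: less_imp_le order.trans\<close>)
  have "k \<le> n \<Longrightarrow> R (s k) \<and> a \<le> s k" for k
  proof (induction k)
    case 0
    then show ?case using s assms(2) by simp
  next
    case (Suc k)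
    then show ?case using s(3)[of k] le_b[of "Suc k"] assms(3)[of "s k" "s (Suc k)"] by auto
  qed
  then show ?thesis using s(2) by auto
qed

lemma piecewise_cong:
  assumes "piecewise P a b" "\<And>u v. a \<le> u \<Longrightarrow> u < v \<Longrightarrow> v \<le> b \<Longrightarrow> P {u..v} \<Longrightarrow> Q {u..v}"
  shows "piecewise Q a b"
proof -
  have "piecewise Q a a" unfolding piecewise_def by (intro exI[of _ "0::nat"] exI[of _ "\<lambda>_. a"]) simp
  from piecewise_induct[of P a b "piecewise Q a", OF assms(1) this] show ?thesis
    using assms(2) piecewise_append piecewise_single by blast
qed

context zermelo_manifold
begin

text \<open>
  In the interior of an interval, one-sided derivatives within the interval are two-sided, so the
  speed may be measured without reference to the interval.
\<close>

definition speed :: "(real \<Rightarrow> 'm) \<Rightarrow> real \<Rightarrow> real" where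
  "speed \<gamma> t = F (\<gamma> t) (velocity \<A> UNIV \<gamma> t)"

text \<open>
  The travel time as a relation with integrability built in; an undefined integral would be \<open>0\<close> and
  destroy additivity.
\<close>

definition travel :: "(real \<Rightarrow> 'm) \<Rightarrow> real \<Rightarrow> real \<Rightarrow> real \<Rightarrow> bool" where
  "travel \<gamma> a b T \<longleftrightarrow> piecewise (\<lambda>I. smooth_curve X \<A> I \<gamma>) a b \<and> (speed \<gamma> has_integral T) {a..b}"

lemma has_integral_speed_iff:
  "(speed \<gamma> has_integral T) {a..b} \<longleftrightarrow> ((\<lambda>t. F (\<gamma> t) (velocity \<A> {a..b} \<gamma> t)) has_integral T) {a..b}"
  by (rule has_integral_spike_finite_eq[of "{a, b}"])
    (use velocity_interior[of _ a b \<gamma>] in \<open>auto simp: speed_def\<close>)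

lemma travel_time_eq: "travel \<gamma> a b T \<Longrightarrow> travel_time \<A> F a b \<gamma> = T"
  unfolding travel_def travel_time_def has_integral_speed_iff by (simp add: integral_unique)

lemma continuous_on_speed:
  assumes g: "smooth_curve X \<A> {a..b} \<gamma>" and ab: "a < b"
  shows "continuous_on {a..b} (\<lambda>t. F (\<gamma> t) (velocity \<A> {a..b} \<gamma> t))" (is "continuous_on ?I ?f")
  unfolding continuous_on_eq_continuous_within
proof
  fix t assume t: "t \<in> {a..b}"
  obtain U \<phi> where c: "(U, \<phi>) \<in> \<A>" "\<gamma> t \<in> U" using chart_cover[OF smooth_curve_in_topspace[OF g t]] by blast
  interpret randers_chart "\<phi> ` U" "metric_coord (U, \<phi>)" "wind_coord (U, \<phi>)" by (rule randers_chart[OF c(1)])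
  define J where "J = {s\<in>{a..b}. \<gamma> s \<in> U}"
  have J: "openin (top_of_set {a..b}) J" "smooth_on J (\<phi> \<circ> \<gamma>)" "t \<in> J"
    using smooth_curve_chart_domain[OF g c(1)] t c(2) by (auto simp: J_def)
  obtain y' where y': "\<And>s. s \<in> J \<Longrightarrow> ((\<phi> \<circ> \<gamma>) has_vector_derivative y' s) (at s within J)" "continuous_on J y'"
    using smooth_on_vector_derivative[OF J(2)] by blast
  have "continuous_on J (\<lambda>s. cost_coord (U, \<phi>) ((\<phi> \<circ> \<gamma>) s) (y' s))"
    by (rule continuous_on_cost[OF smooth_on_continuous[OF J(2)] y'(2)]) (auto simp: J_def)
  moreover have "cost_coord (U, \<phi>) ((\<phi> \<circ> \<gamma>) s) (y' s) = ?f s" if s: "s \<in> J" for s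
  proof -
    have s': "s \<in> {a..b}" "\<gamma> s \<in> U" using s by (auto simp: J_def)
    have "vector_derivative (\<phi> \<circ> \<gamma>) (at s within {a..b}) = y' s"
      using y'(1)[OF s] vector_derivative_within[OF thick_at_nontrivial[OF thick_Icc[OF ab] s'(1)]]
      unfolding at_within_relopen[OF J(1) s] by blast
    then show ?thesis
      using velocity_coord[OF g thick_Icc[OF ab] c(1) s'] F_coord[OF c(1) s'(2)] by simp
  qed
  ultimately have "continuous_on J ?f" by (rule continuous_on_eq)
  then have "continuous (at t within J) ?f" using J(3) by (simp add: continuous_on_eq_continuous_within)
  then show "continuous (at t within ?I) ?f" unfolding at_within_relopen[OF J(1,3)] .
qed

lemma travel_smooth:
  assumes "smooth_curve X \<A> {a..b} \<gamma>" "a < b"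
  shows "travel \<gamma> a b (integral {a..b} (\<lambda>t. F (\<gamma> t) (velocity \<A> {a..b} \<gamma> t)))"
  unfolding travel_def has_integral_speed_iff
  using integrable_integral[OF integrable_continuous_interval[OF continuous_on_speed[OF assms]]]
    piecewise_single[OF assms(2), of "\<lambda>I. smooth_curve X \<A> I \<gamma>"] assms(1) by blast

lemma travel_append:
  assumes "travel \<gamma> a b S" "travel \<gamma> b c T"
  shows "travel \<gamma> a c (S + T)"
proof -
  have "a \<le> b" using assms(1) piecewise_induct[where R = "\<lambda>_. True"] unfolding travel_def by blast
  moreover have "b \<le> c" using assms(2) piecewise_induct[where R = "\<lambda>_. True"] unfolding travel_def by blast
  ultimately show ?thesis
    using assms piecewise_append has_integral_combine unfolding travel_def by blast
qed

lemma travel_exists: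
  assumes "piecewise (\<lambda>I. smooth_curve X \<A> I \<gamma>) a b"
  obtains T where "travel \<gamma> a b T"
proof -
  have "travel \<gamma> a a 0" unfolding travel_def piecewise_def
    by (auto intro!: exI[of _ "0::nat"] exI[of _ "\<lambda>_. a"])
  then have "\<exists>T. travel \<gamma> a a T" ..
  from piecewise_induct[of _ a b "\<lambda>u. \<exists>T. travel \<gamma> a u T", OF assms this] show ?thesis
    using that travel_append travel_smooth by meson
qed

lemma travel_cong:
  assumes "travel \<gamma> a b T" "\<And>t. t \<in> {a..b} \<Longrightarrow> \<gamma> t = \<gamma>' t"
  shows "travel \<gamma>' a b T"
  unfolding travel_def
proof
  show "piecewise (\<lambda>I. smooth_curve X \<A> I \<gamma>') a b"
  proof (rule piecewise_cong)
    show "piecewise (\<lambda>I. smooth_curve X \<A> I \<gamma>) a b" using assms(1) by (simp add: travel_def)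
    show "smooth_curve X \<A> {u..v} \<gamma>'" if "a \<le> u" "v \<le> b" "smooth_curve X \<A> {u..v} \<gamma>" for u v
      using smooth_curve_cong[OF that(3), of \<gamma>'] assms(2) that(1,2) by simp
  qed
  have "((\<lambda>t. F (\<gamma> t) (velocity \<A> {a..b} \<gamma> t)) has_integral T) {a..b}"
    using assms(1) unfolding travel_def has_integral_speed_iff by blast
  then show "(speed \<gamma>' has_integral T) {a..b}"
    unfolding has_integral_speed_iff
    by (rule has_integral_eq[rotated]) (use velocity_cong[of "{a..b}" \<gamma> \<gamma>'] assms(2) in auto)
qed

lemma smooth_curve_affine:
  assumes g: "smooth_curve X \<A> {u..v} \<gamma>" and m: "m > 0" and uv: "u < v"
  shows "smooth_curve X \<A> {(u - q) / m..(v - q) / m} (\<lambda>t. \<gamma> (m * t + q))" (is "smooth_curve X \<A> ?I ?g")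
  unfolding smooth_curve_def
proof (intro conjI ballI)
  have im: "m * t + q \<in> {u..v}" if "t \<in> ?I" for t using that m by (auto simp: field_simps)
  have "continuous_map (top_of_set ?I) (top_of_set {u..v}) (\<lambda>t. m * t + q)"
    unfolding continuous_map_subtopology_eu using im by (auto intro!: continuous_intros)
  from continuous_map_compose[OF this, of X \<gamma>] g
  show cont: "continuous_map (top_of_set ?I) X ?g" by (simp add: smooth_curve_def o_def)
  fix c assume "c \<in> \<A>"
  then obtain U \<phi> where U: "c = (U, \<phi>)" "(U, \<phi>) \<in> \<A>" by (cases c) auto
  define J where "J = {t\<in>?I. ?g t \<in> U}"
  have "openin (top_of_set ?I) J"
    using openin_continuous_map_preimage[OF cont chartD(1)[OF U(2)]] by (simp add: J_def)
  moreover have "(u - q) / m < (v - q) / m" using m uv by (simp add: divide_strict_right_mono)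
  ultimately have J: "thick J" using thick_interval by blast
  have "smooth_on J (\<lambda>t. m * t + q)"
    by (intro smooth_on_add smooth_on_bounded_linear smooth_on_const J bounded_linear_mult_right)
  then have "smooth_on J (\<lambda>t. (\<phi> \<circ> \<gamma>) (m * t + q))"
    by (rule smooth_on_compose[OF J smooth_curve_chart_domain(2)[OF g U(2)]]) (use im in \<open>auto simp: J_def\<close>)
  then show "case c of (U, \<phi>) \<Rightarrow> smooth_on {t \<in> ?I. ?g t \<in> U} (\<phi> \<circ> ?g)"
    unfolding U(1) prod.case J_def by (simp add: o_def)
qed

text \<open>
  Invariance under affine reparametrisation is proved piece by piece, since the substitution rule for
  velocities needs differentiability: a factor \<open>m\<close> in the velocity leaves \<open>F\<close> by homogeneity and is
  compensated by the change of variables.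
\<close>

lemma travel_affine:
  assumes "travel \<gamma> a b T" and m: "m > 0"
  shows "travel (\<lambda>t. \<gamma> (m * t + q)) ((a - q) / m) ((b - q) / m) T"
proof -
  define G where "G = (\<lambda>t. \<gamma> (m * t + q))"
  define f where "f t = (t - q) / m" for t
  have f: "f u < f v" if "u < v" for u v using that m by (simp add: f_def divide_strict_right_mono)
  have "travel g u u 0" for g u unfolding travel_def piecewise_def
    by (auto intro!: exI[of _ "0::nat"] exI[of _ "\<lambda>_. u"])
  then have base: "\<exists>T. travel G (f a) (f a) T \<and> travel \<gamma> a a T" by blast
  have "(\<exists>T. travel G (f a) (f b) T \<and> travel \<gamma> a b T) \<and> a \<le> b"
  proof (rule piecewise_induct[where R = "\<lambda>u. \<exists>T. travel G (f a) (f u) T \<and> travel \<gamma> a u T"])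
    show "piecewise (\<lambda>I. smooth_curve X \<A> I \<gamma>) a b" using assms(1) by (simp add: travel_def)
    fix u v assume IH: "\<exists>T. travel G (f a) (f u) T \<and> travel \<gamma> a u T" and uv: "u < v"
      and g: "smooth_curve X \<A> {u..v} \<gamma>"
    have G: "smooth_curve X \<A> {f u..f v} G"
      unfolding f_def G_def by (rule smooth_curve_affine[OF g m uv])
    define S where "S = integral {u..v} (\<lambda>t. F (\<gamma> t) (velocity \<A> {u..v} \<gamma> t))"
    have tg: "travel \<gamma> u v S" unfolding S_def by (rule travel_smooth[OF g uv])
    have "((\<lambda>t. F (\<gamma> t) (velocity \<A> {u..v} \<gamma> t)) has_integral S) (cbox u v)"
      using tg unfolding travel_def has_integral_speed_iff by simp
    from has_integral_mult_right[OF has_integral_affinity[OF this, of m q], of m]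
    have "((\<lambda>t. m * F (\<gamma> (m * t + q)) (velocity \<A> {u..v} \<gamma> (m * t + q))) has_integral S)
       ((\<lambda>x. (1 / m) *\<^sub>R x + - ((1 / m) *\<^sub>R q)) ` cbox u v)"
      using m by simp
    moreover have "(\<lambda>x. (1 / m) *\<^sub>R x + - ((1 / m) *\<^sub>R q)) ` cbox u v = {f u..f v}"
    proof -
      have "(\<lambda>x. (1 / m) * x + - (q / m)) ` {u..v} = {1 / m * u + - (q / m)..1 / m * v + - (q / m)}"
        using m uv image_affinity_atLeastAtMost[of "1 / m" "- (q / m)" u v] by simp
      then show ?thesis by (simp add: f_def diff_divide_distrib)
    qed
    ultimately have int: "((\<lambda>t. m * F (\<gamma> (m * t + q)) (velocity \<A> {u..v} \<gamma> (m * t + q))) has_integral S) {f u..f v}"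
      by simp
    have eq: "m * F (\<gamma> (m * t + q)) (velocity \<A> {u..v} \<gamma> (m * t + q)) = F (G t) (velocity \<A> {f u..f v} G t)"
      if t: "t \<in> {f u..f v}" for t
    proof -
      define s where "s = m * t + q"
      have s: "s \<in> {u..v}" using t m by (auto simp: s_def f_def field_simps)
      have p: "\<gamma> s \<in> topspace X" by (rule smooth_curve_in_topspace[OF g s])
      obtain U \<phi> where c: "(U, \<phi>) \<in> \<A>" "\<gamma> s \<in> U" using chart_cover[OF p] by blast
      have Gt: "G t = \<gamma> s" by (simp add: G_def s_def)
      have "((\<phi> \<circ> \<gamma>) has_vector_derivative vector_derivative (\<phi> \<circ> \<gamma>) (at s within {u..v})) (at s within {u..v})"
        by (rule smooth_curve_derivative[OF g c(1) s c(2)])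
      then have "((\<phi> \<circ> \<gamma>) has_vector_derivative vector_derivative (\<phi> \<circ> \<gamma>) (at s within {u..v}))
          (at (m * t + q) within (\<lambda>t. m * t + q) ` {f u..f v})"
        unfolding s_def[symmetric]
        by (rule has_vector_derivative_within_subset) (use m in \<open>auto simp: f_def field_simps\<close>)
      moreover have "((\<lambda>t. m * t + q) has_vector_derivative m) (at t within {f u..f v})"
        by (auto intro!: derivative_eq_intros simp: has_real_derivative_iff_has_vector_derivative[symmetric])
      ultimately have "((\<phi> \<circ> \<gamma>) \<circ> (\<lambda>t. m * t + q) has_vector_derivative
          m *\<^sub>R vector_derivative (\<phi> \<circ> \<gamma>) (at s within {u..v})) (at t within {f u..f v})"
        by (rule vector_diff_chain_within[rotated])
      then have "(\<phi> \<circ> G has_vector_derivative m *\<^sub>R vector_derivative (\<phi> \<circ> \<gamma>) (at s within {u..v})) (at t within {f u..f v})"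
        by (simp add: o_def G_def)
      then have "vector_derivative (\<phi> \<circ> G) (at t within {f u..f v}) = m *\<^sub>R vector_derivative (\<phi> \<circ> \<gamma>) (at s within {u..v})"
        by (rule vector_derivative_within[OF thick_at_nontrivial[OF thick_Icc[OF f[OF uv]] t]])
      then have "velocity \<A> {f u..f v} G t = tvec_of \<A> (U, \<phi>) (\<gamma> s) (m *\<^sub>R vector_derivative (\<phi> \<circ> \<gamma>) (at s within {u..v}))"
        using velocity_coord[OF G thick_Icc[OF f[OF uv]] c(1) t] c(2) Gt by simp
      also have "\<dots> = tv_scale m (velocity \<A> {u..v} \<gamma> s)"
        using velocity_coord[OF g thick_Icc[OF uv] c(1) s c(2)] tvec_of_linear(2)[OF c] by simp
      finally have "F (G t) (velocity \<A> {f u..f v} G t) = m * F (\<gamma> s) (velocity \<A> {u..v} \<gamma> s)"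
        using F_tv_scale[OF p velocity_tangent[OF g thick_Icc[OF uv] s] m] Gt by simp
      then show ?thesis by (simp add: s_def)
    qed
    have "((\<lambda>t. F (G t) (velocity \<A> {f u..f v} G t)) has_integral S) {f u..f v}"
      by (rule has_integral_eq[OF eq int])
    then have "travel G (f u) (f v) S"
      unfolding travel_def has_integral_speed_iff
      using piecewise_single[OF f[OF uv], of "\<lambda>I. smooth_curve X \<A> I G"] G by blast
    then show "\<exists>T. travel G (f a) (f v) T \<and> travel \<gamma> a v T"
      using IH tg travel_append by blast
  qed (rule base)
  then obtain T' where T': "travel G (f a) (f b) T'" "travel \<gamma> a b T'" by blast
  then have "T' = T" using assms(1) has_integral_unique unfolding travel_def by blast
  then show ?thesis using T'(1) by (simp add: G_def f_def)
qed

lemma fdist_le_travel: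
  assumes "travel \<gamma> a b T" "a < b"
  shows "fdist X \<A> F (\<gamma> a) (\<gamma> b) \<le> ereal T"
proof -
  define G where "G = (\<lambda>t. \<gamma> ((b - a) * t + a))"
  have G: "travel G 0 1 T"
    using travel_affine[OF assms(1), of "b - a" a] assms(2) by (simp add: G_def)
  then have "fdist X \<A> F (\<gamma> a) (\<gamma> b) \<le> ereal (travel_time \<A> F 0 1 G)"
    unfolding fdist_def by (intro INF_lower) (auto simp: travel_def G_def)
  then show ?thesis using travel_time_eq[OF G] by simp
qed

text \<open>
  The triangle inequality: an almost optimal curve from \<open>A\<close> to \<open>\<gamma> a\<close> is continued by \<open>\<gamma>\<close>.  All lower
  bounds on travel times of competitors come from this lemma, applied between points whose distances
  from \<open>A\<close> are known.
\<close>

lemma fdist_from_le_travel: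
  assumes "travel \<gamma> a b T" "a < b" "fdist_from X \<A> F A (\<gamma> a) \<le> ereal s"
  shows "fdist_from X \<A> F A (\<gamma> b) \<le> ereal (s + T)"
proof (rule ereal_le_epsilon2)
  fix e :: real assume e: "e > 0"
  have "fdist_from X \<A> F A (\<gamma> a) < ereal (s + e)"
    using assms(3) e by (metis dual_order.strict_trans2 ereal_less_eq(3) less_add_same_cancel1 less_ereal.simps(1) order_le_less_trans)
  then obtain p where p: "p \<in> A" "fdist X \<A> F p (\<gamma> a) < ereal (s + e)"
    unfolding fdist_from_def INF_less_iff by blast
  then obtain g where g: "piecewise (\<lambda>I. smooth_curve X \<A> I g) 0 1" "g 0 = p" "g 1 = \<gamma> a"
    "ereal (travel_time \<A> F 0 1 g) < ereal (s + e)"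
    unfolding fdist_def INF_less_iff by blast
  obtain S where S: "travel g 0 1 S" using travel_exists[OF g(1)] .
  have Se: "S < s + e" using g(4) travel_time_eq[OF S] by simp
  define k where "k t = (if t \<le> 0 then g (t + 1) else \<gamma> (t + a))" for t
  have "travel (\<lambda>t. g (1 * t + 1)) ((0 - 1) / 1) ((1 - 1) / 1) S" by (rule travel_affine[OF S]) simp
  then have "travel (\<lambda>t. g (t + 1)) (-1) 0 S" by simp
  then have "travel k (-1) 0 S" by (rule travel_cong) (auto simp: k_def)
  moreover have "travel (\<lambda>t. \<gamma> (1 * t + a)) ((a - a) / 1) ((b - a) / 1) T" by (rule travel_affine[OF assms(1)]) simp
  then have "travel (\<lambda>t. \<gamma> (t + a)) 0 (b - a) T" by simp
  then have "travel k 0 (b - a) T" by (rule travel_cong) (use g in \<open>auto simp: k_def\<close>)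
  ultimately have "travel k (-1) (b - a) (S + T)" by (rule travel_append)
  then have "fdist X \<A> F (k (-1)) (k (b - a)) \<le> ereal (S + T)"
    using assms(2) by (intro fdist_le_travel) auto
  then have "fdist X \<A> F p (\<gamma> b) \<le> ereal (S + T)" using g assms(2) by (simp add: k_def)
  then have "fdist_from X \<A> F A (\<gamma> b) \<le> ereal (S + T)"
    unfolding fdist_from_def using p(1) by (meson INF_lower2)
  also have "\<dots> \<le> ereal (s + T) + ereal e" using Se by simp
  finally show "fdist_from X \<A> F A (\<gamma> b) \<le> ereal (s + T) + ereal e" .
qed

lemma travel_chart:
  assumes c: "(U, \<phi>) \<in> \<A>" and y: "smooth_on {a..b} y" "\<And>t. t \<in> {a..b} \<Longrightarrow> y t \<in> \<phi> ` U"
    and y': "\<And>t. t \<in> {a..b} \<Longrightarrow> (y has_vector_derivative y' t) (at t within {a..b})" and ab: "a < b"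
  shows "travel (\<lambda>t. inv_into U \<phi> (y t)) a b (integral {a..b} (\<lambda>t. cost_coord (U, \<phi>) (y t) (y' t)))"
proof -
  define G where "G = (\<lambda>t. inv_into U \<phi> (y t))"
  have G: "smooth_curve X \<A> {a..b} G" unfolding G_def by (rule chart_curve[OF c y ab])
  have "F (G t) (velocity \<A> {a..b} G t) = cost_coord (U, \<phi>) (y t) (y' t)" if t: "t \<in> {a..b}" for t
  proof -
    have U: "G t \<in> U" "\<phi> (G t) = y t" using chart_inv[OF c] y(2)[OF t] by (auto simp: G_def)
    have "((\<phi> \<circ> G) has_vector_derivative y' t) (at t within {a..b})"
      by (rule has_vector_derivative_transform[OF t _ y'[OF t]]) (use y(2) chart_inv[OF c] in \<open>auto simp: G_def\<close>)
    then have "vector_derivative (\<phi> \<circ> G) (at t within {a..b}) = y' t"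
      by (rule vector_derivative_within[OF thick_at_nontrivial[OF thick_Icc[OF ab] t]])
    then show ?thesis using velocity_coord[OF G thick_Icc[OF ab] c t U(1)] F_coord[OF c U(1)] U(2) by simp
  qed
  then have "integral {a..b} (\<lambda>t. F (G t) (velocity \<A> {a..b} G t)) = integral {a..b} (\<lambda>t. cost_coord (U, \<phi>) (y t) (y' t))"
    by (rule integral_cong)
  then show ?thesis using travel_smooth[OF G ab] by (simp add: G_def)
qed

end

section \<open>First order variations\<close>

context randers_chart
begin

lemma cost_zero: "x \<in> S \<Longrightarrow> cost x 0 = 0"
  using bilinear_lzero[OF H_bil, of x] bilinear_rzero[OF H_bil, of x] by (simp add: cost_def)

lemma cost_differentiable:
  assumes "x \<in> S" "v \<noteq> 0"
  obtains D where "((\<lambda>s. cost x (v + s *\<^sub>R u)) has_real_derivative D) (at 0)"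
proof -
  note l = bilinear_ladd[OF H_bil[OF assms(1)]] bilinear_radd[OF H_bil[OF assms(1)]]
    bilinear_lmul[OF H_bil[OF assms(1)]] bilinear_rmul[OF H_bil[OF assms(1)]]
  define b c k where "b = H x (w x) v" and "c = H x (w x) u" and "k = 1 - H x (w x) (w x)"
  have k: "k > 0" using w_small[OF assms(1)] by (simp add: k_def)
  have pos: "b\<^sup>2 + k * H x v v > 0"
    using k H_pos[OF assms] by (simp add: add_nonneg_pos)
  have "(\<lambda>s. cost x (v + s *\<^sub>R u)) = (\<lambda>s. (sqrt ((b + s * c)\<^sup>2
      + k * (H x v v + s * (H x v u + H x u v) + s * s * H x u u)) - (b + s * c)) / k)"
    unfolding cost_def k_def[symmetric] l b_def[symmetric] c_def[symmetric]
    by (simp add: algebra_simps)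
  moreover have "\<exists>D. ((\<lambda>s. (sqrt ((b + s * c)\<^sup>2
      + k * (H x v v + s * (H x v u + H x u v) + s * s * H x u u)) - (b + s * c)) / k) has_real_derivative D) (at 0)"
    using pos k by (intro exI) (auto intro!: derivative_eq_intros)
  ultimately show thesis using that by metis
qed

end

context zermelo_manifold
begin

text \<open>
  If the points \<open>\<alpha> \<delta>\<close> and \<open>\<beta> \<delta>\<close> depart from \<open>x0\<close> with velocities \<open>a'\<close> and \<open>b'\<close>, then the coordinate segment
  between them is travelled in time \<open>\<delta> F(x0, b' - a') + o(\<delta>)\<close>.  This cannot be less than the difference
  of their distances from \<open>A\<close>.
\<close>

lemma blow_up:
  fixes \<alpha> \<beta> :: "real \<Rightarrow> 'e"
  assumes c: "(U, \<phi>) \<in> \<A>" and x0: "x0 \<in> \<phi> ` U" and d: "d > 0"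
    and \<alpha>: "\<alpha> 0 = x0" "(\<alpha> has_vector_derivative a') (at 0 within {0..d})"
    and \<beta>: "\<beta> 0 = x0" "(\<beta> has_vector_derivative b') (at 0 within {0..d})"
    and near: "\<And>\<delta>. 0 < \<delta> \<Longrightarrow> \<delta> < d \<Longrightarrow> fdist_from X \<A> F A (inv_into U \<phi> (\<alpha> \<delta>)) \<le> ereal (s1 \<delta>)"
    and far: "\<And>\<delta>. 0 < \<delta> \<Longrightarrow> \<delta> < d \<Longrightarrow> ereal (s1 \<delta> + k * \<delta>) \<le> fdist_from X \<A> F A (inv_into U \<phi> (\<beta> \<delta>))"
  shows "k \<le> cost_coord (U, \<phi>) x0 (b' - a')"
proof (rule ccontr)
  interpret randers_chart "\<phi> ` U" "metric_coord (U, \<phi>)" "wind_coord (U, \<phi>)" by (rule randers_chart[OF c])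
  define v0 where "v0 = b' - a'"
  assume "\<not> k \<le> cost_coord (U, \<phi>) x0 (b' - a')"
  then obtain k' where k': "cost x0 v0 < k'" "k' < k" unfolding v0_def using dense by (metis not_le)
  have "open (\<phi> ` U \<times> (UNIV :: 'e set))" using S by (intro open_Times) auto
  then have "isCont (\<lambda>(x, v). cost x v) (x0, v0)"
    using continuous_cost x0 by (auto simp: continuous_on_eq_continuous_at)
  then have "\<forall>\<^sub>F z in nhds (x0, v0). (\<lambda>(x, v). cost x v) z < k'"
    unfolding isCont_def tendsto_at_iff_tendsto_nhds by (rule order_tendstoD(2)) (simp add: k')
  moreover have "\<forall>\<^sub>F z in nhds (x0, v0). z \<in> \<phi> ` U \<times> (UNIV :: 'e set)"
    using \<open>open (\<phi> ` U \<times> UNIV)\<close> x0 by (intro eventually_nhds_in_open) auto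
  ultimately have "\<forall>\<^sub>F z in nhds (x0, v0). fst z \<in> \<phi> ` U \<and> cost (fst z) (snd z) < k'"
    by eventually_elim auto
  then obtain e where e: "e > 0" "\<And>z. dist z (x0, v0) < e \<Longrightarrow> fst z \<in> \<phi> ` U \<and> cost (fst z) (snd z) < k'"
    unfolding eventually_nhds_metric by blast
  define \<rho> where "\<rho> = e / 2"
  have \<rho>: "\<rho> > 0" using e(1) by (simp add: \<rho>_def)
  have close: "x \<in> \<phi> ` U \<and> cost x v < k'" if "norm (x - x0) < \<rho>" "norm (v - v0) < \<rho>" for x v
  proof -
    have "dist (x, v) (x0, v0) \<le> norm (x - x0) + norm (v - v0)"
      using norm_Pair_le[of "x - x0" "v - v0"] by (simp add: dist_norm)
    then have "dist (x, v) (x0, v0) < e" using that by (simp add: \<rho>_def)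
    then show ?thesis using e(2) by fastforce
  qed
  have ex: "\<exists>\<epsilon>>0. \<forall>\<delta>. 0 < \<delta> \<longrightarrow> \<delta> < \<epsilon> \<longrightarrow> norm (f \<delta> - x0 - \<delta> *\<^sub>R f') \<le> \<rho> / 3 * \<delta>"
    if f: "f 0 = x0" "(f has_vector_derivative f') (at 0 within {0..d})" for f f'
  proof -
    have "\<rho> / 3 > 0" using \<rho> by simp
    then obtain \<epsilon> where \<epsilon>: "\<epsilon> > 0" "\<forall>y\<in>{0..d}. norm (y - 0) < \<epsilon> \<longrightarrow> norm (f y - f 0 - (y - 0) *\<^sub>R f') \<le> \<rho> / 3 * norm (y - 0)"
      using f(2) unfolding has_vector_derivative_def has_derivative_within_alt by blast
    show ?thesis
      by (intro exI[of _ "min \<epsilon> d"] conjI allI impI) (use \<epsilon> d f(1) in auto)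
  qed
  obtain \<epsilon>1 where \<epsilon>1: "\<epsilon>1 > 0" "\<And>\<delta>. 0 < \<delta> \<Longrightarrow> \<delta> < \<epsilon>1 \<Longrightarrow> norm (\<alpha> \<delta> - x0 - \<delta> *\<^sub>R a') \<le> \<rho> / 3 * \<delta>"
    using ex[OF \<alpha>] by blast
  obtain \<epsilon>2 where \<epsilon>2: "\<epsilon>2 > 0" "\<And>\<delta>. 0 < \<delta> \<Longrightarrow> \<delta> < \<epsilon>2 \<Longrightarrow> norm (\<beta> \<delta> - x0 - \<delta> *\<^sub>R b') \<le> \<rho> / 3 * \<delta>"
    using ex[OF \<beta>] by blast
  define L where "L = norm a' + norm b' + \<rho>"
  have L: "L > 0" using \<rho> by (simp add: L_def add_nonneg_pos)
  define q where "q = \<rho> / L"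
  define \<delta> where "\<delta> = min (min \<epsilon>1 \<epsilon>2) (min d q) / 2"
  have "q > 0" using \<rho> L by (simp add: q_def)
  then have \<delta>: "\<delta> > 0" "\<delta> < \<epsilon>1" "\<delta> < \<epsilon>2" "\<delta> < d" "\<delta> < q"
    using \<epsilon>1(1) \<epsilon>2(1) d by (auto simp: \<delta>_def)
  have \<delta>L: "\<delta> * L < \<rho>" using \<delta>(5) L by (simp add: q_def field_simps)
  have n\<alpha>: "norm (\<alpha> \<delta> - x0) < \<rho>" and n\<beta>: "norm (\<beta> \<delta> - x0) < \<rho>"
  proof -
    have "norm (\<alpha> \<delta> - x0) \<le> norm (\<alpha> \<delta> - x0 - \<delta> *\<^sub>R a') + norm (\<delta> *\<^sub>R a')"
      "norm (\<beta> \<delta> - x0) \<le> norm (\<beta> \<delta> - x0 - \<delta> *\<^sub>R b') + norm (\<delta> *\<^sub>R b')"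
      using norm_triangle_ineq[of "\<alpha> \<delta> - x0 - \<delta> *\<^sub>R a'" "\<delta> *\<^sub>R a'"]
        norm_triangle_ineq[of "\<beta> \<delta> - x0 - \<delta> *\<^sub>R b'" "\<delta> *\<^sub>R b'"] by simp_all
    then have "norm (\<alpha> \<delta> - x0) \<le> \<rho> / 3 * \<delta> + \<delta> * norm a'" "norm (\<beta> \<delta> - x0) \<le> \<rho> / 3 * \<delta> + \<delta> * norm b'"
      using \<epsilon>1(2)[OF \<delta>(1,2)] \<epsilon>2(2)[OF \<delta>(1,3)] \<delta>(1) by auto
    moreover have "\<rho> / 3 * \<delta> + \<delta> * norm a' \<le> \<delta> * L" "\<rho> / 3 * \<delta> + \<delta> * norm b' \<le> \<delta> * L"
      using \<delta>(1) \<rho> by (simp_all add: L_def algebra_simps)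
    ultimately show "norm (\<alpha> \<delta> - x0) < \<rho>" "norm (\<beta> \<delta> - x0) < \<rho>" using \<delta>L by linarith+
  qed
  define v where "v = (1 / \<delta>) *\<^sub>R (\<beta> \<delta> - \<alpha> \<delta>)"
  have nv: "norm (v - v0) < \<rho>"
  proof -
    have "v - v0 = (1 / \<delta>) *\<^sub>R ((\<beta> \<delta> - x0 - \<delta> *\<^sub>R b') - (\<alpha> \<delta> - x0 - \<delta> *\<^sub>R a'))"
      using \<delta>(1) by (simp add: v_def v0_def scaleR_right_diff_distrib algebra_simps)
    then have "norm (v - v0) = (1 / \<delta>) * norm ((\<beta> \<delta> - x0 - \<delta> *\<^sub>R b') - (\<alpha> \<delta> - x0 - \<delta> *\<^sub>R a'))"
      using \<delta>(1) by simp
    also have "\<dots> \<le> (1 / \<delta>) * (\<rho> / 3 * \<delta> + \<rho> / 3 * \<delta>)"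
      using \<delta>(1) \<epsilon>1(2)[OF \<delta>(1,2)] \<epsilon>2(2)[OF \<delta>(1,3)]
      by (intro mult_left_mono order.trans[OF norm_triangle_ineq4 add_mono]) auto
    also have "\<dots> < \<rho>" using \<delta>(1) \<rho> by simp
    finally show ?thesis .
  qed
  define y where "y t = \<alpha> \<delta> + t *\<^sub>R v" for t
  have ny: "norm (y t - x0) < \<rho>" if t: "t \<in> {0..\<delta>}" for t
  proof -
    have "y t = (1 - t / \<delta>) *\<^sub>R \<alpha> \<delta> + (t / \<delta>) *\<^sub>R \<beta> \<delta>"
      using \<delta>(1) by (simp add: y_def v_def algebra_simps)
    moreover have "(1 - t / \<delta>) *\<^sub>R \<alpha> \<delta> + (t / \<delta>) *\<^sub>R \<beta> \<delta> \<in> ball x0 \<rho>"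
      using n\<alpha> n\<beta> t \<delta>(1) by (intro convexD[OF convex_ball]) (auto simp: dist_norm norm_minus_commute)
    ultimately show ?thesis by (simp add: dist_norm norm_minus_commute)
  qed
  have sy: "smooth_on {0..\<delta>} y" unfolding y_def
    by (intro smooth_on_add smooth_on_const smooth_on_bounded_linear thick_Icc \<delta>(1) bounded_linear_scaleR_left)
  have dy: "(y has_vector_derivative v) (at t within {0..\<delta>})" for t
    unfolding y_def by (auto intro!: derivative_eq_intros)
  define I where "I = integral {0..\<delta>} (\<lambda>t. cost (y t) v)"
  have yU: "y t \<in> \<phi> ` U" if "t \<in> {0..\<delta>}" for t using close[OF ny[OF that] nv] by blast
  have tr: "travel (\<lambda>t. inv_into U \<phi> (y t)) 0 \<delta> I"
    unfolding I_def by (rule travel_chart[OF c sy yU dy \<delta>(1)])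
  have "I \<le> integral {0..\<delta>} (\<lambda>t. k')" unfolding I_def
  proof (rule integral_le)
    show "(\<lambda>t. cost (y t) v) integrable_on {0..\<delta>}"
      by (intro integrable_continuous_interval continuous_on_cost smooth_on_continuous[OF sy] continuous_on_const yU)
    show "cost (y t) v \<le> k'" if "t \<in> {0..\<delta>}" for t using close[OF ny[OF that] nv] by simp
  qed auto
  then have "I \<le> k' * \<delta>" using \<delta>(1) by (simp add: mult.commute)
  also have "\<dots> < k * \<delta>" using k'(2) \<delta>(1) by simp
  finally have I: "I < k * \<delta>" .
  have "y 0 = \<alpha> \<delta>" "y \<delta> = \<beta> \<delta>" using \<delta>(1) by (simp_all add: y_def v_def)
  then have "fdist_from X \<A> F A (inv_into U \<phi> (\<beta> \<delta>)) \<le> ereal (s1 \<delta> + I)"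
    using fdist_from_le_travel[OF tr \<delta>(1), of A "s1 \<delta>"] near[OF \<delta>(1,4)] by simp
  then have "ereal (s1 \<delta> + k * \<delta>) \<le> ereal (s1 \<delta> + I)" using far[OF \<delta>(1,4)] by (rule order.trans[rotated])
  then show False using I by simp
qed

text \<open>
  Cutting the corner at time \<open>T\<close> by the segment from time \<open>T - \<delta>\<close> to time \<open>T + \<delta>\<close> takes time
  \<open>\<delta> F(u + v) + o(\<delta>)\<close>, and \<open>F(u + v) < 2\<close> by strict convexity unless the one-sided velocities agree.
\<close>

lemma no_corner:
  assumes c: "(U, \<phi>) \<in> \<A>" and d: "d > 0"
    and \<sigma>: "\<And>t. t \<in> {T-d..T} \<Longrightarrow> \<sigma> t \<in> U" "\<And>t. t \<in> {T-d..T} \<Longrightarrow> fdist_from X \<A> F A (\<sigma> t) = ereal t"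
      "((\<phi> \<circ> \<sigma>) has_vector_derivative u) (at T within {T-d..T})" "cost_coord (U, \<phi>) (\<phi> (\<sigma> T)) u = 1"
    and \<gamma>: "\<And>t. t \<in> {T..T+d} \<Longrightarrow> \<gamma> t \<in> U" "\<And>t. t \<in> {T..T+d} \<Longrightarrow> fdist_from X \<A> F A (\<gamma> t) = ereal t"
      "((\<phi> \<circ> \<gamma>) has_vector_derivative v) (at T within {T..T+d})" "cost_coord (U, \<phi>) (\<phi> (\<sigma> T)) v = 1"
    and join: "\<gamma> T = \<sigma> T"
  shows "u = v"
proof (rule ccontr)
  interpret randers_chart "\<phi> ` U" "metric_coord (U, \<phi>)" "wind_coord (U, \<phi>)" by (rule randers_chart[OF c])
  assume ne: "u \<noteq> v"
  have x0: "\<phi> (\<sigma> T) \<in> \<phi> ` U" using \<sigma>(1)[of T] d by auto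
  have "((\<lambda>\<delta>. T - \<delta>) has_vector_derivative -1) (at 0 within {0..d})"
    by (auto intro!: derivative_eq_intros simp: has_real_derivative_iff_has_vector_derivative[symmetric])
  moreover have "((\<phi> \<circ> \<sigma>) has_vector_derivative u) (at (T - 0) within (\<lambda>\<delta>. T - \<delta>) ` {0..d})"
    using \<sigma>(3) by (auto intro: has_vector_derivative_within_subset)
  ultimately have D1: "((\<phi> \<circ> \<sigma>) \<circ> (\<lambda>\<delta>. T - \<delta>) has_vector_derivative (-1) *\<^sub>R u) (at 0 within {0..d})"
    by (rule vector_diff_chain_within)
  have "((\<lambda>\<delta>. T + \<delta>) has_vector_derivative 1) (at 0 within {0..d})"
    by (auto intro!: derivative_eq_intros simp: has_real_derivative_iff_has_vector_derivative[symmetric])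
  moreover have "((\<phi> \<circ> \<gamma>) has_vector_derivative v) (at (T + 0) within (\<lambda>\<delta>. T + \<delta>) ` {0..d})"
    using \<gamma>(3) by (auto intro: has_vector_derivative_within_subset)
  ultimately have D2: "((\<phi> \<circ> \<gamma>) \<circ> (\<lambda>\<delta>. T + \<delta>) has_vector_derivative 1 *\<^sub>R v) (at 0 within {0..d})"
    by (rule vector_diff_chain_within)
  have "2 \<le> cost (\<phi> (\<sigma> T)) (1 *\<^sub>R v - (-1) *\<^sub>R u)"
  proof (rule blow_up[OF c x0 d _ D1 _ D2, of A "\<lambda>\<delta>. T - \<delta>"])
    fix \<delta> assume \<delta>: "0 < \<delta>" "\<delta> < d"
    show "fdist_from X \<A> F A (inv_into U \<phi> ((\<phi> \<circ> \<sigma> \<circ> (-) T) \<delta>)) \<le> ereal (T - \<delta>)"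
      using \<sigma>(1,2)[of "T - \<delta>"] \<delta> chart_inv(1)[OF c] by simp
    show "ereal (T - \<delta> + 2 * \<delta>) \<le> fdist_from X \<A> F A (inv_into U \<phi> ((\<phi> \<circ> \<gamma> \<circ> (+) T) \<delta>))"
      using \<gamma>(1,2)[of "T + \<delta>"] \<delta> chart_inv(1)[OF c] by simp
  qed (use join in auto)
  also have "1 *\<^sub>R v - (-1) *\<^sub>R u = 2 *\<^sub>R ((1/2) *\<^sub>R (u + v))" by simp
  also have "cost (\<phi> (\<sigma> T)) \<dots> = 2 * cost (\<phi> (\<sigma> T)) ((1/2) *\<^sub>R (u + v))"
    by (rule cost_homogeneous[OF x0]) simp
  finally show False using cost_midpoint_less[OF x0 \<sigma>(4) \<gamma>(4) ne] by simp
qed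

lemma fdist_from_source:
  assumes "p \<in> A" "p \<in> topspace X"
  shows "fdist_from X \<A> F A p \<le> 0"
proof -
  obtain U \<phi> where c: "(U, \<phi>) \<in> \<A>" "p \<in> U" using chart_cover[OF assms(2)] by blast
  interpret randers_chart "\<phi> ` U" "metric_coord (U, \<phi>)" "wind_coord (U, \<phi>)" by (rule randers_chart[OF c(1)])
  have x: "\<phi> p \<in> \<phi> ` U" using c(2) by simp
  have "travel (\<lambda>t. inv_into U \<phi> (\<phi> p)) 0 1 (integral {0..1} (\<lambda>t::real. cost (\<phi> p) 0))"
  proof (rule travel_chart[OF c(1)])
    show "smooth_on {0..1} (\<lambda>t::real. \<phi> p)" by (intro smooth_on_const thick_Icc) simp
    show "((\<lambda>t. \<phi> p) has_vector_derivative 0) (at t within {0..1})" for t :: real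
      by (rule has_vector_derivative_const)
  qed (use x in auto)
  then have "fdist X \<A> F p p \<le> 0"
    using fdist_le_travel[of "\<lambda>t. inv_into U \<phi> (\<phi> p)" 0 1 0] cost_zero[OF x] chart_inv(1)[OF c] by (simp add: zero_ereal_def)
  then show ?thesis unfolding fdist_from_def using assms(1) by (meson INF_lower2)
qed

text \<open>
  By homogeneity \<open>F\<^sup>2(v + t v + s u) = (1 + t)\<^sup>2 F\<^sup>2(v + (s / (1 + t)) u)\<close>, so the derivative in \<open>s\<close> at \<open>0\<close>
  is a multiple of the one for \<open>t = 0\<close>.  That one vanishes because \<open>s = 0\<close> is a minimum.
\<close>

lemma fundamental_tensor_zero:
  assumes c: "(U, \<phi>) \<in> \<A>" and p: "p \<in> U"
    and v: "cost_coord (U, \<phi>) (\<phi> p) v = 1" and min: "\<And>s. 1 \<le> cost_coord (U, \<phi>) (\<phi> p) (v + s *\<^sub>R u)"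
  shows "fundamental_tensor F p (tvec_of \<A> (U, \<phi>) p v) (tvec_of \<A> (U, \<phi>) p v) (tvec_of \<A> (U, \<phi>) p u) = 0"
proof -
  interpret randers_chart "\<phi> ` U" "metric_coord (U, \<phi>)" "wind_coord (U, \<phi>)" by (rule randers_chart[OF c])
  define x where "x = \<phi> p"
  have x: "x \<in> \<phi> ` U" using p by (simp add: x_def)
  have v0: "v \<noteq> 0" using v cost_zero[OF x] by (auto simp: x_def)
  obtain D where D: "((\<lambda>s. cost x (v + s *\<^sub>R u)) has_real_derivative D) (at 0)"
    using cost_differentiable[OF x v0] .
  define f where "f s = (cost x (v + s *\<^sub>R u))\<^sup>2" for s
  have f1: "(f has_real_derivative 2 * D) (at 0)"
    unfolding f_def using DERIV_power[OF D, of 2] v by (simp add: x_def)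
  have "2 * D = 0"
  proof (rule DERIV_local_min[OF f1, of 1])
    have "1 \<le> (cost x (v + s *\<^sub>R u))\<^sup>2" for s using min[of s] by (simp add: x_def)
    then show "\<forall>y. \<bar>0 - y\<bar> < 1 \<longrightarrow> f 0 \<le> f y" using v by (simp add: f_def x_def)
  qed simp
  then have f0: "(f has_real_derivative 0) (at 0)" using f1 by simp
  define G where "G t s = (F p (tv_add (tvec_of \<A> (U, \<phi>) p v) (tv_add (tv_scale t (tvec_of \<A> (U, \<phi>) p v))
      (tv_scale s (tvec_of \<A> (U, \<phi>) p u)))))\<^sup>2" for t s
  have G: "G t s = (1 + t)\<^sup>2 * f (s / (1 + t))" if "\<bar>t\<bar> < 1" for t s
  proof -
    have t: "1 + t > 0" using that by auto
    have "v + (t *\<^sub>R v + s *\<^sub>R u) = (1 + t) *\<^sub>R (v + (s / (1 + t)) *\<^sub>R u)"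
      using t by (simp add: scaleR_left_distrib scaleR_right_distrib)
    moreover have "G t s = (cost x (v + (t *\<^sub>R v + s *\<^sub>R u)))\<^sup>2"
      unfolding G_def tvec_of_linear[OF c p, symmetric] F_coord[OF c p] x_def ..
    ultimately show ?thesis
      using cost_homogeneous[OF x t] by (simp add: f_def power_mult_distrib)
  qed
  have in0: "deriv (G t) 0 = 0" if t: "\<bar>t\<bar> < 1" for t
  proof -
    have "(f has_real_derivative 0) (at (0 / (1 + t)))" using f0 by simp
    moreover have "((\<lambda>s. s / (1 + t)) has_real_derivative 1 / (1 + t)) (at 0)"
      using t by (auto intro!: derivative_eq_intros)
    ultimately have "((\<lambda>s. f (s / (1 + t))) has_real_derivative 0 * (1 / (1 + t))) (at 0)"
      by (rule DERIV_chain2)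
    from DERIV_cmult[OF this, of "(1 + t)\<^sup>2"]
    moreover have "G t = (\<lambda>s. (1 + t)\<^sup>2 * f (s / (1 + t)))" using G[OF t] by auto
    ultimately have "(G t has_real_derivative 0) (at 0)" by simp
    then show ?thesis by (rule DERIV_imp_deriv)
  qed
  have "((\<lambda>t. deriv (G t) 0) has_real_derivative 0) (at 0)"
  proof (rule has_field_derivative_transform_within_open[of "\<lambda>t. 0" _ _ "{-1<..<1}"])
    show "((\<lambda>t. 0) has_real_derivative 0) (at 0)" by simp
  qed (use in0 in auto)
  then have "deriv (\<lambda>t. deriv (G t) 0) 0 = 0" by (rule DERIV_imp_deriv)
  then show ?thesis unfolding fundamental_tensor_def G_def by simp
qed

text \<open>
  The first variation formula without integration: letting the starting point move along a curve \<open>g\<close>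
  in \<open>A\<close> while \<open>\<gamma>\<close> advances by \<open>\<delta>\<close>, the segment from \<open>g(- s \<delta>)\<close> to \<open>\<gamma> \<delta>\<close> shows \<open>F(v + s u) \<ge> 1\<close> for all
  \<open>s\<close>, where \<open>v\<close> and \<open>u\<close> are the velocities of \<open>\<gamma>\<close> and \<open>g\<close>.
\<close>

lemma starts_orthogonally:
  assumes \<gamma>: "smooth_curve X \<A> {0..b} \<gamma>" "unit_speed \<A> F {0..b} \<gamma>" "\<gamma> 0 \<in> A" and b: "b > 0"
    and on_time: "\<And>t. t \<in> {0..b} \<Longrightarrow> fdist_from X \<A> F A (\<gamma> t) = ereal t"
  shows "F_orthogonal X \<A> F A (\<gamma> 0) (velocity \<A> {0..b} \<gamma> 0)"
proof -
  define p where "p = \<gamma> 0"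
  have b0: "0 \<in> {0..b}" using b by simp
  have "p \<in> topspace X" using smooth_curve_in_topspace[OF \<gamma>(1) b0] by (simp add: p_def)
  then obtain U \<phi> where c: "(U, \<phi>) \<in> \<A>" "p \<in> U" using chart_cover by blast
  interpret randers_chart "\<phi> ` U" "metric_coord (U, \<phi>)" "wind_coord (U, \<phi>)" by (rule randers_chart[OF c(1)])
  have x0: "\<phi> p \<in> \<phi> ` U" using c(2) by simp
  define v where "v = vector_derivative (\<phi> \<circ> \<gamma>) (at 0 within {0..b})"
  have V: "velocity \<A> {0..b} \<gamma> 0 = tvec_of \<A> (U, \<phi>) p v"
    using velocity_coord[OF \<gamma>(1) thick_Icc[OF b] c(1) b0] c(2) by (simp add: p_def v_def)
  have v1: "cost (\<phi> p) v = 1"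
    using \<gamma>(2) b0 V F_coord[OF c] unfolding unit_speed_def p_def by metis
  have dv: "((\<phi> \<circ> \<gamma>) has_vector_derivative v) (at 0 within {0..b})"
    unfolding v_def using smooth_curve_derivative[OF \<gamma>(1) c(1) b0] c(2) by (simp add: p_def)
  have "tvec_of \<A> (U, \<phi>) p v \<noteq> tv_zero"
    using tvec_of_self[OF c, of v] v1 cost_zero[OF x0] by (auto simp: tv_zero_def)
  moreover have "fundamental_tensor F p (tvec_of \<A> (U, \<phi>) p v) (tvec_of \<A> (U, \<phi>) p v) Z = 0"
    if Z: "Z \<in> sub_tangent_space X \<A> A p" for Z
  proof -
    obtain e g where e: "e > 0" and g: "smooth_curve X \<A> {-e<..<e} g" "g ` {-e<..<e} \<subseteq> A" "g 0 = p"
      and Zg: "Z = velocity \<A> {-e<..<e} g 0"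
      using Z unfolding sub_tangent_space_def by blast
    have e0: "0 \<in> {-e<..<e}" using e by simp
    have th: "thick {-e<..<e}" by (rule thick_open) simp
    define u where "u = vector_derivative (\<phi> \<circ> g) (at 0 within {-e<..<e})"
    have Zu: "Z = tvec_of \<A> (U, \<phi>) p u"
      using velocity_coord[OF g(1) th c(1) e0] c(2) g(3) Zg by (simp add: u_def)
    have du: "((\<phi> \<circ> g) has_vector_derivative u) (at 0)"
      using smooth_curve_derivative[OF g(1) c(1) e0] c(2) g(3) at_within_open[OF e0] unfolding u_def by simp
    have "openin (top_of_set {-e<..<e}) {t\<in>{-e<..<e}. g t \<in> U}"
      by (rule smooth_curve_chart_domain(1)[OF g(1) c(1)])
    then have "open {t\<in>{-e<..<e}. g t \<in> U}" by (rule openin_open_trans) simp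
    moreover have "0 \<in> {t\<in>{-e<..<e}. g t \<in> U}" using e0 g(3) c(2) by simp
    ultimately obtain e' where e': "e' > 0" "ball 0 e' \<subseteq> {t\<in>{-e<..<e}. g t \<in> U}"
      using open_contains_ball by blast
    obtain b' where b': "b' > 0" "b' \<le> b" "\<And>t. t \<in> {0..b'} \<Longrightarrow> \<gamma> t \<in> U"
    proof -
      have "openin (top_of_set {0..b}) {t\<in>{0..b}. \<gamma> t \<in> U}"
        by (rule smooth_curve_chart_domain(1)[OF \<gamma>(1) c(1)])
      then obtain T where T: "open T" "{t\<in>{0..b}. \<gamma> t \<in> U} = {0..b} \<inter> T" by (auto simp: openin_open)
      have "0 \<in> T" using T(2) b0 c(2) by (auto simp: p_def)
      then obtain q where q: "q > 0" "ball 0 q \<subseteq> T" using T(1) open_contains_ball by blast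
      have "\<gamma> t \<in> U" if "t \<in> {0..min b (q / 2)}" for t
      proof -
        have "t \<in> {0..b} \<inter> T" using that q by (auto simp: dist_norm)
        then show ?thesis using T(2) by blast
      qed
      then show thesis using that[of "min b (q / 2)"] b q(1) by simp
    qed
    have min: "1 \<le> cost (\<phi> p) (v + s *\<^sub>R u)" for s
    proof -
      define d where "d = min b' (e' / (\<bar>s\<bar> + 1))"
      have d: "d > 0" "d \<le> b'" using b' e'(1) by (simp_all add: d_def)
      have gs: "- s * \<delta> \<in> {-e<..<e}" "g (- s * \<delta>) \<in> U" if "0 < \<delta>" "\<delta> < d" for \<delta>
      proof -
        have "\<delta> * (\<bar>s\<bar> + 1) < e'" using that by (simp add: d_def field_simps)
        then have "\<bar>- s * \<delta>\<bar> < e'" using that by (simp add: abs_mult algebra_simps)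
        then have "- s * \<delta> \<in> ball 0 e'" by (simp add: dist_norm)
        then show "- s * \<delta> \<in> {-e<..<e}" "g (- s * \<delta>) \<in> U" using e'(2) by blast+
      qed
      have "((\<lambda>\<delta>. - s * \<delta>) has_vector_derivative - s) (at 0 within {0..d})"
        by (auto intro!: derivative_eq_intros simp: has_real_derivative_iff_has_vector_derivative[symmetric])
      moreover have "((\<phi> \<circ> g) has_vector_derivative u) (at (- s * 0) within (\<lambda>\<delta>. - s * \<delta>) ` {0..d})"
        using du by (simp add: has_vector_derivative_at_within)
      ultimately have D1: "((\<phi> \<circ> g) \<circ> (\<lambda>\<delta>. - s * \<delta>) has_vector_derivative (- s) *\<^sub>R u) (at 0 within {0..d})"
        by (rule vector_diff_chain_within)
      have D2: "((\<phi> \<circ> \<gamma>) has_vector_derivative v) (at 0 within {0..d})"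
        using dv by (rule has_vector_derivative_within_subset) (use d b' in auto)
      have "1 \<le> cost (\<phi> p) (v - (- s) *\<^sub>R u)"
      proof (rule blow_up[OF c(1) x0 d(1) _ D1 _ D2, of A "\<lambda>_. 0"])
        fix \<delta> assume \<delta>: "0 < \<delta>" "\<delta> < d"
        have "g (- s * \<delta>) \<in> A" "g (- s * \<delta>) \<in> topspace X"
          using g(2) gs[OF \<delta>] chartD(4)[OF c(1)] by blast+
        then show "fdist_from X \<A> F A (inv_into U \<phi> ((\<phi> \<circ> g \<circ> (\<lambda>\<delta>. - s * \<delta>)) \<delta>)) \<le> ereal 0"
          using fdist_from_source chart_inv(1)[OF c(1) gs(2)[OF \<delta>]] by (simp add: zero_ereal_def[symmetric])
        show "ereal (0 + 1 * \<delta>) \<le> fdist_from X \<A> F A (inv_into U \<phi> ((\<phi> \<circ> \<gamma>) \<delta>))"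
          using on_time[of \<delta>] b'(2) b'(3)[of \<delta>] d \<delta> chart_inv(1)[OF c(1), of "\<gamma> \<delta>"] by simp
      qed (use g(3) in \<open>auto simp: p_def\<close>)
      then show ?thesis by simp
    qed
    show ?thesis unfolding Zu by (rule fundamental_tensor_zero[OF c v1 min])
  qed
  ultimately show ?thesis unfolding F_orthogonal_def V p_def[symmetric] by blast
qed

section \<open>Wave rays are normal geodesics\<close>

lemma unit_speed_subset:
  assumes "smooth_curve X \<A> I \<gamma>" "unit_speed \<A> F I \<gamma>" "thick J" "J \<subseteq> I"
  shows "unit_speed \<A> F J \<gamma>"
  using assms velocity_subset[OF assms(1,3,4)] unfolding unit_speed_def by auto

lemma travel_time_unit_speed:
  assumes "smooth_curve X \<A> {a..b} \<gamma>" "unit_speed \<A> F {a..b} \<gamma>" "a \<le> s" "s < u" "u \<le> b"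
  shows "travel \<gamma> s u (u - s)"
proof -
  have g: "smooth_curve X \<A> {s..u} \<gamma>" by (rule smooth_curve_subset[OF assms(1) _ assms(4) refl]) (use assms in auto)
  have "unit_speed \<A> F {s..u} \<gamma>"
    by (rule unit_speed_subset[OF assms(1,2) thick_Icc[OF assms(4)]]) (use assms in auto)
  then have "integral {s..u} (\<lambda>t. F (\<gamma> t) (velocity \<A> {s..u} \<gamma> t)) = integral {s..u} (\<lambda>t. 1)"
    unfolding unit_speed_def by (intro integral_cong) auto
  then show ?thesis using travel_smooth[OF g assms(4)] assms(4) by simp
qed

text \<open>
  A curve that is everywhere at distance \<open>t\<close> from \<open>A\<close> at time \<open>t\<close> minimises between any two of its
  points, as a faster connection would bring its later point closer to \<open>A\<close>.
\<close>

lemma on_time_normal_geodesic: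
  assumes \<gamma>: "smooth_curve X \<A> {0..b} \<gamma>" "unit_speed \<A> F {0..b} \<gamma>" "\<gamma> 0 \<in> A" and b: "b > 0"
    and on_time: "\<And>t. t \<in> {0..b} \<Longrightarrow> fdist_from X \<A> F A (\<gamma> t) = ereal t"
  shows "normal_geodesic X \<A> F A b \<gamma>"
proof -
  have "fdist X \<A> F (\<gamma> s) (\<gamma> u) = ereal (travel_time \<A> F s u \<gamma>)" if su: "s \<in> {0..b}" "u \<in> {0..b}" "s < u" for s u
  proof -
    have t: "travel \<gamma> s u (u - s)" by (rule travel_time_unit_speed[OF \<gamma>(1,2)]) (use su in auto)
    have "ereal (u - s) \<le> fdist X \<A> F (\<gamma> s) (\<gamma> u)" unfolding fdist_def
    proof (rule INF_greatest)
      fix g assume "g \<in> {\<gamma>'. piecewise (\<lambda>I. smooth_curve X \<A> I \<gamma>') 0 1 \<and> \<gamma>' 0 = \<gamma> s \<and> \<gamma>' 1 = \<gamma> u}"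
      then have g: "piecewise (\<lambda>I. smooth_curve X \<A> I g) 0 1" "g 0 = \<gamma> s" "g 1 = \<gamma> u" by auto
      obtain T where T: "travel g 0 1 T" using travel_exists[OF g(1)] .
      have "fdist_from X \<A> F A (g 1) \<le> ereal (s + T)"
        by (rule fdist_from_le_travel[OF T]) (use g(2) on_time su in auto)
      then have "u \<le> s + T" using g(3) on_time[OF su(2)] by simp
      then show "ereal (u - s) \<le> ereal (travel_time \<A> F 0 1 g)" using travel_time_eq[OF T] by simp
    qed
    then show ?thesis using fdist_le_travel[OF t su(3)] travel_time_eq[OF t] by simp
  qed
  then have "F_geodesic X \<A> F 0 b \<gamma>"
    unfolding F_geodesic_def using \<gamma>(1) by (auto intro!: exI[of _ "1::real"])
  then show ?thesis
    unfolding normal_geodesic_def using starts_orthogonally[OF \<gamma> b on_time] \<gamma> by blast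
qed

text \<open>
  Both curves are on time, so at \<open>T\<close> there is no corner between them, and the competitors of
  \<open>no_branching\<close>, which lead from \<open>\<sigma> (T - \<delta>)\<close> to \<open>\<gamma> (T + \<delta>)\<close> and to \<open>\<sigma> (T + \<delta>)\<close>, need at least the time
  \<open>2 \<delta>\<close> each.
\<close>

lemma on_time_curves_do_not_branch:
  assumes T: "0 < T" "T < b" "b \<le> r"
    and \<sigma>: "smooth_curve X \<A> {0..r} \<sigma>" "unit_speed \<A> F {0..r} \<sigma>"
      "\<And>t. t \<in> {0..r} \<Longrightarrow> fdist_from X \<A> F A (\<sigma> t) = ereal t"
    and \<gamma>: "smooth_curve X \<A> {T..b} \<gamma>" "unit_speed \<A> F {T..b} \<gamma>"
      "\<And>t. t \<in> {T..b} \<Longrightarrow> fdist_from X \<A> F A (\<gamma> t) = ereal t"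
    and join: "\<gamma> T = \<sigma> T"
  shows "\<exists>\<delta>>0. T + \<delta> \<le> b \<and> (\<forall>t\<in>{T..T+\<delta>}. \<gamma> t = \<sigma> t)"
proof -
  have Tr: "T \<in> {0..r}" "T \<in> {T..b}" using T by auto
  obtain U \<phi> where c: "(U, \<phi>) \<in> \<A>" "\<sigma> T \<in> U"
    using chart_cover[OF smooth_curve_in_topspace[OF \<sigma>(1) Tr(1)]] by blast
  interpret randers_chart "\<phi> ` U" "metric_coord (U, \<phi>)" "wind_coord (U, \<phi>)" by (rule randers_chart[OF c(1)])
  have nbhd: "\<exists>e>0. \<forall>t\<in>I. \<bar>t - T\<bar> < e \<longrightarrow> g t \<in> U" if g: "smooth_curve X \<A> I g" "T \<in> I" "g T \<in> U" for I g
  proof -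
    obtain O' where O': "open O'" "{t\<in>I. g t \<in> U} = I \<inter> O'"
      using smooth_curve_chart_domain(1)[OF g(1) c(1)] by (auto simp: openin_open)
    have "T \<in> O'" using g O'(2) by blast
    then obtain e where e: "e > 0" "ball T e \<subseteq> O'" using O'(1) open_contains_ball by blast
    have "g t \<in> U" if "t \<in> I" "\<bar>t - T\<bar> < e" for t
    proof -
      have "t \<in> ball T e" using that by (simp add: dist_real_def abs_minus_commute)
      then show ?thesis using e(2) O'(2) that(1) by blast
    qed
    then show ?thesis using e(1) by blast
  qed
  obtain e1 where e1: "e1 > 0" "\<And>t. t \<in> {0..r} \<Longrightarrow> \<bar>t - T\<bar> < e1 \<Longrightarrow> \<sigma> t \<in> U"
    using nbhd[OF \<sigma>(1) Tr(1) c(2)] by blast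
  obtain e2 where e2: "e2 > 0" "\<And>t. t \<in> {T..b} \<Longrightarrow> \<bar>t - T\<bar> < e2 \<Longrightarrow> \<gamma> t \<in> U"
    using nbhd[OF \<gamma>(1) Tr(2)] c(2) join by metis
  define d where "d = min (min e1 e2) (min T (b - T)) / 2"
  have d: "d > 0" "d < e1" "d < e2" "d < T" "d < b - T"
    using e1(1) e2(1) T by (auto simp: d_def)
  have sub: "{T-d..T+d} \<subseteq> {0..r}" "{T..T+d} \<subseteq> {T..b}" "{T-d..T+d} \<subseteq> {T-d..T+d}" using d T by auto
  have lt: "T - d < T + d" "T < T + d" using d by auto
  have \<sigma>U: "\<sigma> t \<in> U" if "t \<in> {T-d..T+d}" for t using e1(2)[of t] that d T by auto
  have \<gamma>U: "\<gamma> t \<in> U" if "t \<in> {T..T+d}" for t using e2(2)[of t] that d T by auto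
  note s\<sigma> = smooth_curve_subset[OF \<sigma>(1) sub(1) lt(1) refl]
  note s\<gamma> = smooth_curve_subset[OF \<gamma>(1) sub(2) lt(2) refl]
  note u\<sigma> = unit_speed_subset[OF \<sigma>(1,2) thick_Icc[OF lt(1)] sub(1)]
  note u\<gamma> = unit_speed_subset[OF \<gamma>(1,2) thick_Icc[OF lt(2)] sub(2)]
  define x1 x2 where "x1 = \<phi> \<circ> \<sigma>" and "x2 = \<phi> \<circ> \<gamma>"
  obtain x1' where x1: "smooth_on {T-d..T+d} x1"
    "\<And>t. t \<in> {T-d..T+d} \<Longrightarrow> (x1 has_vector_derivative x1' t) (at t within {T-d..T+d})"
    "continuous_on {T-d..T+d} x1'" "\<And>t. t \<in> {T-d..T+d} \<Longrightarrow> cost (x1 t) (x1' t) = 1"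
    using chart_piece[OF s\<sigma> lt(1) c(1) \<sigma>U] u\<sigma> unfolding x1_def unit_speed_def by (metis o_apply)
  obtain x2' where x2: "smooth_on {T..T+d} x2"
    "\<And>t. t \<in> {T..T+d} \<Longrightarrow> (x2 has_vector_derivative x2' t) (at t within {T..T+d})"
    "continuous_on {T..T+d} x2'" "\<And>t. t \<in> {T..T+d} \<Longrightarrow> cost (x2 t) (x2' t) = 1"
    using chart_piece[OF s\<gamma> lt(2) c(1) \<gamma>U] u\<gamma> unfolding x2_def unit_speed_def by (metis o_apply)
  have inv: "inv_into U \<phi> (x1 t) = \<sigma> t" if "t \<in> {T-d..T+d}" for t
    using chart_inv(1)[OF c(1) \<sigma>U[OF that]] by (simp add: x1_def)
  have inv2: "inv_into U \<phi> (x2 t) = \<gamma> t" if "t \<in> {T..T+d}" for t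
    using chart_inv(1)[OF c(1) \<gamma>U[OF that]] by (simp add: x2_def)
  have jx: "x2 T = x1 T" using join by (simp add: x1_def x2_def)
  have "x1' T = x2' T"
  proof (rule no_corner[OF c(1) d(1), of T \<sigma> A _ \<gamma>])
    show "((\<phi> \<circ> \<sigma>) has_vector_derivative x1' T) (at T within {T-d..T})"
      using x1(2)[of T] d unfolding x1_def by (auto intro: has_vector_derivative_within_subset)
    show "((\<phi> \<circ> \<gamma>) has_vector_derivative x2' T) (at T within {T..T+d})"
      using x2(2)[of T] d unfolding x2_def by auto
    show "cost (\<phi> (\<sigma> T)) (x1' T) = 1" using x1(4)[of T] d by (simp add: x1_def)
    show "cost (\<phi> (\<sigma> T)) (x2' T) = 1" using x2(4)[of T] d join by (simp add: x2_def)
  qed (use \<sigma>U \<gamma>U \<sigma>(3) \<gamma>(3) sub join d T in auto)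
  then have jv: "x2' T = x1' T" by simp
  have "\<exists>\<delta>>0. \<delta> \<le> d \<and> (\<forall>t\<in>{T..T+\<delta>}. x2 t = x1 t)"
  proof (rule no_branching[OF d(1) x1(2,3) _ x1(4) x2(2,3) _ x2(4) jx jv])
    show "x1 t \<in> \<phi> ` U" if "t \<in> {T-d..T+d}" for t using \<sigma>U[OF that] by (simp add: x1_def)
    show "x2 t \<in> \<phi> ` U" if "t \<in> {T..T+d}" for t using \<gamma>U[OF that] by (simp add: x2_def)
    fix \<delta> c' k
    assume \<delta>: "0 < \<delta>" "\<delta> < d" and c': "\<bar>c'\<bar> = 1 / (4 * \<delta>)" and k: "k = c' *\<^sub>R (x2 (T + \<delta>) - x1 (T + \<delta>))"
    define yL where "yL t = x1 t + (t - (T - \<delta>)) *\<^sub>R k" for t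
    define yR where "yR t = (1/2) *\<^sub>R (x1 t + x2 t) + (t - (T - \<delta>)) *\<^sub>R k" for t
    assume "\<And>t. t \<in> {T-\<delta>..T} \<Longrightarrow> x1 t + (t - (T - \<delta>)) *\<^sub>R k \<in> \<phi> ` U"
      and "\<And>t. t \<in> {T..T+\<delta>} \<Longrightarrow> (1/2) *\<^sub>R (x1 t + x2 t) + (t - (T - \<delta>)) *\<^sub>R k \<in> \<phi> ` U"
    then have L: "\<And>t. t \<in> {T-\<delta>..T} \<Longrightarrow> yL t \<in> \<phi> ` U" and R: "\<And>t. t \<in> {T..T+\<delta>} \<Longrightarrow> yR t \<in> \<phi> ` U"
      by (simp_all add: yL_def yR_def)
    define IL where "IL = integral {T-\<delta>..T} (\<lambda>t. cost (yL t) (x1' t + k))"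
    define IR where "IR = integral {T..T+\<delta>} (\<lambda>t. cost (yR t) ((1/2) *\<^sub>R (x1' t + x2' t) + k))"
    have thL: "thick {T-\<delta>..T}" and thR: "thick {T..T+\<delta>}" using \<delta> by (auto intro: thick_Icc)
    have subs: "{T-\<delta>..T} \<subseteq> {T-d..T+d}" "{T..T+\<delta>} \<subseteq> {T-d..T+d}" "{T..T+\<delta>} \<subseteq> {T..T+d}" using \<delta> d by auto
    have lin: "smooth_on I (\<lambda>t. (t - (T - \<delta>)) *\<^sub>R k)" if "thick I" for I
      by (intro smooth_on_scaleR smooth_on_diff smooth_on_const smooth_on_bounded_linear that bounded_linear_ident)
    have "smooth_on {T-\<delta>..T} yL" unfolding yL_def
      by (intro smooth_on_add lin thL smooth_on_subset[OF x1(1) subs(1)])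
    moreover have "(yL has_vector_derivative (x1' t + k)) (at t within {T-\<delta>..T})" if t: "t \<in> {T-\<delta>..T}" for t
    proof -
      have "(x1 has_vector_derivative x1' t) (at t within {T-\<delta>..T})"
        using x1(2)[of t] t subs(1) by (auto intro: has_vector_derivative_within_subset)
      then show ?thesis unfolding yL_def by (auto intro!: derivative_eq_intros)
    qed
    ultimately have tL: "travel (\<lambda>t. inv_into U \<phi> (yL t)) (T - \<delta>) T IL"
      unfolding IL_def using travel_chart[OF c(1) _ L] \<delta> by simp
    have "smooth_on {T..T+\<delta>} yR" unfolding yR_def
      by (intro smooth_on_add smooth_on_scaleR smooth_on_const lin thR
        smooth_on_subset[OF x1(1) subs(2)] smooth_on_subset[OF x2(1) subs(3)])
    moreover have "(yR has_vector_derivative ((1/2) *\<^sub>R (x1' t + x2' t) + k)) (at t within {T..T+\<delta>})"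
      if t: "t \<in> {T..T+\<delta>}" for t
    proof -
      have "(x1 has_vector_derivative x1' t) (at t within {T..T+\<delta>})"
        "(x2 has_vector_derivative x2' t) (at t within {T..T+\<delta>})"
        using x1(2)[of t] x2(2)[of t] t subs by (auto intro: has_vector_derivative_within_subset)
      then show ?thesis unfolding yR_def by (auto intro!: derivative_eq_intros)
    qed
    ultimately have tR: "travel (\<lambda>t. inv_into U \<phi> (yR t)) T (T + \<delta>) IR"
      unfolding IR_def using travel_chart[OF c(1) _ R] \<delta> by simp
    define K where "K t = inv_into U \<phi> (if t \<le> T then yL t else yR t)" for t
    have LR: "yL T = yR T" using jx by (simp add: yL_def yR_def)
    have "travel K (T - \<delta>) T IL" by (rule travel_cong[OF tL]) (simp add: K_def)
    moreover have "travel K T (T + \<delta>) IR" by (rule travel_cong[OF tR]) (use LR in \<open>auto simp: K_def\<close>)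
    ultimately have tK: "travel K (T - \<delta>) (T + \<delta>) (IL + IR)" by (rule travel_append)
    have K0: "K (T - \<delta>) = \<sigma> (T - \<delta>)" using inv[of "T - \<delta>"] \<delta> by (simp add: K_def yL_def)
    have K1: "K (T + \<delta>) = \<gamma> (T + \<delta>) \<or> K (T + \<delta>) = \<sigma> (T + \<delta>)"
    proof -
      have c4: "c' = 1 / (4 * \<delta>) \<or> c' = - (1 / (4 * \<delta>))" using c' by linarith
      have e: "(T + \<delta> - (T - \<delta>)) *\<^sub>R k = (2 * \<delta> * c') *\<^sub>R (x2 (T + \<delta>) - x1 (T + \<delta>))" by (simp add: k)
      have "2 * \<delta> * c' = 1/2 \<or> 2 * \<delta> * c' = - 1/2" using c4 \<delta>(1) by auto
      then have "yR (T + \<delta>) = x2 (T + \<delta>) \<or> yR (T + \<delta>) = x1 (T + \<delta>)"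
      proof
        assume h: "2 * \<delta> * c' = 1/2"
        have "yR (T + \<delta>) = (1/2) *\<^sub>R (x2 (T + \<delta>) + x2 (T + \<delta>))"
          unfolding yR_def e h by (simp add: scaleR_right_distrib scaleR_right_diff_distrib del: scaleR_half_double)
        then show ?thesis by simp
      next
        assume h: "2 * \<delta> * c' = - 1/2"
        have "yR (T + \<delta>) = (1/2) *\<^sub>R (x1 (T + \<delta>) + x1 (T + \<delta>))"
          unfolding yR_def e h by (simp add: scaleR_right_distrib scaleR_right_diff_distrib del: scaleR_half_double)
        then show ?thesis by simp
      qed
      then show ?thesis using inv[of "T + \<delta>"] inv2[of "T + \<delta>"] \<delta> by (auto simp: K_def)
    qed
    have "fdist_from X \<A> F A (K (T - \<delta>)) \<le> ereal (T - \<delta>)"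
      unfolding K0 using \<sigma>(3)[of "T - \<delta>"] \<delta> d T by simp
    from fdist_from_le_travel[OF tK _ this]
    have "fdist_from X \<A> F A (K (T + \<delta>)) \<le> ereal (T - \<delta> + (IL + IR))" using \<delta> by simp
    moreover have "fdist_from X \<A> F A (K (T + \<delta>)) = ereal (T + \<delta>)"
      using K1 \<sigma>(3)[of "T + \<delta>"] \<gamma>(3)[of "T + \<delta>"] \<delta> d T by auto
    ultimately have "T + \<delta> \<le> T - \<delta> + (IL + IR)" by simp
    then have "2 * \<delta> \<le> IL + IR" by simp
    then show "2 * \<delta> \<le> integral {T-\<delta>..T} (\<lambda>t. cost (x1 t + (t - (T - \<delta>)) *\<^sub>R k) (x1' t + k))
         + integral {T..T+\<delta>} (\<lambda>t. cost ((1/2) *\<^sub>R (x1 t + x2 t) + (t - (T - \<delta>)) *\<^sub>R k)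
             ((1/2) *\<^sub>R (x1' t + x2' t) + k))"
      unfolding IL_def IR_def yL_def yR_def .
  qed
  then obtain \<delta> where \<delta>: "\<delta> > 0" "\<delta> \<le> d" "\<And>t. t \<in> {T..T+\<delta>} \<Longrightarrow> x2 t = x1 t" by blast
  have "\<gamma> t = \<sigma> t" if t: "t \<in> {T..T+\<delta>}" for t
    using inv[of t] inv2[of t] \<delta>(2) \<delta>(3)[OF t] t d by auto
  then show ?thesis using \<delta> d by (intro exI[of _ \<delta>]) auto
qed

lemma normal_geodesic_restrict:
  assumes "normal_geodesic X \<A> F A r \<sigma>" "0 < \<tau>" "\<tau> \<le> r" "\<And>t. t \<in> {0..\<tau>} \<Longrightarrow> \<gamma> t = \<sigma> t"
  shows "normal_geodesic X \<A> F A \<tau> \<gamma>"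
proof -
  have sub: "{0..\<tau>} \<subseteq> {0..r}" using assms(3) by auto
  have geo: "F_geodesic X \<A> F 0 r \<sigma>" and u: "unit_speed \<A> F {0..r} \<sigma>" and 0: "\<sigma> 0 \<in> A"
    and o: "F_orthogonal X \<A> F A (\<sigma> 0) (velocity \<A> {0..r} \<sigma> 0)"
    using assms(1) by (auto simp: normal_geodesic_def)
  have s: "smooth_curve X \<A> {0..r} \<sigma>" using geo by (simp add: F_geodesic_def)
  have s\<tau>: "smooth_curve X \<A> {0..\<tau>} \<sigma>" by (rule smooth_curve_subset[OF s sub assms(2) refl])
  then have g: "smooth_curve X \<A> {0..\<tau>} \<gamma>" using smooth_curve_cong assms(4) by metis
  have vel: "velocity \<A> {0..\<tau>} \<gamma> t = velocity \<A> {0..r} \<sigma> t" if t: "t \<in> {0..\<tau>}" for t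
    using velocity_cong[of "{0..\<tau>}" \<gamma> \<sigma>, OF assms(4) t] velocity_subset[OF s thick_Icc[OF assms(2)] sub t] by simp
  have tt: "travel_time \<A> F a b \<gamma> = travel_time \<A> F a b \<sigma>" if "a \<in> {0..\<tau>}" "b \<in> {0..\<tau>}" for a b
    unfolding travel_time_def using velocity_cong[of "{a..b}" \<gamma> \<sigma>] assms(4) that
    by (intro integral_cong) auto
  have "F_geodesic X \<A> F 0 \<tau> \<gamma>" unfolding F_geodesic_def
  proof (intro conjI g ballI)
    fix t assume t: "t \<in> {0..\<tau>}"
    then obtain \<epsilon> where \<epsilon>: "\<epsilon> > 0" "\<And>s u. s \<in> {0..r} \<Longrightarrow> u \<in> {0..r} \<Longrightarrow> \<bar>s - t\<bar> < \<epsilon> \<and> \<bar>u - t\<bar> < \<epsilon> \<and> s < u \<Longrightarrow>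
        fdist X \<A> F (\<sigma> s) (\<sigma> u) = ereal (travel_time \<A> F s u \<sigma>)"
      using geo sub unfolding F_geodesic_def by blast
    show "\<exists>\<epsilon>>0. \<forall>s\<in>{0..\<tau>}. \<forall>u\<in>{0..\<tau>}. \<bar>s - t\<bar> < \<epsilon> \<and> \<bar>u - t\<bar> < \<epsilon> \<and> s < u \<longrightarrow>
        fdist X \<A> F (\<gamma> s) (\<gamma> u) = ereal (travel_time \<A> F s u \<gamma>)"
      by (intro exI[of _ \<epsilon>] conjI \<epsilon>(1) ballI impI) (use \<epsilon>(2) sub assms(4) tt in auto)
  qed
  moreover have "unit_speed \<A> F {0..\<tau>} \<gamma>"
    unfolding unit_speed_def using u sub assms(4) vel by (auto simp: unit_speed_def)
  moreover have "\<gamma> 0 = \<sigma> 0" "velocity \<A> {0..\<tau>} \<gamma> 0 = velocity \<A> {0..r} \<sigma> 0"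
    using assms(2,4) vel by auto
  ultimately show ?thesis using 0 o by (simp add: normal_geodesic_def)
qed

lemma normal_geodesic_extend:
  assumes "no_cut_loci_until X \<A> F A r" "normal_geodesic X \<A> F A \<tau> \<gamma>" "0 < \<tau>" "\<tau> \<le> r"
  obtains \<sigma> where "normal_geodesic X \<A> F A r \<sigma>" "\<And>t. t \<in> {0..\<tau>} \<Longrightarrow> \<sigma> t = \<gamma> t"
    "\<And>t. t \<in> {0..r} \<Longrightarrow> fdist_from X \<A> F A (\<sigma> t) = ereal t"
proof -
  have "min \<tau> r = \<tau>" using assms(4) by simp
  then show thesis using assms(1-3) that unfolding no_cut_loci_until_def by metis
qed

lemma normal_geodesic_imp_wave_ray:
  assumes "no_cut_loci_until X \<A> F A r" "normal_geodesic X \<A> F A \<tau> \<gamma>" "0 < \<tau>" "\<tau> \<le> r"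
  shows "wave_ray X \<A> F A \<tau> \<gamma>"
proof -
  obtain \<sigma> where \<sigma>: "\<And>t. t \<in> {0..\<tau>} \<Longrightarrow> \<sigma> t = \<gamma> t" "\<And>t. t \<in> {0..r} \<Longrightarrow> fdist_from X \<A> F A (\<sigma> t) = ereal t"
    using normal_geodesic_extend[OF assms] by metis
  have "fdist_from X \<A> F A (\<gamma> t) = ereal t" if "t \<in> {0..\<tau>}" for t
    using \<sigma>(1)[OF that] \<sigma>(2)[of t] that assms(4) by auto
  then show ?thesis
    using assms(2) piecewise_single[OF assms(3), of "\<lambda>I. smooth_curve X \<A> I \<gamma> \<and> unit_speed \<A> F I \<gamma>"]
    unfolding wave_ray_def normal_geodesic_def F_geodesic_def by blast
qed

text \<open>
  The first smooth piece of the ray is a normal geodesic and extends to a normal geodesic \<open>\<sigma>\<close> on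
  \<open>{0..r}\<close>.  The ray follows \<open>\<sigma>\<close> through all of its pieces: the last time \<open>T\<close> of agreement within a
  piece is attained since \<open>X\<close> is a Hausdorff space, and it is the end of the piece since the two curves
  do not branch.  In particular the ray is smooth.
\<close>

lemma wave_ray_imp_normal_geodesic:
  assumes cut: "no_cut_loci_until X \<A> F A r" and ray: "wave_ray X \<A> F A \<tau> \<gamma>" and \<tau>: "0 < \<tau>" "\<tau> \<le> r"
  shows "normal_geodesic X \<A> F A \<tau> \<gamma>"
proof -
  have pw: "piecewise (\<lambda>I. smooth_curve X \<A> I \<gamma> \<and> unit_speed \<A> F I \<gamma>) 0 \<tau>" and \<gamma>0: "\<gamma> 0 \<in> A"
    and on_time: "\<And>t. t \<in> {0..\<tau>} \<Longrightarrow> fdist_from X \<A> F A (\<gamma> t) = ereal t"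
    using ray by (auto simp: wave_ray_def)
  obtain t1 where t1: "0 < t1" "t1 \<le> \<tau>" "smooth_curve X \<A> {0..t1} \<gamma>" "unit_speed \<A> F {0..t1} \<gamma>"
  proof -
    have "(\<tau> = 0 \<or> (\<exists>t1>0. t1 \<le> \<tau> \<and> smooth_curve X \<A> {0..t1} \<gamma> \<and> unit_speed \<A> F {0..t1} \<gamma>)) \<and> 0 \<le> \<tau>"
      by (rule piecewise_induct[OF pw, of "\<lambda>u. u = 0 \<or> (\<exists>t1>0. t1 \<le> \<tau> \<and> smooth_curve X \<A> {0..t1} \<gamma> \<and> unit_speed \<A> F {0..t1} \<gamma>)"])
        auto
    then show thesis using that \<tau> by auto
  qed
  have "normal_geodesic X \<A> F A t1 \<gamma>"
    by (rule on_time_normal_geodesic[OF t1(3,4) \<gamma>0 t1(1) on_time]) (use t1 in auto)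
  then obtain \<sigma> where \<sigma>: "normal_geodesic X \<A> F A r \<sigma>" "\<And>t. t \<in> {0..t1} \<Longrightarrow> \<sigma> t = \<gamma> t"
    "\<And>t. t \<in> {0..r} \<Longrightarrow> fdist_from X \<A> F A (\<sigma> t) = ereal t"
    using normal_geodesic_extend[OF cut _ t1(1) order.trans[OF t1(2) \<tau>(2)]] by blast
  have s\<sigma>: "smooth_curve X \<A> {0..r} \<sigma>" "unit_speed \<A> F {0..r} \<sigma>"
    using \<sigma>(1) by (auto simp: normal_geodesic_def F_geodesic_def)
  have "(\<forall>t\<in>{0..\<tau>}. \<gamma> t = \<sigma> t) \<and> 0 \<le> \<tau>"
  proof (rule piecewise_induct[OF pw, of "\<lambda>u. \<forall>t\<in>{0..u}. \<gamma> t = \<sigma> t"])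
    show "\<forall>t\<in>{0..0}. \<gamma> t = \<sigma> t" using \<sigma>(2)[of 0] t1 by auto
    fix u v assume IH: "\<forall>t\<in>{0..u}. \<gamma> t = \<sigma> t" and uv: "0 \<le> u" "u < v" "v \<le> \<tau>"
      and "smooth_curve X \<A> {u..v} \<gamma> \<and> unit_speed \<A> F {u..v} \<gamma>"
    then have g: "smooth_curve X \<A> {u..v} \<gamma>" "unit_speed \<A> F {u..v} \<gamma>" by blast+
    define Z where "Z = {t\<in>{u..v}. \<forall>s\<in>{0..t}. \<gamma> s = \<sigma> s}"
    have uZ: "u \<in> Z" using IH uv by (auto simp: Z_def)
    have bdd: "bdd_above Z" by (rule bdd_aboveI[of _ v]) (auto simp: Z_def)
    define T where "T = Sup Z"
    have uT: "u \<le> T" unfolding T_def by (rule cSup_upper[OF uZ bdd])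
    have Tv: "T \<le> v" unfolding T_def by (rule cSup_least) (use uZ in \<open>auto simp: Z_def\<close>)
    have below: "\<gamma> s = \<sigma> s" if s: "0 \<le> s" "s < T" for s
    proof -
      obtain t where "t \<in> Z" "s < t" using s(2) less_cSupE[of s Z] uZ unfolding T_def by blast
      then show ?thesis using s(1) by (auto simp: Z_def)
    qed
    have "\<gamma> T = \<sigma> T"
    proof (cases "u < T")
      case True
      have closure: "T \<in> (top_of_set {u..T}) closure_of {u..<T}"
      proof -
        have "{u..T} \<inter> {u..<T} = {u..<T}" by auto
        then show ?thesis using True by (simp add: closure_of_subtopology)
      qed
      have sg: "smooth_curve X \<A> {u..T} \<gamma>" by (rule smooth_curve_subset[OF g(1) _ True refl]) (use Tv in auto)
      have ss: "smooth_curve X \<A> {u..T} \<sigma>" by (rule smooth_curve_subset[OF s\<sigma>(1) _ True refl]) (use Tv uv \<tau> in auto)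
      show ?thesis
        by (rule forall_in_closure_of_eq[OF closure manifoldD(1)])
          (use sg ss below uv in \<open>auto simp: smooth_curve_def\<close>)
    next
      case False
      then show ?thesis using IH uT uv by auto
    qed
    then have "\<gamma> s = \<sigma> s" if "s \<in> {0..T}" for s
      using below[of s] that by (cases "s = T") auto
    then have TZ: "T \<in> Z" using uT Tv by (simp add: Z_def)
    \<comment> \<open>branching is excluded at positive times only; at time \<open>0\<close> the first piece helps\<close>
    have T0: "T > 0"
    proof (cases "u > 0")
      case True
      then show ?thesis using uT by simp
    next
      case False
      then have "min t1 v \<in> Z" using uv t1 \<sigma>(2) by (auto simp: Z_def)
      then have "min t1 v \<le> T" unfolding T_def by (rule cSup_upper[OF _ bdd])
      then show ?thesis using t1 uv by linarith
    qed
    have "T = v"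
    proof (rule ccontr)
      assume "T \<noteq> v"
      then have lt: "T < v" using Tv by simp
      have sub: "{T..v} \<subseteq> {u..v}" using uT by auto
      have "\<exists>\<delta>>0. T + \<delta> \<le> v \<and> (\<forall>t\<in>{T..T+\<delta>}. \<gamma> t = \<sigma> t)"
      proof (rule on_time_curves_do_not_branch[OF T0 lt _ s\<sigma> \<sigma>(3)])
        show "smooth_curve X \<A> {T..v} \<gamma>" by (rule smooth_curve_subset[OF g(1) sub lt refl])
        show "unit_speed \<A> F {T..v} \<gamma>" by (rule unit_speed_subset[OF g thick_Icc[OF lt] sub])
        show "fdist_from X \<A> F A (\<gamma> t) = ereal t" if "t \<in> {T..v}" for t
          using on_time[of t] that T0 uv by auto
      qed (use \<open>\<gamma> T = \<sigma> T\<close> uv \<tau> in auto)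
      then obtain \<delta> where \<delta>: "\<delta> > 0" "T + \<delta> \<le> v" "\<And>t. t \<in> {T..T+\<delta>} \<Longrightarrow> \<gamma> t = \<sigma> t" by blast
      have "\<gamma> s = \<sigma> s" if "s \<in> {0..T+\<delta>}" for s
        using below[of s] \<delta>(3)[of s] that by (cases "s < T") auto
      then have "T + \<delta> \<in> Z" using \<delta> uT by (auto simp: Z_def)
      then have "T + \<delta> \<le> T" unfolding T_def by (rule cSup_upper[OF _ bdd])
      then show False using \<delta>(1) by simp
    qed
    then show "\<forall>t\<in>{0..v}. \<gamma> t = \<sigma> t" using TZ by (simp add: Z_def)
  qed
  then show ?thesis using normal_geodesic_restrict[OF \<sigma>(1) \<tau>] by blast
qed

end

section \<open>Strategic paths\<close>

context zermelo_manifold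
begin

lemma wave_ray_iff_normal_geodesic:
  assumes "no_cut_loci_until X \<A> F A r" "0 < \<tau>" "\<tau> \<le> r"
  shows "wave_ray X \<A> F A \<tau> \<gamma> \<longleftrightarrow> normal_geodesic X \<A> F A \<tau> \<gamma>"
  using wave_ray_imp_normal_geodesic[OF assms(1) _ assms(2,3)]
    normal_geodesic_imp_wave_ray[OF assms(1) _ assms(2,3)] by blast

lemma wave_ray_wavefront:
  assumes "no_cut_loci_until X \<A> F A r" "0 < \<tau>" "\<tau> \<le> r" "wave_ray X \<A> F A \<tau> \<gamma>" "t \<in> {0..\<tau>}"
  shows "\<gamma> t \<in> wavefront X \<A> F A t"
proof -
  have "smooth_curve X \<A> {0..\<tau>} \<gamma>"
    using wave_ray_imp_normal_geodesic[OF assms(1,4,2,3)] by (simp add: normal_geodesic_def F_geodesic_def)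
  then show ?thesis
    using smooth_curve_in_topspace assms(4,5) by (auto simp: wavefront_def wave_ray_def)
qed

lemma reached_exactly_once:
  assumes "no_cut_loci_until X \<A> F A r" "0 < \<tau>" "\<tau> \<le> r" "q \<in> wavefront X \<A> F A \<tau>"
  obtains \<gamma> where "normal_geodesic X \<A> F A r \<gamma>" "\<gamma> \<tau> = q"
    "\<And>\<sigma> t. normal_geodesic X \<A> F A r \<sigma> \<Longrightarrow> \<sigma> \<tau> = q \<Longrightarrow> t \<in> {0..r} \<Longrightarrow> \<sigma> t = \<gamma> t"
proof -
  have q: "q \<in> topspace X" "fdist_from X \<A> F A q = ereal \<tau>" using assms(4) by (auto simp: wavefront_def)
  note cut = conjunct2[OF assms(1)[unfolded no_cut_loci_until_def]]
  have "0 < \<tau> \<and> \<tau> \<le> r \<and> fdist_from X \<A> F A q = ereal \<tau>" using assms(2,3) q(2) by blast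
  from mp[OF spec[OF bspec[OF cut q(1)]] this] show thesis using that by blast
qed

lemma normal_geodesic_reaches:
  assumes cut: "no_cut_loci_until X \<A> F A r" and \<tau>: "0 < \<tau>" "\<tau> \<le> r" and q: "q \<in> wavefront X \<A> F A \<tau>"
  obtains \<gamma> where "normal_geodesic X \<A> F A \<tau> \<gamma>" "\<gamma> \<tau> = q"
proof -
  obtain \<gamma> where \<gamma>: "normal_geodesic X \<A> F A r \<gamma>" "\<gamma> \<tau> = q"
    using reached_exactly_once[OF cut \<tau> q] .
  show thesis using normal_geodesic_restrict[OF \<gamma>(1) \<tau>] \<gamma>(2) that by blast
qed

text \<open>
  The standing assumption gives uniqueness among the geodesics defined on all of \<open>{0..r}\<close>, to which
  those on \<open>{0..\<tau>}\<close> extend.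
\<close>

lemma normal_geodesic_unique:
  assumes cut: "no_cut_loci_until X \<A> F A r" and \<tau>: "0 < \<tau>" "\<tau> \<le> r"
    and \<gamma>: "normal_geodesic X \<A> F A \<tau> \<gamma>" and \<sigma>: "normal_geodesic X \<A> F A \<tau> \<sigma>" and eq: "\<gamma> \<tau> = \<sigma> \<tau>"
    and t: "t \<in> {0..\<tau>}"
  shows "\<gamma> t = \<sigma> t"
proof -
  obtain \<gamma>' where \<gamma>': "normal_geodesic X \<A> F A r \<gamma>'" "\<And>t. t \<in> {0..\<tau>} \<Longrightarrow> \<gamma>' t = \<gamma> t"
      "\<And>t. t \<in> {0..r} \<Longrightarrow> fdist_from X \<A> F A (\<gamma>' t) = ereal t"
    by (rule normal_geodesic_extend[OF cut \<gamma> \<tau>], rule that, blast+)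
  obtain \<sigma>' where \<sigma>': "normal_geodesic X \<A> F A r \<sigma>'" "\<And>t. t \<in> {0..\<tau>} \<Longrightarrow> \<sigma>' t = \<sigma> t"
      "\<And>t. t \<in> {0..r} \<Longrightarrow> fdist_from X \<A> F A (\<sigma>' t) = ereal t"
    by (rule normal_geodesic_extend[OF cut \<sigma> \<tau>], rule that, blast+)
  have \<tau>': "\<tau> \<in> {0..\<tau>}" using \<tau> by simp
  have "\<gamma> \<tau> \<in> wavefront X \<A> F A \<tau>"
    by (rule wave_ray_wavefront[OF cut \<tau> normal_geodesic_imp_wave_ray[OF cut \<gamma> \<tau>] \<tau>'])
  then obtain \<kappa> where \<kappa>: "\<And>\<sigma> t. normal_geodesic X \<A> F A r \<sigma> \<Longrightarrow> \<sigma> \<tau> = \<gamma> \<tau> \<Longrightarrow> t \<in> {0..r} \<Longrightarrow> \<sigma> t = \<kappa> t"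
    using reached_exactly_once[OF cut \<tau>] by metis
  have "t \<in> {0..r}" using t \<tau> by auto
  then have "\<gamma>' t = \<kappa> t" "\<sigma>' t = \<kappa> t"
    using \<kappa>[OF \<gamma>'(1), of t] \<kappa>[OF \<sigma>'(1), of t] \<gamma>'(2)[OF \<tau>'] \<sigma>'(2)[OF \<tau>'] eq by simp_all
  then show ?thesis using \<gamma>'(2)[OF t] \<sigma>'(2)[OF t] by simp
qed

text \<open>
  The geodesic that reaches an interior point of \<open>B\<close> at time \<open>\<tau>\<close> is in the interior of \<open>B\<close> shortly before
  \<open>\<tau>\<close>, hence on an earlier wavefront that meets \<open>B\<close>.
\<close>

lemma first_contact_at_frontier:
  assumes cut: "no_cut_loci_until X \<A> F A r" and \<tau>: "0 < \<tau>" "\<tau> \<le> r"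
    and first: "first_meeting_time X \<A> F A B \<tau>" and q: "q \<in> wavefront X \<A> F A \<tau>" "q \<in> X closure_of B"
  shows "q \<in> X frontier_of B"
proof (rule ccontr)
  assume "q \<notin> X frontier_of B"
  then have int: "q \<in> X interior_of B" using q(2) by (simp add: frontier_of_def)
  obtain \<gamma> where \<gamma>: "normal_geodesic X \<A> F A \<tau> \<gamma>" "\<gamma> \<tau> = q" using normal_geodesic_reaches[OF cut \<tau> q(1)] .
  have "continuous_map (top_of_set {0..\<tau>}) X \<gamma>"
    using \<gamma>(1) by (simp add: normal_geodesic_def F_geodesic_def smooth_curve_def)
  from openin_continuous_map_preimage[OF this openin_interior_of]
  have "openin (top_of_set {0..\<tau>}) {t\<in>{0..\<tau>}. \<gamma> t \<in> X interior_of B}" by simp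
  then obtain T where T: "open T" "{t\<in>{0..\<tau>}. \<gamma> t \<in> X interior_of B} = {0..\<tau>} \<inter> T" by (auto simp: openin_open)
  have "\<tau> \<in> {t\<in>{0..\<tau>}. \<gamma> t \<in> X interior_of B}" using int \<gamma>(2) \<tau>(1) by simp
  then have "\<tau> \<in> T" unfolding T(2) by blast
  then obtain e where e: "e > 0" "ball \<tau> e \<subseteq> T" using T(1) open_contains_ball by blast
  define s where "s = max 0 (\<tau> - e / 2)"
  have s: "s \<in> {0..<\<tau>}" "s \<in> {0..\<tau>}" using e(1) \<tau> by (auto simp: s_def)
  have "s \<in> T" using e \<tau> by (auto simp: s_def dist_real_def max_def intro!: subsetD[OF e(2)])
  then have "\<gamma> s \<in> X interior_of B" using T(2) s(2) by blast
  then have "\<gamma> s \<in> X closure_of B"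
    using interior_of_subset_closure_of by fastforce
  moreover have "\<gamma> s \<in> wavefront X \<A> F A s"
    by (rule wave_ray_wavefront[OF cut \<tau> normal_geodesic_imp_wave_ray[OF cut \<gamma>(1) \<tau>] s(2)])
  ultimately show False using first s(1) unfolding first_meeting_time_def by blast
qed

end

theorem corollary3p7:
  fixes X :: "'m topology"
    and \<A> :: "('m, 'e::euclidean_space) chart set"
    and h :: "'m \<Rightarrow> ('m, 'e) tvec \<Rightarrow> ('m, 'e) tvec \<Rightarrow> real"
    and W :: "'m \<Rightarrow> ('m, 'e) tvec"
    and F :: "'m \<Rightarrow> ('m, 'e) tvec \<Rightarrow> real"
    and A :: "'m set"
    and r :: real
  assumes "smooth_manifold X \<A>"
    and "riemannian_metric \<A> h"
    and "smooth_vector_field \<A> W"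
    and "\<And>p. p \<in> topspace X \<Longrightarrow> h p (W p) (W p) < 1"
    and "F = randers_metric h W"
    and "compactin X A"
    and "submanifold \<A> A"
    and "0 < r"
    and "no_cut_loci_until X \<A> F A r"
  shows
    "(\<forall>x \<tau> \<gamma>. (topspace X, x) \<in> \<A> \<and> 0 < \<tau> \<and> \<tau> \<le> r \<longrightarrow>
        (strategic_path_until X \<A> F A x \<tau> \<gamma> \<longleftrightarrow>
           normal_geodesic X \<A> F A \<tau> \<gamma> \<and>
           (\<forall>\<sigma>. normal_geodesic X \<A> F A \<tau> \<sigma> \<longrightarrow>
              norm (x (\<sigma> \<tau>) - x (\<sigma> 0)) \<le> norm (x (\<gamma> \<tau>) - x (\<gamma> 0)))))
     \<and>
     (\<forall>\<tau> q. 0 < \<tau> \<and> \<tau> \<le> r \<and> q \<in> wavefront X \<A> F A \<tau> \<longrightarrow>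
        (\<forall>\<gamma>. strategic_path_to_point X \<A> F A q \<tau> \<gamma> \<longleftrightarrow>
           normal_geodesic X \<A> F A \<tau> \<gamma> \<and> \<gamma> \<tau> = q) \<and>
        (\<exists>\<gamma>. strategic_path_to_point X \<A> F A q \<tau> \<gamma>) \<and>
        (\<forall>\<gamma> \<sigma>. strategic_path_to_point X \<A> F A q \<tau> \<gamma> \<and>
           strategic_path_to_point X \<A> F A q \<tau> \<sigma> \<longrightarrow> (\<forall>t\<in>{0..\<tau>}. \<gamma> t = \<sigma> t)))
     \<and>
     (\<forall>B \<tau>. B \<subseteq> topspace X \<and> 0 < \<tau> \<and> \<tau> \<le> r \<and> first_meeting_time X \<A> F A B \<tau> \<longrightarrow>
        (\<forall>\<gamma>. strategic_path_to_area X \<A> F A B \<tau> \<gamma> \<longleftrightarrow>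
           (\<exists>q \<in> wavefront X \<A> F A \<tau> \<inter> X frontier_of B.
              normal_geodesic X \<A> F A \<tau> \<gamma> \<and> \<gamma> \<tau> = q)) \<and>
        (\<exists>\<gamma>. strategic_path_to_area X \<A> F A B \<tau> \<gamma>) \<and>
        (\<forall>\<gamma> \<sigma>. strategic_path_to_area X \<A> F A B \<tau> \<gamma> \<and>
           strategic_path_to_area X \<A> F A B \<tau> \<sigma> \<and> \<gamma> \<tau> = \<sigma> \<tau> \<longrightarrow>
           (\<forall>t\<in>{0..\<tau>}. \<gamma> t = \<sigma> t)))"
proof -
  interpret zermelo_manifold X \<A> h W F by unfold_locales (fact assms)+
  note cut = assms(9)
  note iff = wave_ray_iff_normal_geodesic[OF cut]
  have until: "strategic_path_until X \<A> F A x \<tau> \<gamma> \<longleftrightarrow>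
           normal_geodesic X \<A> F A \<tau> \<gamma> \<and>
           (\<forall>\<sigma>. normal_geodesic X \<A> F A \<tau> \<sigma> \<longrightarrow>
              norm (x (\<sigma> \<tau>) - x (\<sigma> 0)) \<le> norm (x (\<gamma> \<tau>) - x (\<gamma> 0)))"
    if "0 < \<tau>" "\<tau> \<le> r" for x \<tau> \<gamma>
    unfolding strategic_path_until_def iff[OF that] ..
  have point: "strategic_path_to_point X \<A> F A q \<tau> \<gamma> \<longleftrightarrow> normal_geodesic X \<A> F A \<tau> \<gamma> \<and> \<gamma> \<tau> = q"
    if "0 < \<tau>" "\<tau> \<le> r" "q \<in> wavefront X \<A> F A \<tau>" for q \<tau> \<gamma>
    using that(3) unfolding strategic_path_to_point_def iff[OF that(1,2)] by blast
  have area: "strategic_path_to_area X \<A> F A B \<tau> \<gamma> \<longleftrightarrow>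
           (\<exists>q \<in> wavefront X \<A> F A \<tau> \<inter> X frontier_of B. normal_geodesic X \<A> F A \<tau> \<gamma> \<and> \<gamma> \<tau> = q)"
    if \<tau>: "0 < \<tau>" "\<tau> \<le> r" "first_meeting_time X \<A> F A B \<tau>" for B \<tau> \<gamma>
  proof -
    have "\<gamma> \<tau> \<in> wavefront X \<A> F A \<tau>" if "wave_ray X \<A> F A \<tau> \<gamma>"
      using wave_ray_wavefront[OF cut \<tau>(1,2) that] \<tau>(1) by simp
    then show ?thesis
      using \<tau>(3) iff[OF \<tau>(1,2)] unfolding strategic_path_to_area_def by blast
  qed
  have area_ex: "\<exists>\<gamma>. strategic_path_to_area X \<A> F A B \<tau> \<gamma>"
    if \<tau>: "0 < \<tau>" "\<tau> \<le> r" "first_meeting_time X \<A> F A B \<tau>" for B \<tau>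
  proof -
    obtain q where q: "q \<in> wavefront X \<A> F A \<tau>" "q \<in> X closure_of B"
      using \<tau>(3) unfolding first_meeting_time_def by blast
    have "q \<in> X frontier_of B" by (rule first_contact_at_frontier[OF cut \<tau> q])
    moreover obtain \<gamma> where "normal_geodesic X \<A> F A \<tau> \<gamma>" "\<gamma> \<tau> = q"
      using normal_geodesic_reaches[OF cut \<tau>(1,2) q(1)] .
    ultimately show ?thesis
      unfolding area[OF \<tau>] using q(1) by blast
  qed
  show ?thesis
  proof (intro conjI allI impI; (elim conjE)?)
    fix x \<tau> \<gamma> assume "0 < \<tau>" "\<tau> \<le> r"
    then show "strategic_path_until X \<A> F A x \<tau> \<gamma> \<longleftrightarrow>
           normal_geodesic X \<A> F A \<tau> \<gamma> \<and>
           (\<forall>\<sigma>. normal_geodesic X \<A> F A \<tau> \<sigma> \<longrightarrow>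
              norm (x (\<sigma> \<tau>) - x (\<sigma> 0)) \<le> norm (x (\<gamma> \<tau>) - x (\<gamma> 0)))" by (rule until)
  next
    fix \<tau> q \<gamma> assume \<tau>: "0 < \<tau>" "\<tau> \<le> r" "q \<in> wavefront X \<A> F A \<tau>"
    show "strategic_path_to_point X \<A> F A q \<tau> \<gamma> \<longleftrightarrow> normal_geodesic X \<A> F A \<tau> \<gamma> \<and> \<gamma> \<tau> = q" by (rule point[OF \<tau>])
  next
    fix \<tau> q assume \<tau>: "0 < \<tau>" "\<tau> \<le> r" "q \<in> wavefront X \<A> F A \<tau>"
    show "\<exists>\<gamma>. strategic_path_to_point X \<A> F A q \<tau> \<gamma>"
      unfolding point[OF \<tau>] using normal_geodesic_reaches[OF cut \<tau>] by metis
  next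
    fix \<tau> q \<gamma> \<sigma> assume \<tau>: "0 < \<tau>" "\<tau> \<le> r" "q \<in> wavefront X \<A> F A \<tau>"
      and "strategic_path_to_point X \<A> F A q \<tau> \<gamma>" "strategic_path_to_point X \<A> F A q \<tau> \<sigma>"
    then show "\<forall>t\<in>{0..\<tau>}. \<gamma> t = \<sigma> t"
      unfolding point[OF \<tau>] using normal_geodesic_unique[OF cut \<tau>(1,2)] by metis
  next
    fix B \<tau> \<gamma> assume \<tau>: "0 < \<tau>" "\<tau> \<le> r" "first_meeting_time X \<A> F A B \<tau>"
    show "strategic_path_to_area X \<A> F A B \<tau> \<gamma> \<longleftrightarrow>
           (\<exists>q \<in> wavefront X \<A> F A \<tau> \<inter> X frontier_of B. normal_geodesic X \<A> F A \<tau> \<gamma> \<and> \<gamma> \<tau> = q)"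
      by (rule area[OF \<tau>])
  next
    fix B \<tau> assume \<tau>: "0 < \<tau>" "\<tau> \<le> r" "first_meeting_time X \<A> F A B \<tau>"
    show "\<exists>\<gamma>. strategic_path_to_area X \<A> F A B \<tau> \<gamma>" by (rule area_ex[OF \<tau>])
  next
    fix B \<tau> \<gamma> \<sigma> assume \<tau>: "0 < \<tau>" "\<tau> \<le> r" "first_meeting_time X \<A> F A B \<tau>"
      and "strategic_path_to_area X \<A> F A B \<tau> \<gamma>" "strategic_path_to_area X \<A> F A B \<tau> \<sigma>" "\<gamma> \<tau> = \<sigma> \<tau>"
    then show "\<forall>t\<in>{0..\<tau>}. \<gamma> t = \<sigma> t"
      unfolding area[OF \<tau>] using normal_geodesic_unique[OF cut \<tau>(1,2)] by metis
  qed
qed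

end
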